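(* Suppose that $e\ne2$ (that is, $e\in\{3,4,5,\dots\}\cup\{\infty\}$) and that $2$ is invertible in the integral domain $\mathcal{Z}$. Then $$\mathscr{R}_e(\mathfrak{A}_n)=\bigoplus_{\gamma\in Q^\varepsilon_n}\mathscr{R}_e(\mathfrak{A}_n)_\gamma ,$$ where $\mathscr{R}_e(\mathfrak{A}_n)_\gamma$ is the unital associative $\mathcal{Z}$-algebra generated by elements $$\{\Psi_r(\mathbf{i}),\,Y_s(\mathbf{i}),\,\varepsilon(\mathbf{i}) : 1\le r<n,\ 1\le s\le n\text{ and }\mathbf{i}\in I^\gamma\}$$ subject to the following relations, for all $\mathbf{i},\mathbf{j},\mathbf{k}\in I^\gamma$ and all admissible $r,s$ and $t$: $$Y_1(\mathbf{i})^{(\Lambda_0,\alpha_{i_1})}=0,\qquad \varepsilon(\mathbf{i})\varepsilon(\mathbf{j})=\delta_{\mathbf{i}\sim\mathbf{j}}\,\varepsilon(\mathbf{i}),\qquad \sum_{\mathbf{i}\in I^\gamma}\tfrac12\varepsilon(\mathbf{i})=1,$$ $$Y_r(-\mathbf{i})=-Y_r(\mathbf{i}),\qquad \Psi_r(-\mathbf{i})=-\Psi_r(\mathbf{i}),\qquad \varepsilon(-\mathbf{i})=\varepsilon(\mathbf{i}),$$ $$\varepsilon(\mathbf{i})Y_r(\mathbf{j})\varepsilon(\mathbf{k})=\delta_{\mathbf{i}\mathbf{j}}\delta_{\mathbf{j}\mathbf{k}}Y_r(\mathbf{j}),\qquad \varepsilon(\mathbf{i})\Psi_r(\mathbf{j})\varepsilon(\mathbf{k})=\delta_{s_r\cdot\mathbf{i},\mathbf{j}}\delta_{\mathbf{j}\mathbf{k}}\Psi_r(\mathbf{j}),\qquad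 Y_r(\mathbf{i})Y_s(\mathbf{j})=\delta_{\mathbf{i}\mathbf{j}}Y_s(\mathbf{i})Y_r(\mathbf{j}),$$ $$\Psi_r(\mathbf{i})Y_{r+1}(\mathbf{i})=Y_r(s_r\cdot\mathbf{i})\Psi_r(\mathbf{i})+\delta_{i_ri_{r+1}}\varepsilon(\mathbf{i}),\qquad Y_{r+1}(s_r\cdot\mathbf{i})\Psi_r(\mathbf{i})=\Psi_r(\mathbf{i})Y_r(\mathbf{i})+\delta_{i_ri_{r+1}}\varepsilon(\mathbf{i}),$$ $$\Psi_r(\mathbf{i})Y_s(\mathbf{i})=Y_s(s_r\cdot\mathbf{i})\Psi_r(\mathbf{i})\ \text{ if } s\ne r,r+1,\qquad \Psi_r(s_t\cdot\mathbf{i})\Psi_t(\mathbf{i})=\Psi_t(s_r\cdot\mathbf{i})\Psi_r(\mathbf{i})\ \text{ if } |r-t|>1,$$ $$\Psi_r(s_r\cdot\mathbf{i})\Psi_r(\mathbf{i})=\begin{cases}Y_r(\mathbf{i})-Y_{r+1}(\mathbf{i}),&\text{if } i_r\to i_{r+1},\\ Y_{r+1}(\mathbf{i})-Y_r(\mathbf{i}),&\text{if } i_r\leftarrow i_{r+1},\\ 0,&\text{if } i_r=i_{r+1},\\ \varepsilon(\mathbf{i}),&\text{otherwise,}\end{cases}$$ and $$\Psi_r(s_{r+1}s_r\cdot\mathbf{i})\Psi_{r+1}(s_r\cdot\mathbf{i})\Psi_r(\mathbf{i})-\Psi_{r+1}(s_rs_{r+1}\cdot\mathbf{i})\Psi_r(s_{r+1}\cdot\mathbf{i})\Psi_{r+1}(\mathbf{i})=\begin{cases}\varepsilon(\mathbf{i}),&\text{if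 } i_r=i_{r+2}\leftarrow i_{r+1},\\-\varepsilon(\mathbf{i}),&\text{if } i_r=i_{r+2}\to i_{r+1},\\0,&\text{otherwise.}\end{cases}$$
   Context: Fix $n\ge0$. Let $I=\mathbb{Z}/e\mathbb{Z}$ ($I=\mathbb{Z}$ if $e=\infty$), and let $\Gamma_e$ be the quiver with vertex set $I$ and edges $i\to i+1$. Let $Q^+=\bigoplus_{i\in I}\mathbb{N}\alpha_i$, $(\Lambda_0,\alpha_i)=\delta_{0i}$, and let $Q_n^+$ be the set of sums of $n$ simple roots. For $\alpha\in Q_n^+$ let $I^\alpha=\{\mathbf{i}\in I^n: \alpha_{i_1}+\dots+\alpha_{i_n}=\alpha\}$. Let $s_r\cdot\mathbf{i}$ be $\mathbf{i}$ with $i_r,i_{r+1}$ swapped, and $-\mathbf{i}=(-i_1,\dots,-i_n)$. Write $\mathbf{i}\sim\mathbf{j}$ if $\mathbf{j}\in\{\mathbf{i},-\mathbf{i}\}$, and set $\delta_{\mathbf{i}\sim\mathbf{j}}=1$ if $\mathbf{i}\sim\mathbf{j}$ and $0$ otherwise; $\delta_{\mathbf{i}\mathbf{j}}$ is the ordinary Kronecker delta. For $\alpha,\beta\in Q^+_n$ write $\alpha\sim\beta$ if $\beta\in\{\alpha,\alpha'\}$, where $\alpha'$ is obtained from $\alpha$ by replacing each $\alpha_i$ by $\alpha_{-i}$. Let $Q_n^\varepsilon=Q_n^+/{\sim}$, and for $\gamma\in Q_n^\varepsilon$ let $I^\gamma=\bigcup_{\alpha\in\gamma}I^\alpha$. The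 algebra $\mathscr{R}_e(\mathfrak{S}_n)_\alpha$ is the unital associative $\mathcal{Z}$-algebra with generators $\psi_1,\dots,\psi_{n-1},y_1,\dots,y_n$, $e(\mathbf{i})$ ($\mathbf{i}\in I^\alpha$) and relations: $y_1^{(\Lambda_0,\alpha_{i_1})}e(\mathbf{i})=0$; $e(\mathbf{i})e(\mathbf{j})=\delta_{\mathbf{i}\mathbf{j}}e(\mathbf{i})$; $\sum_{\mathbf{i}\in I^\alpha}e(\mathbf{i})=1$; $y_re(\mathbf{i})=e(\mathbf{i})y_r$; $\psi_re(\mathbf{i})=e(s_r\cdot\mathbf{i})\psi_r$; $y_ry_s=y_sy_r$; $\psi_ry_{r+1}e(\mathbf{i})=(y_r\psi_r+\delta_{i_ri_{r+1}})e(\mathbf{i})$; $y_{r+1}\psi_re(\mathbf{i})=(\psi_ry_r+\delta_{i_ri_{r+1}})e(\mathbf{i})$; $\psi_ry_s=y_s\psi_r$ if $s\ne r,r+1$; $\psi_r\psi_s=\psi_s\psi_r$ if $|r-s|>1$; $\psi_r^2e(\mathbf{i})$ equals $0$ if $i_r=i_{r+1}$, $(y_r-y_{r+1})e(\mathbf{i})$ if $i_r\to i_{r+1}$, $(y_{r+1}-y_r)e(\mathbf{i})$ if $i_r\leftarrow i_{r+1}$, and $e(\mathbf{i})$ otherwise; $(\psi_r\psi_{r+1}\psi_r-\psi_{r+1}\psi_r\psi_{r+1})e(\mathbf{i})$ equals $-e(\mathbf{i})$ if $i_r=i_{r+2}\to i_{r+1}$, $e(\mathbf{i})$ if $i_r=i_{r+2}\leftarrow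 i_{r+1}$, and $0$ otherwise. Set $\mathscr{R}_e(\mathfrak{S}_n)=\bigoplus_{\alpha\in Q_n^+}\mathscr{R}_e(\mathfrak{S}_n)_\alpha$ and $\mathscr{R}_e(\mathfrak{S}_n)_\gamma=\bigoplus_{\alpha\in\gamma}\mathscr{R}_e(\mathfrak{S}_n)_\alpha$. Let $\mathtt{sgn}$ be the automorphism of $\mathscr{R}_e(\mathfrak{S}_n)$ with $\psi_r\mapsto-\psi_r$, $y_s\mapsto-y_s$, $e(\mathbf{i})\mapsto e(-\mathbf{i})$; it preserves each $\mathscr{R}_e(\mathfrak{S}_n)_\gamma$. Then $\mathscr{R}_e(\mathfrak{A}_n)$ and $\mathscr{R}_e(\mathfrak{A}_n)_\gamma$ are the fixed-point subalgebras of $\mathscr{R}_e(\mathfrak{S}_n)$ and $\mathscr{R}_e(\mathfrak{S}_n)_\gamma$ under $\mathtt{sgn}$. Convention: in the first relation $Y_1(\mathbf{i})^0$ means $\varepsilon(\mathbf{i})$, in analogy with the relation $y_1^{(\Lambda_0,\alpha_{i_1})}e(\mathbf{i})=0$.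
   Formalization: The deltas comparing residue sequences in the relations for ε(i)Y_r(j)ε(k), ε(i)Ψ_r(j)ε(k) and Y_r(i)Y_s(j) are read up to ∼ (literal deltas kill all Ψ and Y), and n ≥ 2 is assumed (for n = 0, 1 the printed relations force 1 = 0 where the algebra is Z). *)

theory Defs
  imports
    "HOL-Algebra.QuotRing"
    "HOL-Algebra.Module"
    "HOL-Library.Poly_Mapping"
    "HOL-Library.Multiset"
    "HOL-Library.Extended_Nat"
begin

section \<open>Associative algebras given by generators and relations\<close>

text \<open>
  The base ring is a type \<open>'z\<close> of class \<^class>\<open>comm_ring_1\<close>; an algebra over it is a
  record of type \<^typ>\<open>('z, 'b) module\<close>, that is, a ring with a scalar multiplication.
\<close>

datatype 'g word = Word (letters: "'g list")

instantiation word :: (type) monoid_add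
begin
definition zero_word :: "'a word" where "0 = Word []"
definition plus_word :: "'a word \<Rightarrow> 'a word \<Rightarrow> 'a word"
  where "u + v = Word (letters u @ letters v)"
instance by standard (simp_all add: zero_word_def plus_word_def)
end

type_synonym ('g, 'z) free = "'g word \<Rightarrow>\<^sub>0 'z"

text \<open>Multiplication on \<^typ>\<open>('g, 'z) free\<close> is the convolution product of \<^theory>\<open>HOL-Library.Poly_Mapping\<close>.\<close>

definition gen :: "'g \<Rightarrow> ('g, 'z::comm_ring_1) free"
  where "gen g = Poly_Mapping.single (Word [g]) 1"

definition scale :: "'z \<Rightarrow> ('g, 'z::comm_ring_1) free \<Rightarrow> ('g, 'z) free"
  where "scale c p = Poly_Mapping.single 0 c * p"

definition free_alg :: "'g set \<Rightarrow> ('z::comm_ring_1, ('g, 'z) free) module"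
  where "free_alg G =
    \<lparr>carrier = {p. \<forall>w\<in>Poly_Mapping.keys p. set (letters w) \<subseteq> G},
     monoid.mult = (*), one = 1, zero = 0, add = (+), smult = scale\<rparr>"

definition free_lift :: "('g \<Rightarrow> ('h, 'z::comm_ring_1) free) \<Rightarrow> ('g, 'z) free \<Rightarrow> ('h, 'z) free"
  where "free_lift f p =
    (\<Sum>w\<in>Poly_Mapping.keys p. scale (Poly_Mapping.lookup p w) (prod_list (map f (letters w))))"

text \<open>
  Relations are pairs; \<open>rel p q\<close> imposes the equation \<open>p = q\<close>.  The carrier, multiplication, unit,
  zero and addition of \<open>presented G rel\<close> are those of the quotient ring
  \<^const>\<open>FactRing\<close> by the two-sided ideal generated by the differences \<open>p - q\<close>.
\<close>

definition rel_ideal :: "'g set \<Rightarrow> (('g, 'z::comm_ring_1) free \<Rightarrow> ('g, 'z) free \<Rightarrow> bool) \<Rightarrow> ('g, 'z) free set"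
  where "rel_ideal G rel = Idl\<^bsub>free_alg G\<^esub> {p - q | p q. rel p q}"

definition presented ::
    "'g set \<Rightarrow> (('g, 'z::comm_ring_1) free \<Rightarrow> ('g, 'z) free \<Rightarrow> bool) \<Rightarrow> ('z, ('g, 'z) free set) module"
  where "presented G rel =
    (let F = free_alg G; J = rel_ideal G rel in
      ring.extend (F Quot J)
        (module.fields (\<lambda>c X. \<Union>p\<in>X. J +>\<^bsub>F\<^esub> (c \<odot>\<^bsub>F\<^esub> p))))"

definition alg_iso :: "('z, 'a) module \<Rightarrow> ('z, 'b) module \<Rightarrow> ('a \<Rightarrow> 'b) set"
  where "alg_iso A B =
    {h \<in> ring_iso A B. \<forall>c. \<forall>x\<in>carrier A. h (c \<odot>\<^bsub>A\<^esub> x) = c \<odot>\<^bsub>B\<^esub> h x}"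

text \<open>
  The unit is the family of units.  It lies in the carrier only if almost all summands are the
  zero ring, which is the case in all direct sums below (cyclotomic quiver Hecke algebras vanish in
  all but finitely many blocks, for given \<open>n\<close>).
\<close>

definition alg_dsum :: "'k set \<Rightarrow> ('k \<Rightarrow> ('z, 'b) module) \<Rightarrow> ('z, 'k \<Rightarrow> 'b) module"
  where "alg_dsum K A =
    \<lparr>carrier = {f \<in> \<Pi>\<^sub>E k\<in>K. carrier (A k). finite {k \<in> K. f k \<noteq> \<zero>\<^bsub>A k\<^esub>}},
     monoid.mult = (\<lambda>f g. \<lambda>k\<in>K. f k \<otimes>\<^bsub>A k\<^esub> g k),
     one = (\<lambda>k\<in>K. \<one>\<^bsub>A k\<^esub>),
     zero = (\<lambda>k\<in>K. \<zero>\<^bsub>A k\<^esub>),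
     add = (\<lambda>f g. \<lambda>k\<in>K. f k \<oplus>\<^bsub>A k\<^esub> g k),
     smult = (\<lambda>c f. \<lambda>k\<in>K. c \<odot>\<^bsub>A k\<^esub> f k)\<rparr>"

definition fixed_subalg :: "('b \<Rightarrow> 'b) \<Rightarrow> ('z, 'b) module \<Rightarrow> ('z, 'b) module"
  where "fixed_subalg s A = A\<lparr>carrier := {x \<in> carrier A. s x = x}\<rparr>"


section \<open>Residue sequences\<close>

text \<open>
  \<open>I = \<int>/e\<int>\<close> is represented by the residues \<open>0, \<dots>, e - 1\<close>, and by all integers if \<open>e = \<infinity>\<close>.
\<close>

definition residue :: "enat \<Rightarrow> int \<Rightarrow> int"
  where "residue e k = (case e of enat m \<Rightarrow> k mod int m | \<infinity> \<Rightarrow> k)"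

definition vertices :: "enat \<Rightarrow> int set"
  where "vertices e = range (residue e)"

definition edge :: "enat \<Rightarrow> int \<Rightarrow> int \<Rightarrow> bool"
  where "edge e i j \<longleftrightarrow> j = residue e (i + 1)"

text \<open>
  \<open>Q\<^sup>+\<close> is the free commutative monoid on the simple roots: the multiset \<open>{#i#}\<close> is
  \<open>\<alpha>\<^sub>i\<close>, and \<open>mset \<ii>\<close> is the sum of the roots of the entries of \<open>\<ii>\<close>.
\<close>

definition roots :: "enat \<Rightarrow> nat \<Rightarrow> int multiset set"
  where "roots e n = {\<alpha>. set_mset \<alpha> \<subseteq> vertices e \<and> size \<alpha> = n}"

definition neg_root :: "enat \<Rightarrow> int multiset \<Rightarrow> int multiset"
  where "neg_root e \<alpha> = image_mset (\<lambda>i. residue e (- i)) \<alpha>"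

definition root_classes :: "enat \<Rightarrow> nat \<Rightarrow> int multiset set set"
  where "root_classes e n =
    roots e n // {(\<alpha>, \<beta>). \<alpha> \<in> roots e n \<and> \<beta> \<in> {\<alpha>, neg_root e \<alpha>}}"

definition seqs :: "int multiset \<Rightarrow> int list set"
  where "seqs \<alpha> = {\<ii>. mset \<ii> = \<alpha>}"

definition class_seqs :: "int multiset set \<Rightarrow> int list set"
  where "class_seqs \<gamma> = (\<Union>\<alpha>\<in>\<gamma>. seqs \<alpha>)"

text \<open>Positions in a sequence are counted from 1.\<close>

definition entry :: "int list \<Rightarrow> nat \<Rightarrow> int"
  where "entry \<ii> r = \<ii> ! (r - 1)"

definition swap :: "nat \<Rightarrow> int list \<Rightarrow> int list"
  where "swap r \<ii> = \<ii>[r - 1 := entry \<ii> (r + 1), r := entry \<ii> r]"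

definition neg_seq :: "enat \<Rightarrow> int list \<Rightarrow> int list"
  where "neg_seq e \<ii> = map (\<lambda>i. residue e (- i)) \<ii>"

definition seq_sim :: "enat \<Rightarrow> int list \<Rightarrow> int list \<Rightarrow> bool"
  where "seq_sim e \<ii> \<jj> \<longleftrightarrow> \<jj> \<in> {\<ii>, neg_seq e \<ii>}"

text \<open>The pairing \<open>(\<Lambda>\<^sub>0, \<alpha>\<^sub>i)\<close>.\<close>

definition Lambda0 :: "int \<Rightarrow> nat"
  where "Lambda0 i = (if i = 0 then 1 else 0)"


section \<open>Cyclotomic quiver Hecke algebras of symmetric groups\<close>

datatype klr_gen = Psi_gen nat | Y_gen nat | E_gen "int list"

abbreviation gPsi :: "nat \<Rightarrow> (klr_gen, 'z::comm_ring_1) free" where "gPsi r \<equiv> gen (Psi_gen r)"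
abbreviation gY :: "nat \<Rightarrow> (klr_gen, 'z::comm_ring_1) free" where "gY r \<equiv> gen (Y_gen r)"
abbreviation gE :: "int list \<Rightarrow> (klr_gen, 'z::comm_ring_1) free" where "gE \<ii> \<equiv> gen (E_gen \<ii>)"

definition klr_gens :: "int multiset \<Rightarrow> klr_gen set"
  where "klr_gens \<alpha> =
    {Psi_gen r | r. 1 \<le> r \<and> r < size \<alpha>} \<union> {Y_gen s | s. 1 \<le> s \<and> s \<le> size \<alpha>} \<union> E_gen ` seqs \<alpha>"

inductive klr_rel ::
    "enat \<Rightarrow> int multiset \<Rightarrow> (klr_gen, 'z::comm_ring_1) free \<Rightarrow> (klr_gen, 'z) free \<Rightarrow> bool"
  for e :: enat and \<alpha> :: "int multiset" where
  cyclotomic: "\<ii> \<in> seqs \<alpha> \<Longrightarrow> 1 \<le> size \<alpha> \<Longrightarrow>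
    klr_rel e \<alpha> (gY 1 ^ Lambda0 (entry \<ii> 1) * gE \<ii>) 0"
| idem_idem: "\<ii> \<in> seqs \<alpha> \<Longrightarrow> \<jj> \<in> seqs \<alpha> \<Longrightarrow>
    klr_rel e \<alpha> (gE \<ii> * gE \<jj>) (gE \<ii> when \<ii> = \<jj>)"
| idem_sum: "klr_rel e \<alpha> (\<Sum>\<ii>\<in>seqs \<alpha>. gE \<ii>) 1"
| y_idem: "\<ii> \<in> seqs \<alpha> \<Longrightarrow> 1 \<le> r \<Longrightarrow> r \<le> size \<alpha> \<Longrightarrow>
    klr_rel e \<alpha> (gY r * gE \<ii>) (gE \<ii> * gY r)"
| psi_idem: "\<ii> \<in> seqs \<alpha> \<Longrightarrow> 1 \<le> r \<Longrightarrow> r < size \<alpha> \<Longrightarrow>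
    klr_rel e \<alpha> (gPsi r * gE \<ii>) (gE (swap r \<ii>) * gPsi r)"
| y_y: "1 \<le> r \<Longrightarrow> r \<le> size \<alpha> \<Longrightarrow> 1 \<le> s \<Longrightarrow> s \<le> size \<alpha> \<Longrightarrow>
    klr_rel e \<alpha> (gY r * gY s) (gY s * gY r)"
| psi_y_Suc: "\<ii> \<in> seqs \<alpha> \<Longrightarrow> 1 \<le> r \<Longrightarrow> r < size \<alpha> \<Longrightarrow>
    klr_rel e \<alpha> (gPsi r * gY (r + 1) * gE \<ii>)
      ((gY r * gPsi r + (1 when entry \<ii> r = entry \<ii> (r + 1))) * gE \<ii>)"
| y_Suc_psi: "\<ii> \<in> seqs \<alpha> \<Longrightarrow> 1 \<le> r \<Longrightarrow> r < size \<alpha> \<Longrightarrow>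
    klr_rel e \<alpha> (gY (r + 1) * gPsi r * gE \<ii>)
      ((gPsi r * gY r + (1 when entry \<ii> r = entry \<ii> (r + 1))) * gE \<ii>)"
| psi_y: "1 \<le> r \<Longrightarrow> r < size \<alpha> \<Longrightarrow> 1 \<le> s \<Longrightarrow> s \<le> size \<alpha> \<Longrightarrow> s \<noteq> r \<Longrightarrow> s \<noteq> r + 1 \<Longrightarrow>
    klr_rel e \<alpha> (gPsi r * gY s) (gY s * gPsi r)"
| psi_psi: "1 \<le> r \<Longrightarrow> r < size \<alpha> \<Longrightarrow> 1 \<le> s \<Longrightarrow> s < size \<alpha> \<Longrightarrow> \<bar>int r - int s\<bar> > 1 \<Longrightarrow>
    klr_rel e \<alpha> (gPsi r * gPsi s) (gPsi s * gPsi r)"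
| quadratic: "\<ii> \<in> seqs \<alpha> \<Longrightarrow> 1 \<le> r \<Longrightarrow> r < size \<alpha> \<Longrightarrow>
    klr_rel e \<alpha> (gPsi r ^ 2 * gE \<ii>)
      (if entry \<ii> r = entry \<ii> (r + 1) then 0
       else if edge e (entry \<ii> r) (entry \<ii> (r + 1)) then (gY r - gY (r + 1)) * gE \<ii>
       else if edge e (entry \<ii> (r + 1)) (entry \<ii> r) then (gY (r + 1) - gY r) * gE \<ii>
       else gE \<ii>)"
| braid: "\<ii> \<in> seqs \<alpha> \<Longrightarrow> 1 \<le> r \<Longrightarrow> r + 1 < size \<alpha> \<Longrightarrow>
    klr_rel e \<alpha> ((gPsi r * gPsi (r + 1) * gPsi r - gPsi (r + 1) * gPsi r * gPsi (r + 1)) * gE \<ii>)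
      (if entry \<ii> r = entry \<ii> (r + 2) \<and> edge e (entry \<ii> r) (entry \<ii> (r + 1)) then - gE \<ii>
       else if entry \<ii> r = entry \<ii> (r + 2) \<and> edge e (entry \<ii> (r + 1)) (entry \<ii> r) then gE \<ii>
       else 0)"

definition klr_block :: "enat \<Rightarrow> int multiset \<Rightarrow> ('z::comm_ring_1, (klr_gen, 'z) free set) module"
  where "klr_block e \<alpha> = presented (klr_gens \<alpha>) (klr_rel e \<alpha>)"

text \<open>
  For \<open>K = roots e n\<close> this is the algebra of the symmetric group; for \<open>K\<close> an element of
  \<open>root_classes e n\<close> it is the sum of the one or two blocks in that class.
\<close>

definition klr_sym ::
    "enat \<Rightarrow> int multiset set \<Rightarrow> ('z::comm_ring_1, int multiset \<Rightarrow> (klr_gen, 'z) free set) module"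
  where "klr_sym e K = alg_dsum K (klr_block e)"

fun sgn_gen :: "enat \<Rightarrow> klr_gen \<Rightarrow> (klr_gen, 'z::comm_ring_1) free" where
  "sgn_gen e (Psi_gen r) = - gPsi r"
| "sgn_gen e (Y_gen s) = - gY s"
| "sgn_gen e (E_gen \<ii>) = gE (neg_seq e \<ii>)"

text \<open>
  The homomorphism from the free algebra of the block of \<open>neg_root e \<alpha>\<close> to that of the block of
  \<open>\<alpha>\<close> given by \<open>sgn_gen\<close> maps relations to consequences of relations; \<open>sgn_block e \<alpha>\<close> is the map
  induced on cosets.
\<close>

definition sgn_block ::
    "enat \<Rightarrow> int multiset \<Rightarrow> (klr_gen, 'z::comm_ring_1) free set \<Rightarrow> (klr_gen, 'z) free set"
  where "sgn_block e \<alpha> X =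
    (\<Union>p\<in>X. rel_ideal (klr_gens \<alpha>) (klr_rel e \<alpha>) +>\<^bsub>free_alg (klr_gens \<alpha>)\<^esub> free_lift (sgn_gen e) p)"

definition klr_sgn ::
    "enat \<Rightarrow> int multiset set \<Rightarrow> (int multiset \<Rightarrow> (klr_gen, 'z::comm_ring_1) free set)
      \<Rightarrow> (int multiset \<Rightarrow> (klr_gen, 'z) free set)"
  where "klr_sgn e K x = (\<lambda>\<alpha>\<in>K. sgn_block e \<alpha> (x (neg_root e \<alpha>)))"

definition klr_alt ::
    "enat \<Rightarrow> int multiset set \<Rightarrow> ('z::comm_ring_1, int multiset \<Rightarrow> (klr_gen, 'z) free set) module"
  where "klr_alt e K = fixed_subalg (klr_sgn e K) (klr_sym e K)"


section \<open>The presentation for alternating groups\<close>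

datatype alt_gen = APsi_gen nat "int list" | AY_gen nat "int list" | AE_gen "int list"

abbreviation APsi :: "nat \<Rightarrow> int list \<Rightarrow> (alt_gen, 'z::comm_ring_1) free"
  where "APsi r \<ii> \<equiv> gen (APsi_gen r \<ii>)"
abbreviation AY :: "nat \<Rightarrow> int list \<Rightarrow> (alt_gen, 'z::comm_ring_1) free"
  where "AY s \<ii> \<equiv> gen (AY_gen s \<ii>)"
abbreviation AE :: "int list \<Rightarrow> (alt_gen, 'z::comm_ring_1) free"
  where "AE \<ii> \<equiv> gen (AE_gen \<ii>)"

definition alt_gens :: "nat \<Rightarrow> int multiset set \<Rightarrow> alt_gen set"
  where "alt_gens n \<gamma> =
    {APsi_gen r \<ii> | r \<ii>. 1 \<le> r \<and> r < n \<and> \<ii> \<in> class_seqs \<gamma>} \<union>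
    {AY_gen s \<ii> | s \<ii>. 1 \<le> s \<and> s \<le> n \<and> \<ii> \<in> class_seqs \<gamma>} \<union>
    AE_gen ` class_seqs \<gamma>"

definition half :: "'z::comm_ring_1"
  where "half = (THE c. 2 * c = 1)"

text \<open>
  All Kronecker symbols comparing residue sequences are taken up to \<^const>\<open>seq_sim\<close>.  With
  literal equality, \<open>\<epsilon>(-\<ii>) = \<epsilon>(\<ii>)\<close> would force all generators \<open>\<Psi>\<^sub>r(\<ii>)\<close> and \<open>Y\<^sub>s(\<ii>)\<close> to vanish.
\<close>

inductive alt_rel ::
    "enat \<Rightarrow> nat \<Rightarrow> int multiset set \<Rightarrow> (alt_gen, 'z::comm_ring_1) free \<Rightarrow> (alt_gen, 'z) free \<Rightarrow> bool"
  for e :: enat and n :: nat and \<gamma> :: "int multiset set" where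
  cyclotomic: "\<ii> \<in> class_seqs \<gamma> \<Longrightarrow> 1 \<le> n \<Longrightarrow>
    alt_rel e n \<gamma>
      (if Lambda0 (entry \<ii> 1) = 0 then AE \<ii> else AY 1 \<ii> ^ Lambda0 (entry \<ii> 1)) 0"
| E_E: "\<ii> \<in> class_seqs \<gamma> \<Longrightarrow> \<jj> \<in> class_seqs \<gamma> \<Longrightarrow>
    alt_rel e n \<gamma> (AE \<ii> * AE \<jj>) (AE \<ii> when seq_sim e \<ii> \<jj>)"
| E_sum: "alt_rel e n \<gamma> (\<Sum>\<ii>\<in>class_seqs \<gamma>. scale half (AE \<ii>)) 1"
| Y_neg: "\<ii> \<in> class_seqs \<gamma> \<Longrightarrow> 1 \<le> r \<Longrightarrow> r \<le> n \<Longrightarrow>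
    alt_rel e n \<gamma> (AY r (neg_seq e \<ii>)) (- AY r \<ii>)"
| Psi_neg: "\<ii> \<in> class_seqs \<gamma> \<Longrightarrow> 1 \<le> r \<Longrightarrow> r < n \<Longrightarrow>
    alt_rel e n \<gamma> (APsi r (neg_seq e \<ii>)) (- APsi r \<ii>)"
| E_neg: "\<ii> \<in> class_seqs \<gamma> \<Longrightarrow>
    alt_rel e n \<gamma> (AE (neg_seq e \<ii>)) (AE \<ii>)"
| E_Y_E: "\<ii> \<in> class_seqs \<gamma> \<Longrightarrow> \<jj> \<in> class_seqs \<gamma> \<Longrightarrow> \<kk> \<in> class_seqs \<gamma> \<Longrightarrow> 1 \<le> r \<Longrightarrow> r \<le> n \<Longrightarrow>
    alt_rel e n \<gamma> (AE \<ii> * AY r \<jj> * AE \<kk>)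
      (AY r \<jj> when seq_sim e \<ii> \<jj> \<and> seq_sim e \<jj> \<kk>)"
| E_Psi_E: "\<ii> \<in> class_seqs \<gamma> \<Longrightarrow> \<jj> \<in> class_seqs \<gamma> \<Longrightarrow> \<kk> \<in> class_seqs \<gamma> \<Longrightarrow> 1 \<le> r \<Longrightarrow> r < n \<Longrightarrow>
    alt_rel e n \<gamma> (AE \<ii> * APsi r \<jj> * AE \<kk>)
      (APsi r \<jj> when seq_sim e (swap r \<ii>) \<jj> \<and> seq_sim e \<jj> \<kk>)"
| Y_Y: "\<ii> \<in> class_seqs \<gamma> \<Longrightarrow> \<jj> \<in> class_seqs \<gamma> \<Longrightarrow>
    1 \<le> r \<Longrightarrow> r \<le> n \<Longrightarrow> 1 \<le> s \<Longrightarrow> s \<le> n \<Longrightarrow>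
    alt_rel e n \<gamma> (AY r \<ii> * AY s \<jj>) (AY s \<ii> * AY r \<jj> when seq_sim e \<ii> \<jj>)"
| Psi_Y_Suc: "\<ii> \<in> class_seqs \<gamma> \<Longrightarrow> 1 \<le> r \<Longrightarrow> r < n \<Longrightarrow>
    alt_rel e n \<gamma> (APsi r \<ii> * AY (r + 1) \<ii>)
      (AY r (swap r \<ii>) * APsi r \<ii> + (AE \<ii> when entry \<ii> r = entry \<ii> (r + 1)))"
| Y_Suc_Psi: "\<ii> \<in> class_seqs \<gamma> \<Longrightarrow> 1 \<le> r \<Longrightarrow> r < n \<Longrightarrow>
    alt_rel e n \<gamma> (AY (r + 1) (swap r \<ii>) * APsi r \<ii>)
      (APsi r \<ii> * AY r \<ii> + (AE \<ii> when entry \<ii> r = entry \<ii> (r + 1)))"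
| Psi_Y: "\<ii> \<in> class_seqs \<gamma> \<Longrightarrow> 1 \<le> r \<Longrightarrow> r < n \<Longrightarrow> 1 \<le> s \<Longrightarrow> s \<le> n \<Longrightarrow> s \<noteq> r \<Longrightarrow> s \<noteq> r + 1 \<Longrightarrow>
    alt_rel e n \<gamma> (APsi r \<ii> * AY s \<ii>) (AY s (swap r \<ii>) * APsi r \<ii>)"
| Psi_Psi: "\<ii> \<in> class_seqs \<gamma> \<Longrightarrow> 1 \<le> r \<Longrightarrow> r < n \<Longrightarrow> 1 \<le> t \<Longrightarrow> t < n \<Longrightarrow> \<bar>int r - int t\<bar> > 1 \<Longrightarrow>
    alt_rel e n \<gamma> (APsi r (swap t \<ii>) * APsi t \<ii>) (APsi t (swap r \<ii>) * APsi r \<ii>)"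
| quadratic: "\<ii> \<in> class_seqs \<gamma> \<Longrightarrow> 1 \<le> r \<Longrightarrow> r < n \<Longrightarrow>
    alt_rel e n \<gamma> (APsi r (swap r \<ii>) * APsi r \<ii>)
      (if edge e (entry \<ii> r) (entry \<ii> (r + 1)) then AY r \<ii> - AY (r + 1) \<ii>
       else if edge e (entry \<ii> (r + 1)) (entry \<ii> r) then AY (r + 1) \<ii> - AY r \<ii>
       else if entry \<ii> r = entry \<ii> (r + 1) then 0
       else AE \<ii>)"
| braid: "\<ii> \<in> class_seqs \<gamma> \<Longrightarrow> 1 \<le> r \<Longrightarrow> r + 1 < n \<Longrightarrow>
    alt_rel e n \<gamma>
      (APsi r (swap (r + 1) (swap r \<ii>)) * APsi (r + 1) (swap r \<ii>) * APsi r \<ii> -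
       APsi (r + 1) (swap r (swap (r + 1) \<ii>)) * APsi r (swap (r + 1) \<ii>) * APsi (r + 1) \<ii>)
      (if entry \<ii> r = entry \<ii> (r + 2) \<and> edge e (entry \<ii> (r + 1)) (entry \<ii> r) then AE \<ii>
       else if entry \<ii> r = entry \<ii> (r + 2) \<and> edge e (entry \<ii> r) (entry \<ii> (r + 1)) then - AE \<ii>
       else 0)"

definition alt_presented ::
    "enat \<Rightarrow> nat \<Rightarrow> int multiset set \<Rightarrow> ('z::comm_ring_1, (alt_gen, 'z) free set) module"
  where "alt_presented e n \<gamma> = presented (alt_gens n \<gamma>) (alt_rel e n \<gamma>)"

end

theory Submission
  imports Defs
begin

text \<open>
  Write \<open>R\<close> for the sum of the one or two blocks in a class \<open>\<gamma>\<close>, with its involution \<open>sgn\<close>, and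
  \<open>A\<close> for the algebra presented by the alternating generators and relations. There is a homomorphism
  \<open>\<Phi> : A \<rightarrow> R\<close> with image in the fixed points of \<open>sgn\<close>, given by
    \<open>\<epsilon>(\<ii>) \<mapsto> e(\<ii>) + e(-\<ii>)\<close>, \<open>Y\<^sub>r(\<ii>) \<mapsto> y\<^sub>r (e(\<ii>) - e(-\<ii>))\<close>, \<open>\<Psi>\<^sub>r(\<ii>) \<mapsto> \<psi>\<^sub>r (e(\<ii>) - e(-\<ii>))\<close>.
  The claim is that \<open>\<Phi>\<close> is a bijection onto the fixed points. The sequences with \<open>-\<ii> = \<ii>\<close>, for which
  these formulas degenerate, do no harm: for \<open>n \<ge> 2\<close> and \<open>e \<ge> 3\<close> their idempotents are zero in \<open>R\<close> and in
  \<open>A\<close> (\<open>weight_self_neg\<close>, \<open>AE_self_neg\<close>).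

  \<^emph>\<open>Relations.\<close> \<open>R\<close> is the direct sum of the weight spaces \<open>e(\<jj>)R\<close>, so an equation in \<open>R\<close> may be checked
  on vectors \<open>v\<close> with \<open>e(\<jj>)v = v\<close>. On such a \<open>v\<close> with \<open>-\<jj> \<noteq> \<jj>\<close>, \<open>\<Phi>(\<Psi>\<^sub>r(\<plusminus>\<jj>))\<close> acts as \<open>\<plusminus>\<psi>\<^sub>r\<close> and
  \<open>\<Phi>(Y\<^sub>r(\<plusminus>\<jj>))\<close> as \<open>\<plusminus>y\<^sub>r\<close>, and all other \<open>\<Phi>(\<Psi>\<^sub>r(\<ii>))\<close>, \<open>\<Phi>(Y\<^sub>r(\<ii>))\<close> act as zero. Every alternating relation thus
  becomes a relation of \<open>R\<close> on a weight space (\<open>phi_rel_on_weight\<close>, \<open>phi_eqv\<close>).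

  \<^emph>\<open>Injectivity.\<close> Choose one sequence from each pair \<open>{\<ii>, -\<ii>}\<close>, and let \<open>\<sigma>(\<ii>) = 1\<close> if \<open>\<ii>\<close> is chosen and
  \<open>-1\<close> otherwise. The element \<open>w = \<Sum> \<sigma>(\<ii>) e(\<ii>)\<close> of \<open>R\<close> satisfies \<open>w\<^sup>2 = 1\<close> and \<open>sgn w = -w\<close>, so \<open>R\<close> is
  generated by its fixed points and \<open>w\<close>, and conjugation by \<open>w\<close> fixes \<open>\<epsilon>(\<ii>)\<close> and \<open>Y\<^sub>r(\<ii>)\<close> and multiplies
  \<open>\<Psi>\<^sub>r(\<ii>)\<close> by \<open>\<sigma>(\<ii>) \<sigma>(s\<^sub>r \<cdot> \<ii>)\<close>. The latter formulas define an automorphism \<open>\<theta>\<close> of \<open>A\<close> (\<open>parity\<close>), and \<open>R\<close> acts on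
  the module \<open>A\<close>: fixed points by left multiplication and \<open>w\<close> by \<open>\<theta>\<close> (\<open>T\<close>). In this module \<open>e(\<jj>)\<close> is
  the projection to the space of all \<open>v\<close> with \<open>\<epsilon>(\<jj>)v = v\<close> and \<open>\<theta>(v) = \<sigma>(\<jj>)v\<close>, where \<open>\<psi>\<^sub>r\<close> acts as \<open>\<Psi>\<^sub>r(\<jj>)\<close>
  and \<open>y\<^sub>r\<close> as \<open>Y\<^sub>r(\<jj>)\<close>; hence the relations of \<open>R\<close> hold by those of \<open>A\<close> (\<open>T_rel_on_weight\<close>, \<open>T_vanish\<close>).
  Since \<open>\<Phi>(a)\<close> acts as left multiplication by \<open>a\<close> (\<open>T_phi\<close>), \<open>\<Phi>(a) = 0\<close> implies \<open>a = a \<cdot> 1 = 0\<close>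
  (\<open>phi_kernel\<close>).

  \<^emph>\<open>Surjectivity.\<close> As 2 is invertible, the fixed points are spanned by the elements \<open>x + sgn x\<close>, where \<open>x\<close>
  runs over words in the generators times some \<open>e(\<ii>)\<close>. If \<open>x = e(\<jj>)x\<close> and \<open>\<Phi>(a) = x + sgn x\<close>, then
  \<open>\<Phi>(\<Psi>\<^sub>r(\<jj>)a) = \<psi>\<^sub>r x + sgn(\<psi>\<^sub>r x)\<close>, so all these elements are reached by induction on the word
  (\<open>has_lift_odd\<close>, \<open>has_lift_all\<close>, \<open>phi_surj\<close>).

  The decomposition of the whole fixed point algebra into the classes \<open>\<gamma>\<close> holds because \<open>sgn\<close> only mixes
  the components \<open>\<alpha>\<close> and \<open>-\<alpha>\<close> (\<open>klr_alt_decomposition\<close>).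

  All computations take place in free algebras, modulo the congruence generated by the relations.
\<close>

section \<open>Free algebras, representations and homomorphisms\<close>

lemma letters_zero [simp]: "letters 0 = []" by (simp add: zero_word_def)
lemma letters_plus [simp]: "letters (u + v) = letters u @ letters v" by (simp add: plus_word_def)

lemma scale_add_right: "scale c (p + q) = scale c p + scale c q"
  by (simp add: scale_def distrib_left)
lemma scale_add_left: "scale (c + d) p = scale c p + scale d p"
  by (simp add: scale_def distrib_right single_add)
lemma scale_zero_left [simp]: "scale 0 p = 0" by (simp add: scale_def)
lemma scale_zero_right [simp]: "scale c 0 = 0" by (simp add: scale_def)
lemma scale_one [simp]: "scale 1 p = p" by (simp add: scale_def)
lemma scale_scale: "scale c (scale d p) = scale (c * d) p"
  by (simp add: scale_def mult.assoc [symmetric] mult_single)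
lemma scale_mult_left: "scale c p * q = scale c (p * q)"
  by (simp add: scale_def mult.assoc)
lemma scale_minus_right: "scale c (- p) = - scale c p" by (simp add: scale_def)
lemma scale_diff_right: "scale c (p - q) = scale c p - scale c q"
  by (simp add: scale_def right_diff_distrib)
lemma scale_sum: "scale c (sum f A) = (\<Sum>x\<in>A. scale c (f x))"
  by (simp add: scale_def sum_distrib_left)

lemma sum_singles: "p = (\<Sum>w\<in>Poly_Mapping.keys p. Poly_Mapping.single w (Poly_Mapping.lookup p w))"
proof (rule poly_mapping_eqI)
  fix k
  show "Poly_Mapping.lookup p k =
      Poly_Mapping.lookup (\<Sum>w\<in>Poly_Mapping.keys p. Poly_Mapping.single w (Poly_Mapping.lookup p w)) k"
    by (simp add: lookup_sum lookup_single when_def in_keys_iff)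
qed

lemma single_word:
  "Poly_Mapping.single (Word (g # w)) c = gen g * Poly_Mapping.single (Word w) (c::'z::comm_ring_1)"
  by (simp add: gen_def mult_single plus_word_def)

text \<open>
  Every word is a product of generators, so facts about the free algebra can be proved by induction
  along a product instead of computing with convolution.
\<close>

lemma single_word_scale:
  "Poly_Mapping.single (Word w) c = scale c (prod_list (map gen w))"
proof (induction w)
  case Nil
  then show ?case by (simp add: scale_def zero_word_def [symmetric])
next
  case (Cons g w)
  have "gen g * scale c p = scale c (gen g * p)" for p
  proof -
    have "gen g * Poly_Mapping.single 0 c = Poly_Mapping.single 0 c * gen g"
      by (simp add: gen_def mult_single)
    then show ?thesis by (simp add: scale_def mult.assoc [symmetric])
  qed
  with Cons show ?case by (simp add: single_word)
qed

lemma free_induct [case_names zero add scale one gen]: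
  assumes "P 0" "\<And>p q. P p \<Longrightarrow> P q \<Longrightarrow> P (p + q)" "\<And>c p. P p \<Longrightarrow> P (scale c p)"
    "P 1" "\<And>g p. P p \<Longrightarrow> P (gen g * p)"
  shows "P (p :: ('g, 'z::comm_ring_1) free)"
proof -
  have "P (prod_list (map gen w))" for w
    by (induction w) (use assms in auto)
  then have single: "P (Poly_Mapping.single (Word w) c)" for w c
    by (simp add: single_word_scale assms(3))
  have "P (\<Sum>w\<in>W. Poly_Mapping.single w (f w))" if "finite W" for W :: "'g word set" and f
    using that
  proof induction
    case (insert w W)
    then show ?case using single [of "letters w"] assms(2) by simp
  qed (simp add: assms(1))
  then show ?thesis
    using sum_singles [of p] finite_keys by metis
qed

lemma scale_mult_right: "p * scale c q = scale c (p * q)"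
  by (induction p rule: free_induct)
    (simp_all add: distrib_right scale_add_right scale_mult_left mult.assoc scale_scale mult.commute,
     metis (no_types, lifting) gen_def scale_def mult.assoc mult_single add_0 add_0_right mult_1 mult.right_neutral)

lemma scale_of_int: "scale (of_int k) p = of_int k * p"
  by (simp add: scale_def single_of_int)

definition free_linear :: "(('h, 'z::comm_ring_1) free \<Rightarrow> ('h, 'z) free) \<Rightarrow> bool"
  where "free_linear f \<longleftrightarrow> (\<forall>x y. f (x + y) = f x + f y) \<and> (\<forall>c x. f (scale c x) = scale c (f x))"

lemma free_linear_add: "free_linear f \<Longrightarrow> f (x + y) = f x + f y"
  and free_linear_scale: "free_linear f \<Longrightarrow> f (scale c x) = scale c (f x)"
  by (simp_all add: free_linear_def)

lemma free_linear_0: "free_linear f \<Longrightarrow> f 0 = 0"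
  by (metis free_linear_scale scale_zero_left)

lemma free_linear_minus: "free_linear f \<Longrightarrow> f (- x) = - f x"
  by (metis free_linear_add free_linear_0 add.right_inverse minus_unique)

lemma free_linear_sum: "free_linear f \<Longrightarrow> f (sum g A) = (\<Sum>x\<in>A. f (g x))"
  by (induction A rule: infinite_finite_induct) (auto simp: free_linear_0 free_linear_add)

text \<open>
  A family of operators indexed by the generators extends to a representation of the free algebra.
  The operators are functions on another free algebra, and act on a quotient of it through
  representatives.
\<close>

definition act ::
    "('g \<Rightarrow> ('h, 'z::comm_ring_1) free \<Rightarrow> ('h, 'z) free) \<Rightarrow> ('g, 'z) free \<Rightarrow> ('h, 'z) free \<Rightarrow> ('h, 'z) free"
  where "act T p v =
    (\<Sum>w\<in>Poly_Mapping.keys p. scale (Poly_Mapping.lookup p w) (foldr T (letters w) v))"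

lemma act_add: "act T (p + q) v = act T p v + act T q v"
  unfolding act_def
  by (rule setsum_keys_plus_distrib) (simp_all add: scale_add_left)

lemma act_single: "act T (Poly_Mapping.single w c) v = scale c (foldr T (letters w) v)"
  by (cases "c = 0") (simp_all add: act_def)

lemma act_0 [simp]: "act T 0 v = 0" by (simp add: act_def)
lemma act_1 [simp]: "act T 1 v = v"
  using act_single [of T 0 1 v] by simp
lemma act_gen [simp]: "act T (gen g) v = T g v"
  by (simp add: gen_def act_single)

lemma act_sum_singles: "finite W \<Longrightarrow> act T (\<Sum>w\<in>W. f w) v = (\<Sum>w\<in>W. act T (f w) v)"
  by (induction W rule: finite_induct) (simp_all add: act_add)

lemma act_sum: "act T (\<Sum>w\<in>W. f w) v = (\<Sum>w\<in>W. act T (f w) v)"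
  by (cases "finite W") (simp_all add: act_sum_singles)

lemma act_minus: "act T (- p) v = - act T p v"
  by (metis act_0 act_add add.right_inverse minus_unique)
lemma act_diff: "act T (p - q) v = act T p v - act T q v"
  by (metis act_add act_minus diff_conv_add_uminus)

lemma act_scale: "act T (scale c p) v = scale c (act T p v)"
proof -
  have *: "scale c (Poly_Mapping.single w d) = Poly_Mapping.single w (c * d)" for w d
    by (simp add: scale_def mult_single)
  have "act T (scale c (\<Sum>w\<in>W. Poly_Mapping.single w (f w))) v
      = scale c (act T (\<Sum>w\<in>W. Poly_Mapping.single w (f w)) v)" for W f
    by (simp add: scale_sum act_sum * act_single scale_scale)
  then show ?thesis
    using sum_singles [of p] by metis
qed

lemma act_gen_mult:
  assumes "\<And>g. free_linear (T g)"
  shows "act T (gen g * p) v = T g (act T p v)"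
proof -
  have "act T (gen g * (\<Sum>w\<in>W. Poly_Mapping.single w (f w))) v
      = T g (act T (\<Sum>w\<in>W. Poly_Mapping.single w (f w)) v)" for W f
    using assms by (simp add: sum_distrib_left gen_def mult_single act_sum act_single
        free_linear_sum free_linear_scale)
  then show ?thesis
    using sum_singles [of p] by metis
qed

lemma act_mult:
  assumes "\<And>g. free_linear (T g)"
  shows "act T (p * q) v = act T p (act T q v)"
  by (induction p rule: free_induct)
    (simp_all add: distrib_right act_add act_scale scale_mult_left mult.assoc act_gen_mult [OF assms])

lemma free_linear_act:
  assumes "\<And>g. free_linear (T g)"
  shows "free_linear (act T p)"
  by (induction p rule: free_induct)
    (use assms in \<open>auto simp: free_linear_def act_add act_scale scale_add_right scale_scale mult.commute
        act_gen_mult [OF assms]\<close>)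

lemma free_linear_mult: "free_linear (\<lambda>x. a * x)"
  by (simp add: free_linear_def distrib_left scale_mult_right)

text \<open>
  A homomorphism into an algebra is the representation by left multiplication, evaluated at the
  unit; so the laws for \<^const>\<open>free_lift\<close> come from those for \<^const>\<open>act\<close>.
\<close>

lemma free_lift_act: "free_lift f p = act (\<lambda>g x. f g * x) p 1"
proof -
  have "foldr (\<lambda>g x. f g * x) w 1 = prod_list (map f w)" for w
    by (induction w) auto
  then show ?thesis by (simp add: free_lift_def act_def)
qed

lemma free_lift_0 [simp]: "free_lift f 0 = 0"
  and free_lift_1 [simp]: "free_lift f 1 = 1"
  and free_lift_gen [simp]: "free_lift f (gen g) = f g"
  and free_lift_add: "free_lift f (p + q) = free_lift f p + free_lift f q"
  and free_lift_minus: "free_lift f (- p) = - free_lift f p"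
  and free_lift_diff: "free_lift f (p - q) = free_lift f p - free_lift f q"
  and free_lift_scale: "free_lift f (scale c p) = scale c (free_lift f p)"
  and free_lift_sum: "free_lift f (sum h A) = (\<Sum>x\<in>A. free_lift f (h x))"
  by (simp_all add: free_lift_act act_add act_minus act_diff act_scale act_sum)

lemma free_lift_mult: "free_lift f (p * q) = free_lift f p * free_lift f q"
  by (induction p rule: free_induct)
    (simp_all add: distrib_right free_lift_add free_lift_scale scale_mult_left mult.assoc,
     simp add: free_lift_act act_gen_mult free_linear_mult mult.assoc)

lemma free_lift_power: "free_lift f (p ^ k) = free_lift f p ^ k"
  by (induction k) (simp_all add: free_lift_mult)

lemma free_lift_of_int: "free_lift f (of_int k) = of_int k"
  by (metis free_lift_1 free_lift_scale mult.right_neutral scale_of_int)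

lemma free_lift_when: "free_lift f (p when b) = (free_lift f p when b)"
  by (simp add: when_def)

lemmas free_lift_simps = free_lift_add free_lift_minus free_lift_diff free_lift_scale
  free_lift_sum free_lift_mult free_lift_power free_lift_when free_lift_of_int

section \<open>The congruence of a presentation\<close>

lemma free_alg_simps [simp]:
  "x \<otimes>\<^bsub>free_alg G\<^esub> y = x * y" "x \<oplus>\<^bsub>free_alg G\<^esub> y = x + y"
  "\<one>\<^bsub>free_alg G\<^esub> = 1" "\<zero>\<^bsub>free_alg G\<^esub> = 0" "c \<odot>\<^bsub>free_alg G\<^esub> x = scale c x"
  by (simp_all add: free_alg_def)

lemma in_free_alg: "p \<in> carrier (free_alg G) \<longleftrightarrow> (\<forall>w\<in>Poly_Mapping.keys p. set (letters w) \<subseteq> G)"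
  by (simp add: free_alg_def)

lemma free_alg_0 [simp, intro]: "0 \<in> carrier (free_alg G)"
  and free_alg_1 [simp, intro]: "1 \<in> carrier (free_alg G)"
  by (simp_all add: in_free_alg)

lemma free_alg_gen [simp, intro]: "g \<in> G \<Longrightarrow> gen g \<in> carrier (free_alg G)"
  by (simp add: in_free_alg gen_def)

lemma free_alg_add [simp, intro]:
  "p \<in> carrier (free_alg G) \<Longrightarrow> q \<in> carrier (free_alg G) \<Longrightarrow> p + q \<in> carrier (free_alg G)"
  unfolding in_free_alg using keys_add [of p q] by blast

lemma free_alg_mult [simp, intro]:
  "p \<in> carrier (free_alg G) \<Longrightarrow> q \<in> carrier (free_alg G) \<Longrightarrow> p * q \<in> carrier (free_alg G)"
  unfolding in_free_alg using keys_mult [of p q] by (fastforce simp: set_append)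

lemma free_alg_minus [simp, intro]: "p \<in> carrier (free_alg G) \<Longrightarrow> - p \<in> carrier (free_alg G)"
  by (simp add: in_free_alg in_keys_iff)

lemma free_alg_diff [simp, intro]:
  "p \<in> carrier (free_alg G) \<Longrightarrow> q \<in> carrier (free_alg G) \<Longrightarrow> p - q \<in> carrier (free_alg G)"
  unfolding diff_conv_add_uminus by (intro free_alg_add free_alg_minus)

lemma free_alg_scale [simp, intro]: "p \<in> carrier (free_alg G) \<Longrightarrow> scale c p \<in> carrier (free_alg G)"
proof -
  have "Poly_Mapping.single 0 c \<in> carrier (free_alg G)"
    by (simp add: in_free_alg)
  then show "p \<in> carrier (free_alg G) \<Longrightarrow> ?thesis" by (simp add: scale_def)
qed

lemma free_alg_power [simp, intro]: "p \<in> carrier (free_alg G) \<Longrightarrow> p ^ k \<in> carrier (free_alg G)"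
  by (induction k) auto

lemma free_alg_when [simp, intro]:
  "(b \<Longrightarrow> p \<in> carrier (free_alg G)) \<Longrightarrow> (p when b) \<in> carrier (free_alg G)"
  by (simp add: when_def)

lemma free_alg_sum [simp, intro]:
  "(\<And>x. x \<in> A \<Longrightarrow> f x \<in> carrier (free_alg G)) \<Longrightarrow> sum f A \<in> carrier (free_alg G)"
  by (induction A rule: infinite_finite_induct) auto

lemma ring_free_alg: "ring (free_alg G)"
proof (rule ringI)
  show "abelian_group (free_alg G)"
  proof (rule abelian_groupI)
    fix x assume "x \<in> carrier (free_alg G)"
    then show "\<exists>y\<in>carrier (free_alg G). y \<oplus>\<^bsub>free_alg G\<^esub> x = \<zero>\<^bsub>free_alg G\<^esub>"
      by (intro bexI [of _ "- x"]) auto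
  qed (auto simp: ac_simps)
  show "Group.monoid (free_alg G)"
    by (rule monoidI) (auto simp: mult.assoc)
qed (auto simp: distrib_left distrib_right)

lemma a_minus_free_alg:
  assumes "x \<in> carrier (free_alg G)" "y \<in> carrier (free_alg G)"
  shows "x \<ominus>\<^bsub>free_alg G\<^esub> y = x - y"
proof -
  interpret ring "free_alg G" by (rule ring_free_alg)
  have "\<ominus>\<^bsub>free_alg G\<^esub> y = - y"
    using assms by (intro minus_equality) auto
  then show ?thesis by (simp add: a_minus_def)
qed

text \<open>
  The retraction of the free algebra on a whole type onto the subalgebra generated by \<open>G\<close> which
  kills all other generators.
\<close>

definition restrict_gens :: "'g set \<Rightarrow> ('g, 'z::comm_ring_1) free \<Rightarrow> ('g, 'z) free"
  where "restrict_gens G = free_lift (\<lambda>g. gen g when g \<in> G)"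

lemma restrict_gens_in [simp, intro]: "restrict_gens G p \<in> carrier (free_alg G)"
  by (induction p rule: free_induct) (auto simp: restrict_gens_def free_lift_simps)

lemma restrict_gens_id:
  fixes p :: "('g, 'z::comm_ring_1) free"
  assumes "p \<in> carrier (free_alg G)" shows "restrict_gens G p = p"
proof -
  have w: "restrict_gens G (Poly_Mapping.single w c) = Poly_Mapping.single w c" if "set (letters w) \<subseteq> G" for w and c :: 'z
  proof -
    have "restrict_gens G (prod_list (map gen ws)) = prod_list (map gen ws :: ('g, 'z) free list)" if "set ws \<subseteq> G" for ws
      using that by (induction ws) (auto simp: restrict_gens_def free_lift_simps)
    then have "restrict_gens G (Poly_Mapping.single (Word (letters w)) c) = Poly_Mapping.single (Word (letters w)) c"
      unfolding single_word_scale using that by (simp add: restrict_gens_def free_lift_simps)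
    then show ?thesis by simp
  qed
  have "restrict_gens G (\<Sum>w\<in>Poly_Mapping.keys p. Poly_Mapping.single w (Poly_Mapping.lookup p w)) =
     (\<Sum>w\<in>Poly_Mapping.keys p. Poly_Mapping.single w (Poly_Mapping.lookup p w))"
    using assms by (subst restrict_gens_def, subst free_lift_sum, intro sum.cong)
      (auto simp: w restrict_gens_def [symmetric] in_free_alg)
  then show ?thesis
    by (simp add: sum_singles [symmetric])
qed

lemma restrict_gens_simps [simp]:
  "restrict_gens G 0 = 0" "restrict_gens G 1 = 1" "restrict_gens G (gen g) = (gen g when g \<in> G)"
  "restrict_gens G (p + q) = restrict_gens G p + restrict_gens G q" "restrict_gens G (p - q) = restrict_gens G p - restrict_gens G q"
  "restrict_gens G (- p) = - restrict_gens G p" "restrict_gens G (p * q) = restrict_gens G p * restrict_gens G q"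
  "restrict_gens G (scale c p) = scale c (restrict_gens G p)"
  by (simp_all add: restrict_gens_def free_lift_simps)

text \<open>
  Composing with the retraction extends the ideal of the relations, which lives in \<open>free_alg G\<close>,
  to a congruence on the whole type. It is compatible with multiplication by arbitrary elements,
  so that calculations carry no membership conditions, and generators outside \<open>G\<close> are
  congruent to zero. The quotient is the same.
\<close>

definition eqv :: "'g set \<Rightarrow> (('g, 'z::comm_ring_1) free \<Rightarrow> ('g, 'z) free \<Rightarrow> bool)
    \<Rightarrow> ('g, 'z) free \<Rightarrow> ('g, 'z) free \<Rightarrow> bool"
  where "eqv G rel p q \<longleftrightarrow> restrict_gens G (p - q) \<in> rel_ideal G rel"

definition cls :: "'g set \<Rightarrow> (('g, 'z::comm_ring_1) free \<Rightarrow> ('g, 'z) free \<Rightarrow> bool)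
    \<Rightarrow> ('g, 'z) free \<Rightarrow> ('g, 'z) free set"
  where "cls G rel p = rel_ideal G rel +>\<^bsub>free_alg G\<^esub> restrict_gens G p"

locale presentation =
  fixes G :: "'g set" and rel :: "('g, 'z::comm_ring_1) free \<Rightarrow> ('g, 'z) free \<Rightarrow> bool"
  assumes rel_closed: "rel p q \<Longrightarrow> p \<in> carrier (free_alg G) \<and> q \<in> carrier (free_alg G)"
begin

abbreviation eqv_rel (infix "\<approx>" 50) where "p \<approx> q \<equiv> eqv G rel p q"
abbreviation "J \<equiv> rel_ideal G rel"

lemma relators_closed: "{p - q |p q. rel p q} \<subseteq> carrier (free_alg G)"
  using rel_closed by auto

lemma ideal_J: "ideal J (free_alg G)"
  unfolding rel_ideal_def by (rule ring.genideal_ideal [OF ring_free_alg relators_closed])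

lemma J_carrier: "x \<in> J \<Longrightarrow> x \<in> carrier (free_alg G)"
  using ideal.Icarr [OF ideal_J] .

lemma J_add: "x \<in> J \<Longrightarrow> y \<in> J \<Longrightarrow> x + y \<in> J"
  using additive_subgroup.a_closed [OF ideal.axioms(1) [OF ideal_J]] by simp

lemma J_0: "0 \<in> J"
  using additive_subgroup.zero_closed [OF ideal.axioms(1) [OF ideal_J]] by simp

lemma J_left: "x \<in> J \<Longrightarrow> a \<in> carrier (free_alg G) \<Longrightarrow> a * x \<in> J"
  and J_right: "x \<in> J \<Longrightarrow> a \<in> carrier (free_alg G) \<Longrightarrow> x * a \<in> J"
  using ideal.I_l_closed [OF ideal_J] ideal.I_r_closed [OF ideal_J] by simp_all

lemma J_minus: "x \<in> J \<Longrightarrow> - x \<in> J"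
  using J_left [of x "- 1"] by simp

lemma eqv_refl [simp, intro]: "p \<approx> p"
  by (simp add: eqv_def J_0)

lemma eqv_sym: "p \<approx> q \<Longrightarrow> q \<approx> p"
  unfolding eqv_def using J_minus [of "restrict_gens G (p - q)"] by simp

lemma eqv_trans [trans]: "p \<approx> q \<Longrightarrow> q \<approx> r \<Longrightarrow> p \<approx> r"
  unfolding eqv_def using J_add [of "restrict_gens G (p - q)" "restrict_gens G (q - r)"] by simp

lemma eqv_add: "p \<approx> q \<Longrightarrow> p' \<approx> q' \<Longrightarrow> p + p' \<approx> q + q'"
  unfolding eqv_def using J_add [of "restrict_gens G (p - q)" "restrict_gens G (p' - q')"] by (simp add: algebra_simps)

lemma eqv_minus: "p \<approx> q \<Longrightarrow> - p \<approx> - q"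
  unfolding eqv_def using J_minus [of "restrict_gens G (p - q)"] by simp

lemma eqv_diff: "p \<approx> q \<Longrightarrow> p' \<approx> q' \<Longrightarrow> p - p' \<approx> q - q'"
  using eqv_add [OF _ eqv_minus] by (metis diff_conv_add_uminus)

lemma eqv_mult_left: "p \<approx> q \<Longrightarrow> a * p \<approx> a * q"
  unfolding eqv_def using J_left [of "restrict_gens G (p - q)" "restrict_gens G a"] by (simp add: algebra_simps)

lemma eqv_mult_right: "p \<approx> q \<Longrightarrow> p * a \<approx> q * a"
  unfolding eqv_def using J_right [of "restrict_gens G (p - q)" "restrict_gens G a"] by (simp add: algebra_simps)

lemma eqv_scale: "p \<approx> q \<Longrightarrow> scale c p \<approx> scale c q"
  by (simp add: scale_def eqv_mult_left)

lemma eqv_sum: "(\<And>x. x \<in> A \<Longrightarrow> f x \<approx> g x) \<Longrightarrow> sum f A \<approx> sum g A"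
  by (induction A rule: infinite_finite_induct) (auto intro: eqv_add)

lemma eqv_gen_out: "g \<notin> G \<Longrightarrow> gen g \<approx> 0"
  by (simp add: eqv_def J_0)

lemma eqv_rel: "rel p q \<Longrightarrow> p \<approx> q"
proof -
  assume r: "rel p q"
  then have "p - q \<in> J"
    unfolding rel_ideal_def
    using ring.genideal_self [OF ring_free_alg relators_closed] by blast
  with rel_closed [OF r] show ?thesis
    by (simp add: eqv_def restrict_gens_id)
qed

lemma eqv_restrict_gens: "restrict_gens G p \<approx> p"
  by (simp add: eqv_def restrict_gens_id J_0)

lemma eqv_diff_0: "p \<approx> q \<longleftrightarrow> p - q \<approx> 0"
  by (simp add: eqv_def)

text \<open>
  The congruence class of zero is the two-sided ideal of the full free algebra which is generated by
  the relators together with the generators outside \<open>G\<close>: an element \<open>x\<close> differs from its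
  retraction by terms containing such a generator.
\<close>

lemma eqv_0_induct [consumes 1, case_names zero add left right rel gen]:
  assumes "x \<approx> 0" "P 0" "\<And>x y. P x \<Longrightarrow> P y \<Longrightarrow> P (x + y)"
    "\<And>a x. P x \<Longrightarrow> P (a * x)" "\<And>a x. P x \<Longrightarrow> P (x * a)"
    "\<And>p q. rel p q \<Longrightarrow> P (p - q)" "\<And>g. g \<notin> G \<Longrightarrow> P (gen g)"
  shows "P x"
proof -
  let ?K = "{y \<in> carrier (free_alg G). P y}"
  interpret ring "free_alg G" by (rule ring_free_alg)
  have neg: "P (- y)" if "P y" for y
    using assms(4) [OF that, of "- 1"] by simp
  have "ideal ?K (free_alg G)"
  proof (rule idealI [OF ring_free_alg])
    show "subgroup ?K (add_monoid (free_alg G))"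
    proof (rule add.subgroupI)
      fix a assume a: "a \<in> ?K"
      then have "\<ominus>\<^bsub>free_alg G\<^esub> a = - a"
        by (intro minus_equality) auto
      with a neg show "\<ominus>\<^bsub>free_alg G\<^esub> a \<in> ?K"
        by simp
    qed (use assms in auto)
  qed (use assms in auto)
  moreover have "{p - q |p q. rel p q} \<subseteq> ?K"
    using rel_closed assms(6) by auto
  ultimately have "J \<subseteq> ?K"
    unfolding rel_ideal_def by (rule genideal_minimal)
  with \<open>x \<approx> 0\<close> have "P (restrict_gens G x)"
    by (auto simp: eqv_def)
  moreover have "P (y - restrict_gens G y)" for y
  proof (induction y rule: free_induct)
    case (add p q)
    then show ?case using assms(3) [of "p - restrict_gens G p" "q - restrict_gens G q"] by (simp add: algebra_simps)
  next
    case (scale c p)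
    then show ?case
      using assms(4) [of "p - restrict_gens G p" "Poly_Mapping.single 0 c"] by (simp add: scale_def [symmetric] scale_diff_right)
  next
    case (gen g p)
    have "gen g * p - restrict_gens G (gen g * p) = gen g * (p - restrict_gens G p) + (gen g - restrict_gens G (gen g)) * restrict_gens G p"
      by (simp add: algebra_simps)
    moreover have "P (gen g - restrict_gens G (gen g))"
      using assms(2,7) by (cases "g \<in> G") auto
    ultimately show ?case
      using assms(3,4,5) gen by simp
  qed (use assms in auto)
  ultimately show ?thesis
    using assms(3) [of "restrict_gens G x" "x - restrict_gens G x"] by simp
qed

lemma free_lift_eqv:
  assumes "presentation G' rel'" and "x \<approx> y"
    and "\<And>p q. rel p q \<Longrightarrow> eqv G' rel' (free_lift f p) (free_lift f q)"
    and "\<And>g. g \<notin> G \<Longrightarrow> eqv G' rel' (f g) 0"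
  shows "eqv G' rel' (free_lift f x) (free_lift f y)"
proof -
  interpret B: presentation G' rel' by fact
  have "x - y \<approx> 0" using assms(2) eqv_diff_0 by blast
  then have "eqv G' rel' (free_lift f (x - y)) 0"
  proof (induction rule: eqv_0_induct)
    case (add x y)
    then show ?case using B.eqv_add by (fastforce simp: free_lift_simps)
  next
    case (left a x)
    then show ?case using B.eqv_mult_left by (fastforce simp: free_lift_simps)
  next
    case (right a x)
    then show ?case using B.eqv_mult_right by (fastforce simp: free_lift_simps)
  next
    case (rel p q)
    then show ?case using assms(3) B.eqv_diff_0 by (fastforce simp: free_lift_simps)
  qed (use assms(4) in auto)
  then show ?thesis
    using B.eqv_diff_0 by (simp add: free_lift_simps)
qed

text \<open>
  Together with \<open>in_cls\<close> and the descriptions of the operations below, this identifies the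
  presented algebra with the quotient of the full free algebra by the congruence.
\<close>

lemma cls_eq_iff: "cls G rel p = cls G rel q \<longleftrightarrow> p \<approx> q"
  using ring.quotient_eq_iff_same_a_r_cos [OF ring_free_alg ideal_J, of "restrict_gens G p" "restrict_gens G q"]
  by (simp add: cls_def eqv_def a_minus_free_alg)

lemma in_cls: "q \<in> cls G rel p \<longleftrightarrow> q \<in> carrier (free_alg G) \<and> q \<approx> p"
proof
  interpret ring "free_alg G" by (rule ring_free_alg)
  assume "q \<in> cls G rel p"
  then obtain x where x: "x \<in> J" "q = x + restrict_gens G p"
    by (auto simp: cls_def a_r_coset_def r_coset_def)
  then show "q \<in> carrier (free_alg G) \<and> q \<approx> p"
    using J_carrier [OF x(1)] by (auto simp: eqv_def restrict_gens_id)
next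
  assume q: "q \<in> carrier (free_alg G) \<and> q \<approx> p"
  then have "q - restrict_gens G p \<in> J" by (simp add: eqv_def) (metis restrict_gens_id)
  then show "q \<in> cls G rel p"
    by (auto simp: cls_def a_r_coset_def r_coset_def intro!: bexI [of _ "q - restrict_gens G p"])
qed

lemma presented_carrier: "carrier (presented G rel) = range (cls G rel)"
proof -
  have "(carrier (free_alg G) :: ('g, 'z) free set) = range (restrict_gens G)"
    using restrict_gens_id restrict_gens_in by (metis (no_types, lifting) image_subset_iff subsetI subset_antisym rangeI)
  then have "range (cls G rel) = (\<lambda>p. J +>\<^bsub>free_alg G\<^esub> p) ` carrier (free_alg G)"
    by (simp add: cls_def image_image)
  then show ?thesis
    by (auto simp: presented_def Let_def ring.extend_def module.fields_def FactRing_def A_RCOSETS_def')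
qed

lemma presented_mult:
  "cls G rel p \<otimes>\<^bsub>presented G rel\<^esub> cls G rel q = cls G rel (p * q)"
  using ideal.rcoset_mult_add [OF ideal_J, of "restrict_gens G p" "restrict_gens G q"]
  by (simp add: presented_def Let_def ring.extend_def module.fields_def FactRing_def cls_def)

lemma presented_add:
  "cls G rel p \<oplus>\<^bsub>presented G rel\<^esub> cls G rel q = cls G rel (p + q)"
  using ideal.a_rcos_sum [OF ideal_J, of "restrict_gens G p" "restrict_gens G q"]
  by (simp add: presented_def Let_def ring.extend_def module.fields_def FactRing_def cls_def)

lemma presented_one: "\<one>\<^bsub>presented G rel\<^esub> = cls G rel 1"
  by (simp add: presented_def Let_def ring.extend_def module.fields_def FactRing_def cls_def)

text \<open>
  The scalar multiplication of a presented algebra and the map \<^const>\<open>sgn_block\<close> are unions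
  over the representatives of a class; they are computed by any one of them.
\<close>

lemma UN_cls_const:
  assumes "\<And>q. q \<in> cls G rel p \<Longrightarrow> f q = X"
  shows "(\<Union>q\<in>cls G rel p. f q) = X"
proof -
  have "restrict_gens G p \<in> cls G rel p" by (simp add: in_cls eqv_restrict_gens)
  with assms show ?thesis by blast
qed

lemma coset_cls: "q \<in> carrier (free_alg G) \<Longrightarrow> J +>\<^bsub>free_alg G\<^esub> q = cls G rel q"
  by (simp add: cls_def restrict_gens_id)

lemma presented_smult: "c \<odot>\<^bsub>presented G rel\<^esub> cls G rel p = cls G rel (scale c p)"
proof -
  have "c \<odot>\<^bsub>presented G rel\<^esub> cls G rel p =
      (\<Union>q\<in>cls G rel p. J +>\<^bsub>free_alg G\<^esub> (scale c q))"
    by (simp add: presented_def Let_def ring.extend_def module.fields_def)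
  also have "\<dots> = cls G rel (scale c p)"
    by (rule UN_cls_const) (auto simp: in_cls coset_cls cls_eq_iff intro: eqv_scale)
  finally show ?thesis .
qed

end

section \<open>Residue sequences\<close>

lemma residue_vertices [simp]: "residue e k \<in> vertices e"
  by (simp add: vertices_def)

lemma residue_id: "v \<in> vertices e \<Longrightarrow> residue e v = v"
  by (auto simp: vertices_def residue_def split: enat.splits)

lemma residue_minus_residue: "residue e (- residue e k) = residue e (- k)"
  by (auto simp: residue_def mod_minus_eq split: enat.splits)

lemma residue_add_residue: "residue e (residue e k + l) = residue e (k + l)"
  by (auto simp: residue_def mod_add_left_eq split: enat.splits)

lemma residue_neg_neg: "v \<in> vertices e \<Longrightarrow> residue e (- residue e (- v)) = v"
  by (simp add: residue_minus_residue residue_id)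

lemma residue_0: "residue e 0 = 0"
  by (auto simp: residue_def split: enat.splits)

lemma residue_neg_0_iff: "v \<in> vertices e \<Longrightarrow> residue e (- v) = 0 \<longleftrightarrow> v = 0"
  by (metis residue_0 residue_neg_neg minus_zero)

lemma edge_neg:
  assumes "a \<in> vertices e" "b \<in> vertices e"
  shows "edge e (residue e (- a)) (residue e (- b)) \<longleftrightarrow> edge e b a"
proof -
  have *: "edge e (residue e (- a)) (residue e (- b))" if "edge e b a" for a b
  proof -
    have "residue e (residue e (- a) + 1) = residue e (1 - a)"
      by (simp add: residue_add_residue)
    also have "\<dots> = residue e (residue e (- residue e (b + 1)) + 1)"
      using that by (simp add: edge_def residue_add_residue)
    also have "\<dots> = residue e (- b)"
      by (simp only: residue_minus_residue residue_add_residue) simp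
    finally show ?thesis by (simp add: edge_def)
  qed
  show ?thesis
    using * [of b a] * [of "residue e (- a)" "residue e (- b)"] assms by (auto simp: residue_neg_neg)
qed

text \<open>
  Two opposite edges would give \<open>2 = 0\<close> in \<open>I\<close>, that is, in \<open>\<int>/e\<int>\<close> or in \<open>\<int>\<close>.
\<close>

lemma edge_asym:
  assumes "3 \<le> e" "edge e a b"
  shows "\<not> edge e b a"
proof
  assume "edge e b a"
  with assms(2) have a: "a = residue e (a + 2)"
    using residue_add_residue [of e "a + 1" 1] by (simp add: edge_def add.assoc)
  show False
  proof (cases e)
    case (enat m)
    with assms(1) have m: "3 \<le> m" by (simp add: numeral_eq_enat)
    have "a mod int m = (a + 2) mod int m"
      using arg_cong [OF a, of "\<lambda>x. x mod int m"] enat by (simp only: residue_def enat.case mod_mod_trivial)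
    then have "int m dvd a - (a + 2)" by (rule mod_eq_dvd_iff [THEN iffD1])
    then have "int m dvd 2" using dvd_minus_iff [of "int m" 2] by simp
    with m show False by (auto dest: zdvd_imp_le)
  next
    case infinity
    with a show False by (simp only: residue_def enat.case)
  qed
qed

lemma edge_irrefl: "3 \<le> e \<Longrightarrow> \<not> edge e a a"
  using edge_asym by blast

text \<open>
  Negation reverses edges, so an edge between two fixed residues would be accompanied by the
  opposite one.
\<close>

lemma edge_self_neg:
  assumes "3 \<le> e" "a \<in> vertices e" "b \<in> vertices e" "residue e (- a) = a" "residue e (- b) = b"
  shows "\<not> edge e a b"
  using edge_neg [of a e b] edge_asym [of e a b] assms by auto

lemma length_neg_seq [simp]: "length (neg_seq e \<ii>) = length \<ii>"
  by (simp add: neg_seq_def)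

lemma length_swap [simp]: "length (swap r \<ii>) = length \<ii>"
  by (simp add: swap_def)

lemma entry_neg_seq: "1 \<le> r \<Longrightarrow> r \<le> length \<ii> \<Longrightarrow> entry (neg_seq e \<ii>) r = residue e (- entry \<ii> r)"
  by (simp add: neg_seq_def entry_def)

lemma neg_neg_seq: "set \<ii> \<subseteq> vertices e \<Longrightarrow> neg_seq e (neg_seq e \<ii>) = \<ii>"
  by (auto simp: neg_seq_def residue_neg_neg intro!: map_idI)

lemma set_neg_seq [simp]: "set (neg_seq e \<ii>) \<subseteq> vertices e"
  by (auto simp: neg_seq_def)

lemma mset_neg_seq: "mset (neg_seq e \<ii>) = neg_root e (mset \<ii>)"
  by (simp add: neg_seq_def neg_root_def)

lemma swap_neg_seq:
  "1 \<le> r \<Longrightarrow> r < length \<ii> \<Longrightarrow> swap r (neg_seq e \<ii>) = neg_seq e (swap r \<ii>)"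
  by (simp add: swap_def entry_def neg_seq_def map_update)

lemma mset_swap: "1 \<le> r \<Longrightarrow> r < length \<ii> \<Longrightarrow> mset (swap r \<ii>) = mset \<ii>"
  using Multiset.mset_swap [of r \<ii> "r - 1"] by (simp add: swap_def entry_def)

lemma nth_swap:
  assumes "1 \<le> r" "r < length \<ii>"
  shows "swap r \<ii> ! k = \<ii> ! (if k = r - 1 then r else if k = r then r - 1 else k)"
  using assms by (cases "k < length \<ii>") (auto simp: swap_def entry_def nth_list_update list_update_beyond)

lemma swap_swap: "1 \<le> r \<Longrightarrow> r < length \<ii> \<Longrightarrow> swap r (swap r \<ii>) = \<ii>"
  by (rule nth_equalityI) (auto simp: nth_swap)

lemma swap_commute:
  assumes "1 \<le> r" "r < length \<ii>" "1 \<le> t" "t < length \<ii>" "\<bar>int r - int t\<bar> > 1"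
  shows "swap r (swap t \<ii>) = swap t (swap r \<ii>)"
  using assms by (intro nth_equalityI) (auto simp: nth_swap)

lemma swap_braid:
  assumes "1 \<le> r" "r + 1 < length \<ii>"
  shows "swap r (swap (r + 1) (swap r \<ii>)) = swap (r + 1) (swap r (swap (r + 1) \<ii>))"
proof (rule nth_equalityI)
  fix k
  have "r \<noteq> r - 1" "r + 1 \<noteq> r" "r + 1 \<noteq> r - 1" using assms by auto
  with assms show "swap r (swap (r + 1) (swap r \<ii>)) ! k = swap (r + 1) (swap r (swap (r + 1) \<ii>)) ! k"
    by (simp add: nth_swap)
qed simp

lemma swap_id:
  assumes "1 \<le> r" "r < length \<ii>" "entry \<ii> r = entry \<ii> (r + 1)"
  shows "swap r \<ii> = \<ii>"
  using assms by (intro nth_equalityI) (simp_all add: nth_swap entry_def)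

text \<open>
  This is the case in which the error term of the braid relation can be nonzero.
\<close>

lemma swap_braid_id:
  assumes "1 \<le> r" "r + 1 < length \<ii>" "entry \<ii> r = entry \<ii> (r + 2)"
  shows "swap r (swap (r + 1) (swap r \<ii>)) = \<ii>"
proof (rule nth_equalityI)
  fix k
  have "r \<noteq> r - 1" "r + 1 \<noteq> r" "r + 1 \<noteq> r - 1" "\<ii> ! (r - 1) = \<ii> ! (r + 1)"
    using assms by (auto simp: entry_def)
  with assms show "swap r (swap (r + 1) (swap r \<ii>)) ! k = \<ii> ! k"
    by (simp add: nth_swap)
qed simp

lemma entry_swap:
  "1 \<le> r \<Longrightarrow> r < length \<ii> \<Longrightarrow> entry (swap r \<ii>) r = entry \<ii> (r + 1)"
  "1 \<le> r \<Longrightarrow> r < length \<ii> \<Longrightarrow> entry (swap r \<ii>) (r + 1) = entry \<ii> r"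
  by (simp_all add: swap_def entry_def)

lemma neg_neg_root: "\<alpha> \<in> roots e n \<Longrightarrow> neg_root e (neg_root e \<alpha>) = \<alpha>"
  by (auto simp: roots_def neg_root_def image_mset.compositionality comp_def residue_neg_neg
      intro!: multiset.map_ident_strong)

lemma neg_root_roots [simp]: "\<alpha> \<in> roots e n \<Longrightarrow> neg_root e \<alpha> \<in> roots e n"
  by (auto simp: roots_def neg_root_def)

lemma seqs_length: "\<ii> \<in> seqs \<alpha> \<Longrightarrow> \<alpha> \<in> roots e n \<Longrightarrow> length \<ii> = n"
  by (auto simp: seqs_def roots_def)

lemma seqs_set: "\<ii> \<in> seqs \<alpha> \<Longrightarrow> \<alpha> \<in> roots e n \<Longrightarrow> set \<ii> \<subseteq> vertices e"
  by (auto simp: seqs_def roots_def)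

lemma finite_seqs [simp]: "finite (seqs \<alpha>)"
proof -
  have "seqs \<alpha> \<subseteq> {xs. set xs \<subseteq> set_mset \<alpha> \<and> length xs = size \<alpha>}"
    by (auto simp: seqs_def)
  then show ?thesis by (rule finite_subset) (simp add: finite_lists_length_eq)
qed

lemma seqs_swap: "\<ii> \<in> seqs \<alpha> \<Longrightarrow> 1 \<le> r \<Longrightarrow> r < size \<alpha> \<Longrightarrow> swap r \<ii> \<in> seqs \<alpha>"
  by (auto simp: seqs_def mset_swap)

lemma seqs_neg: "\<ii> \<in> seqs \<alpha> \<Longrightarrow> neg_seq e \<ii> \<in> seqs (neg_root e \<alpha>)"
  by (auto simp: seqs_def mset_neg_seq)

lemma root_classes_cases:
  assumes "\<gamma> \<in> root_classes e n"
  obtains \<alpha> where "\<alpha> \<in> roots e n" "\<gamma> = {\<alpha>, neg_root e \<alpha>}"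
  using assms by (auto simp: root_classes_def elim!: quotientE)

context
  fixes e :: enat and n :: nat and \<gamma> :: "int multiset set"
  assumes \<gamma>: "\<gamma> \<in> root_classes e n"
begin

lemma class_roots: "\<alpha> \<in> \<gamma> \<Longrightarrow> \<alpha> \<in> roots e n"
  using \<gamma> by (rule root_classes_cases) auto

lemma class_neg_root: "\<alpha> \<in> \<gamma> \<Longrightarrow> neg_root e \<alpha> \<in> \<gamma>"
  using \<gamma> by (rule root_classes_cases) (auto simp: neg_neg_root)

lemma class_size: "\<alpha> \<in> \<gamma> \<Longrightarrow> size \<alpha> = n"
  using class_roots by (auto simp: roots_def)

lemma finite_class: "finite \<gamma>"
  using \<gamma> by (rule root_classes_cases) auto

lemma class_seqsE:
  assumes "\<ii> \<in> class_seqs \<gamma>" obtains \<alpha> where "\<alpha> \<in> \<gamma>" "\<ii> \<in> seqs \<alpha>"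
  using assms by (auto simp: class_seqs_def)

lemma class_seqsI: "\<alpha> \<in> \<gamma> \<Longrightarrow> \<ii> \<in> seqs \<alpha> \<Longrightarrow> \<ii> \<in> class_seqs \<gamma>"
  by (auto simp: class_seqs_def)

lemma finite_class_seqs: "finite (class_seqs \<gamma>)"
  by (simp add: class_seqs_def finite_class)

lemma class_seqs_length: "\<ii> \<in> class_seqs \<gamma> \<Longrightarrow> length \<ii> = n"
  by (meson class_seqsE class_roots seqs_length)

lemma class_seqs_set: "\<ii> \<in> class_seqs \<gamma> \<Longrightarrow> set \<ii> \<subseteq> vertices e"
  by (meson class_seqsE class_roots seqs_set)

lemma class_seqs_swap: "\<ii> \<in> class_seqs \<gamma> \<Longrightarrow> 1 \<le> r \<Longrightarrow> r < n \<Longrightarrow> swap r \<ii> \<in> class_seqs \<gamma>"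
  by (metis class_seqsE class_seqsI class_size seqs_swap)

lemma class_seqs_neg: "\<ii> \<in> class_seqs \<gamma> \<Longrightarrow> neg_seq e \<ii> \<in> class_seqs \<gamma>"
  by (meson class_seqsE class_seqsI class_neg_root seqs_neg)

end

section \<open>Quiver Hecke algebras\<close>

lemma klr_gens_iff:
  "E_gen \<ii> \<in> klr_gens \<alpha> \<longleftrightarrow> \<ii> \<in> seqs \<alpha>"
  "Psi_gen r \<in> klr_gens \<alpha> \<longleftrightarrow> 1 \<le> r \<and> r < size \<alpha>"
  "Y_gen r \<in> klr_gens \<alpha> \<longleftrightarrow> 1 \<le> r \<and> r \<le> size \<alpha>"
  by (auto simp: klr_gens_def)

lemma alt_gens_iff:
  "AE_gen \<ii> \<in> alt_gens n \<gamma> \<longleftrightarrow> \<ii> \<in> class_seqs \<gamma>"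
  "APsi_gen r \<ii> \<in> alt_gens n \<gamma> \<longleftrightarrow> 1 \<le> r \<and> r < n \<and> \<ii> \<in> class_seqs \<gamma>"
  "AY_gen r \<ii> \<in> alt_gens n \<gamma> \<longleftrightarrow> 1 \<le> r \<and> r \<le> n \<and> \<ii> \<in> class_seqs \<gamma>"
  by (auto simp: alt_gens_def)

lemma klr_presentation:
  fixes \<alpha> :: "int multiset"
  shows "presentation (klr_gens \<alpha>) (klr_rel e \<alpha> :: (klr_gen, 'z::comm_ring_1) free \<Rightarrow> _)"
proof
  fix p q :: "(klr_gen, 'z) free"
  note [simp] = klr_gens_iff
  assume "klr_rel e \<alpha> p q"
  then show "p \<in> carrier (free_alg (klr_gens \<alpha>)) \<and> q \<in> carrier (free_alg (klr_gens \<alpha>))"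
    by cases (auto intro!: free_alg_mult free_alg_add free_alg_diff free_alg_minus free_alg_power
      free_alg_when free_alg_sum free_alg_gen seqs_swap)
qed

lemma alt_presentation:
  assumes \<gamma>: "\<gamma> \<in> root_classes e n"
  shows "presentation (alt_gens n \<gamma>) (alt_rel e n \<gamma> :: (alt_gen, 'z::comm_ring_1) free \<Rightarrow> _)"
proof
  fix p q :: "(alt_gen, 'z) free"
  note [simp] = alt_gens_iff
  note [simp] = class_seqs_swap [OF \<gamma>] class_seqs_neg [OF \<gamma>]
  assume "alt_rel e n \<gamma> p q"
  then show "p \<in> carrier (free_alg (alt_gens n \<gamma>)) \<and> q \<in> carrier (free_alg (alt_gens n \<gamma>))"
    by cases (auto intro!: free_alg_mult free_alg_add free_alg_diff free_alg_minus free_alg_power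
      free_alg_when free_alg_sum free_alg_gen free_alg_scale)
qed

text \<open>
  The map \<^const>\<open>neg_seq\<close> is injective only on sequences of residues; \<^const>\<open>sgn_gen\<close> may send a
  sequence that belongs to no block into a block. Killing the sequences with other entries makes the
  map compatible with the congruence on the full free algebra.
\<close>

definition sgn_map_gen :: "enat \<Rightarrow> klr_gen \<Rightarrow> (klr_gen, 'z::comm_ring_1) free"
  where "sgn_map_gen e g = (sgn_gen e g when (\<forall>\<ii>. g = E_gen \<ii> \<longrightarrow> set \<ii> \<subseteq> vertices e))"

locale alternating_block =
  fixes e :: enat and n :: nat and \<gamma> :: "int multiset set" and h :: "'z::idom"
  assumes e3: "3 \<le> e" and n2: "2 \<le> n" and \<gamma>: "\<gamma> \<in> root_classes e n" and h: "h + h = 1"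
begin

abbreviation sgn_map :: "(klr_gen, 'z) free \<Rightarrow> (klr_gen, 'z) free" where "sgn_map \<equiv> free_lift (sgn_map_gen e)"

abbreviation neg :: "int list \<Rightarrow> int list" where "neg \<equiv> neg_seq e"

lemma neg_neg: "\<ii> \<in> class_seqs \<gamma> \<Longrightarrow> neg (neg \<ii>) = \<ii>"
  by (intro neg_neg_seq class_seqs_set [OF \<gamma>])

lemma entry_vertices: "\<ii> \<in> class_seqs \<gamma> \<Longrightarrow> 1 \<le> r \<Longrightarrow> r \<le> n \<Longrightarrow> entry \<ii> r \<in> vertices e"
  using class_seqs_set [OF \<gamma>, of \<ii>] class_seqs_length [OF \<gamma>, of \<ii>] by (auto simp: entry_def)

lemma entry_neg: "\<ii> \<in> class_seqs \<gamma> \<Longrightarrow> 1 \<le> r \<Longrightarrow> r \<le> n \<Longrightarrow> entry (neg \<ii>) r = residue e (- entry \<ii> r)"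
  using class_seqs_length [OF \<gamma>, of \<ii>] by (simp add: entry_neg_seq)

lemma entry_neg_eq_iff:
  assumes "\<ii> \<in> class_seqs \<gamma>" "1 \<le> r" "r \<le> n" "1 \<le> s" "s \<le> n"
  shows "entry (neg \<ii>) r = entry (neg \<ii>) s \<longleftrightarrow> entry \<ii> r = entry \<ii> s"
  using assms entry_vertices [of \<ii>] by (simp add: entry_neg) (metis residue_neg_neg)

lemma edge_neg_iff:
  assumes "\<ii> \<in> class_seqs \<gamma>" "1 \<le> r" "r \<le> n" "1 \<le> s" "s \<le> n"
  shows "edge e (entry (neg \<ii>) r) (entry (neg \<ii>) s) \<longleftrightarrow> edge e (entry \<ii> s) (entry \<ii> r)"
  using assms by (simp add: entry_neg edge_neg entry_vertices)

lemma Lambda0_neg: "\<ii> \<in> class_seqs \<gamma> \<Longrightarrow> Lambda0 (entry (neg \<ii>) 1) = Lambda0 (entry \<ii> 1)"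
  using n2 entry_vertices [of \<ii> 1] by (simp add: entry_neg Lambda0_def residue_neg_0_iff)

lemma swap_neg: "\<ii> \<in> class_seqs \<gamma> \<Longrightarrow> 1 \<le> r \<Longrightarrow> r < n \<Longrightarrow> swap r (neg \<ii>) = neg (swap r \<ii>)"
  using class_seqs_length [OF \<gamma>, of \<ii>] by (simp add: swap_neg_seq)

end

text \<open>
  One of the at most two blocks \<open>\<alpha>\<close> in the class \<open>\<gamma>\<close>.
\<close>

locale alternating_component = alternating_block e n \<gamma> h
  for e :: enat and n :: nat and \<gamma> :: "int multiset set" and h :: "'z::idom" +
  fixes \<alpha> :: "int multiset"
  assumes \<alpha>: "\<alpha> \<in> \<gamma>"
begin

sublocale K: presentation "klr_gens \<alpha>" "klr_rel e \<alpha> :: (klr_gen, 'z) free \<Rightarrow> _"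
  by (rule klr_presentation)

abbreviation keqv (infix "\<sim>" 50)
  where "x \<sim> y \<equiv> eqv (klr_gens \<alpha>) (klr_rel e \<alpha> :: (klr_gen, 'z) free \<Rightarrow> _) x y"

lemma size_component [simp]: "size \<alpha> = n"
  by (rule class_size [OF \<gamma> \<alpha>])

lemma seqs_class: "\<ii> \<in> seqs \<alpha> \<Longrightarrow> \<ii> \<in> class_seqs \<gamma>"
  by (rule class_seqsI [OF \<gamma> \<alpha>])

lemma idem_mult: "gE \<ii> * gE \<jj> \<sim> (gE \<ii> when \<ii> = \<jj>)" if "\<jj> \<in> seqs \<alpha>"
proof (cases "\<ii> \<in> seqs \<alpha>")
  case True
  with that show ?thesis by (intro K.eqv_rel klr_rel.idem_idem)
next
  case False
  then have "gE \<ii> \<sim> 0" by (intro K.eqv_gen_out) (auto simp: klr_gens_def)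
  from K.eqv_mult_right [OF this] False that show ?thesis by (auto simp: when_def)
qed

text \<open>
  The weight space of \<open>\<jj>\<close> in the left regular representation of the block. The relations are used
  below in the form in which they act on weight vectors.
\<close>

definition in_weight :: "int list \<Rightarrow> (klr_gen, 'z) free \<Rightarrow> bool"
  where "in_weight \<jj> v \<longleftrightarrow> \<jj> \<in> seqs \<alpha> \<and> gE \<jj> * v \<sim> v"

lemma in_weight_E: "\<jj> \<in> seqs \<alpha> \<Longrightarrow> in_weight \<jj> (gE \<jj> * v)"
  using K.eqv_mult_right [OF idem_mult [of \<jj> \<jj>], of v] by (simp add: in_weight_def mult.assoc)

lemma E_in_weight: "in_weight \<jj> v \<Longrightarrow> gE \<ii> * v \<sim> (v when \<ii> = \<jj>)"
proof -
  assume v: "in_weight \<jj> v"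
  then have "gE \<ii> * v \<sim> gE \<ii> * (gE \<jj> * v)"
    by (auto simp: in_weight_def intro: K.eqv_sym K.eqv_mult_left)
  also have "\<dots> \<sim> (gE \<ii> when \<ii> = \<jj>) * v"
    using v K.eqv_mult_right [OF idem_mult [of \<jj> \<ii>], of v] by (simp add: in_weight_def mult.assoc)
  also have "\<dots> \<sim> (v when \<ii> = \<jj>)"
    using v by (cases "\<ii> = \<jj>") (auto simp: in_weight_def)
  finally show ?thesis .
qed

lemma eqv_in_weight: "p * gE \<jj> \<sim> q * gE \<jj> \<Longrightarrow> in_weight \<jj> v \<Longrightarrow> p * v \<sim> q * v"
proof -
  assume pq: "p * gE \<jj> \<sim> q * gE \<jj>" and v: "in_weight \<jj> v"
  have "p * v \<sim> p * (gE \<jj> * v)" "q * (gE \<jj> * v) \<sim> q * v"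
    using v by (auto simp: in_weight_def intro: K.eqv_mult_left K.eqv_sym)
  with K.eqv_mult_right [OF pq, of v] show ?thesis
    unfolding mult.assoc by (meson K.eqv_trans)
qed

lemma in_weight_minus: "in_weight \<jj> v \<Longrightarrow> in_weight \<jj> (- v)"
  using K.eqv_minus [of "gE \<jj> * v" v] by (simp add: in_weight_def)

lemma in_weight_Y: "in_weight \<jj> v \<Longrightarrow> 1 \<le> r \<Longrightarrow> r \<le> n \<Longrightarrow> in_weight \<jj> (gY r * v)"
proof -
  assume v: "in_weight \<jj> v" "1 \<le> r" "r \<le> n"
  then have "gE \<jj> * gY r \<sim> gY r * gE \<jj>"
    by (intro K.eqv_sym [OF K.eqv_rel] klr_rel.y_idem) (auto simp: in_weight_def)
  from K.eqv_mult_right [OF this, of v] have "gE \<jj> * (gY r * v) \<sim> gY r * (gE \<jj> * v)"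
    by (simp add: mult.assoc)
  also have "\<dots> \<sim> gY r * v" using v by (auto simp: in_weight_def intro: K.eqv_mult_left)
  finally show ?thesis using v by (simp add: in_weight_def)
qed

lemma in_weight_Psi: "in_weight \<jj> v \<Longrightarrow> 1 \<le> r \<Longrightarrow> r < n \<Longrightarrow> in_weight (swap r \<jj>) (gPsi r * v)"
proof -
  assume v: "in_weight \<jj> v" "1 \<le> r" "r < n"
  then have "gE (swap r \<jj>) * gPsi r \<sim> gPsi r * gE \<jj>"
    by (intro K.eqv_sym [OF K.eqv_rel] klr_rel.psi_idem) (auto simp: in_weight_def)
  from K.eqv_mult_right [OF this, of v] have "gE (swap r \<jj>) * (gPsi r * v) \<sim> gPsi r * (gE \<jj> * v)"
    by (simp add: mult.assoc)
  also have "\<dots> \<sim> gPsi r * v" using v by (auto simp: in_weight_def intro: K.eqv_mult_left)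
  finally show ?thesis using v by (simp add: in_weight_def seqs_swap)
qed

lemma weight_cyclotomic: "in_weight \<jj> v \<Longrightarrow> gY 1 ^ Lambda0 (entry \<jj> 1) * v \<sim> 0"
  using eqv_in_weight [of "gY 1 ^ Lambda0 (entry \<jj> 1)" \<jj> 0 v] K.eqv_rel [OF klr_rel.cyclotomic [of \<jj> \<alpha> e]] n2
  by (simp add: in_weight_def)

lemma weight_psi_y_Suc:
  "in_weight \<jj> v \<Longrightarrow> 1 \<le> r \<Longrightarrow> r < n \<Longrightarrow>
    gPsi r * (gY (r + 1) * v) \<sim> gY r * (gPsi r * v) + (v when entry \<jj> r = entry \<jj> (r + 1))"
  using eqv_in_weight [OF K.eqv_rel [OF klr_rel.psi_y_Suc [of \<jj> \<alpha> r e]], of v]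
  by (simp add: in_weight_def mult.assoc distrib_right when_mult)

lemma weight_y_Suc_psi:
  "in_weight \<jj> v \<Longrightarrow> 1 \<le> r \<Longrightarrow> r < n \<Longrightarrow>
    gY (r + 1) * (gPsi r * v) \<sim> gPsi r * (gY r * v) + (v when entry \<jj> r = entry \<jj> (r + 1))"
  using eqv_in_weight [OF K.eqv_rel [OF klr_rel.y_Suc_psi [of \<jj> \<alpha> r e]], of v]
  by (simp add: in_weight_def mult.assoc distrib_right when_mult)

lemma weight_quadratic:
  assumes v: "in_weight \<jj> v" "1 \<le> r" "r < n"
  shows "gPsi r * (gPsi r * v) \<sim>
    (if entry \<jj> r = entry \<jj> (r + 1) then 0
     else if edge e (entry \<jj> r) (entry \<jj> (r + 1)) then gY r * v - gY (r + 1) * v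
     else if edge e (entry \<jj> (r + 1)) (entry \<jj> r) then gY (r + 1) * v - gY r * v
     else v)"
proof -
  let ?q = "if entry \<jj> r = entry \<jj> (r + 1) then 0
     else if edge e (entry \<jj> r) (entry \<jj> (r + 1)) then gY r - gY (r + 1)
     else if edge e (entry \<jj> (r + 1)) (entry \<jj> r) then gY (r + 1) - gY r
     else (1 :: (klr_gen, 'z) free)"
  have "gPsi r ^ 2 * gE \<jj> \<sim> ?q * gE \<jj>"
    using K.eqv_rel [OF klr_rel.quadratic [of \<jj> \<alpha> r e]] v
    by (simp add: in_weight_def if_distrib [of "\<lambda>x. x * _"] cong: if_cong)
  from eqv_in_weight [OF this v(1)] show ?thesis
    by (simp add: power2_eq_square mult.assoc left_diff_distrib if_distrib [of "\<lambda>x. x * _"] cong: if_cong)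
qed

lemma weight_braid:
  assumes v: "in_weight \<jj> v" "1 \<le> r" "r + 1 < n"
  shows "gPsi r * (gPsi (r + 1) * (gPsi r * v)) - gPsi (r + 1) * (gPsi r * (gPsi (r + 1) * v)) \<sim>
    (if entry \<jj> r = entry \<jj> (r + 2) \<and> edge e (entry \<jj> r) (entry \<jj> (r + 1)) then - v
     else if entry \<jj> r = entry \<jj> (r + 2) \<and> edge e (entry \<jj> (r + 1)) (entry \<jj> r) then v
     else 0)"
proof -
  let ?q = "if entry \<jj> r = entry \<jj> (r + 2) \<and> edge e (entry \<jj> r) (entry \<jj> (r + 1)) then - 1
     else if entry \<jj> r = entry \<jj> (r + 2) \<and> edge e (entry \<jj> (r + 1)) (entry \<jj> r) then 1
     else (0 :: (klr_gen, 'z) free)"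
  have "(gPsi r * gPsi (r + 1) * gPsi r - gPsi (r + 1) * gPsi r * gPsi (r + 1)) * gE \<jj> \<sim> ?q * gE \<jj>"
    using K.eqv_rel [OF klr_rel.braid [of \<jj> \<alpha> r e]] v
    by (simp add: in_weight_def if_distrib [of "\<lambda>x. x * _"] cong: if_cong)
  from eqv_in_weight [OF this v(1)] show ?thesis
    by (simp add: mult.assoc left_diff_distrib if_distrib [of "\<lambda>x. x * _"] cong: if_cong)
qed

lemma y_y_act: "1 \<le> r \<Longrightarrow> r \<le> n \<Longrightarrow> 1 \<le> s \<Longrightarrow> s \<le> n \<Longrightarrow> gY r * (gY s * v) \<sim> gY s * (gY r * v)"
  using K.eqv_mult_right [OF K.eqv_rel [OF klr_rel.y_y [of r \<alpha> s e]], of v] by (simp add: mult.assoc)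

lemma psi_y_act:
  "1 \<le> r \<Longrightarrow> r < n \<Longrightarrow> 1 \<le> s \<Longrightarrow> s \<le> n \<Longrightarrow> s \<noteq> r \<Longrightarrow> s \<noteq> r + 1 \<Longrightarrow>
    gPsi r * (gY s * v) \<sim> gY s * (gPsi r * v)"
  using K.eqv_mult_right [OF K.eqv_rel [OF klr_rel.psi_y [of r \<alpha> s e]], of v] by (simp add: mult.assoc)

lemma psi_psi_act:
  "1 \<le> r \<Longrightarrow> r < n \<Longrightarrow> 1 \<le> s \<Longrightarrow> s < n \<Longrightarrow> \<bar>int r - int s\<bar> > 1 \<Longrightarrow>
    gPsi r * (gPsi s * v) \<sim> gPsi s * (gPsi r * v)"
  using K.eqv_mult_right [OF K.eqv_rel [OF klr_rel.psi_psi [of r \<alpha> s e]], of v] by (simp add: mult.assoc)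

text \<open>
  The idempotents sum to 1.
\<close>

lemma eqv_on_weights:
  assumes "\<And>\<jj> v. in_weight \<jj> v \<Longrightarrow> p * v \<sim> q * v"
  shows "p \<sim> q"
proof -
  have one: "x \<sim> (\<Sum>\<ii>\<in>seqs \<alpha>. x * gE \<ii>)" for x
    using K.eqv_mult_left [OF K.eqv_sym [OF K.eqv_rel [OF klr_rel.idem_sum [of e \<alpha>]]], of x]
    by (simp add: sum_distrib_left)
  have "(\<Sum>\<ii>\<in>seqs \<alpha>. p * gE \<ii>) \<sim> (\<Sum>\<ii>\<in>seqs \<alpha>. q * gE \<ii>)"
    using assms in_weight_E [of _ 1] by (intro K.eqv_sum) auto
  then show ?thesis
    using one K.eqv_trans K.eqv_sym by meson
qed

text \<open>
  All entries of a sequence with \<open>-\<jj> = \<jj>\<close> are 0 or, for even \<open>e\<close>, \<open>e/2\<close>, and \<open>e(\<jj>) = 0\<close> unless it starts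
  with 0. If it starts with \<open>0, 0\<close>, then \<open>y\<^sub>2 \<psi>\<^sub>1\<close> acts as the identity, whereas \<open>\<psi>\<^sub>1\<^sup>2 = 0\<close>. If it starts
  with \<open>0, e/2\<close>, then \<open>\<psi>\<^sub>1\<^sup>2\<close> acts as the identity, because there is no edge between the two residues,
  but \<open>\<psi>\<^sub>1\<close> leads to a sequence starting with \<open>e/2\<close>, where everything vanishes.
\<close>

lemma weight_self_neg:
  assumes v: "in_weight \<jj> v" and neg: "neg \<jj> = \<jj>"
  shows "v \<sim> 0"
proof -
  have j: "\<jj> \<in> seqs \<alpha>" using v by (simp add: in_weight_def)
  let ?a = "entry \<jj> 1" and ?b = "entry \<jj> (1 + 1)"
  have vert: "?a \<in> vertices e" "?b \<in> vertices e"
    using entry_vertices [OF seqs_class [OF j]] n2 by auto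
  have fx: "residue e (- ?a) = ?a" "residue e (- ?b) = ?b"
    using entry_neg [OF seqs_class [OF j], of 1, unfolded neg, symmetric]
      entry_neg [OF seqs_class [OF j], of "1 + 1", unfolded neg, symmetric] n2 by simp_all
  consider "?a \<noteq> 0" | "?a = 0" "?b = ?a" | "?a = 0" "?b \<noteq> ?a" by blast
  then show ?thesis
  proof cases
    case 1
    then show ?thesis
      using weight_cyclotomic [OF v] by (simp add: Lambda0_def)
  next
    case 2
    let ?w = "gPsi 1 * v"
    have sw: "swap 1 \<jj> = \<jj>"
      using 2 n2 seqs_class [OF j] by (intro swap_id) (auto simp: class_seqs_length [OF \<gamma>])
    have w: "in_weight \<jj> ?w"
      using in_weight_Psi [OF v, of 1] n2 sw by simp
    have y0: "gY 1 * u \<sim> 0" if "in_weight \<jj> u" for u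
      using weight_cyclotomic [OF that] 2 by (simp add: Lambda0_def)
    have yp: "gY 2 * (gPsi 1 * u) \<sim> u" if "in_weight \<jj> u" for u
    proof -
      have "gY 2 * (gPsi 1 * u) \<sim> gPsi 1 * (gY 1 * u) + u"
        using weight_y_Suc_psi [OF that, of 1, unfolded one_add_one] 2(2) n2 unfolding one_add_one by simp
      also have "\<dots> \<sim> gPsi 1 * 0 + u"
        by (intro K.eqv_add K.eqv_mult_left y0 that K.eqv_refl)
      finally show ?thesis by simp
    qed
    have "gPsi 1 * ?w \<sim> 0"
      by (rule K.eqv_trans [OF weight_quadratic [OF v]]) (use n2 2(2) in simp_all)
    from K.eqv_trans [OF K.eqv_sym [OF yp [OF w]] K.eqv_mult_left [OF this, of "gY 2"]]
    have "?w \<sim> 0" by simp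
    from K.eqv_trans [OF K.eqv_sym [OF yp [OF v]] K.eqv_mult_left [OF this, of "gY 2"]]
    show ?thesis by simp
  next
    case 3
    let ?w = "gPsi 1 * v"
    have w: "in_weight (swap 1 \<jj>) ?w"
      using in_weight_Psi [OF v, of 1] n2 by simp
    have "entry (swap 1 \<jj>) 1 = ?b"
      using n2 seqs_class [OF j] by (intro entry_swap) (auto simp: class_seqs_length [OF \<gamma>])
    then have "?w \<sim> 0"
      using weight_cyclotomic [OF w] 3 by (simp add: Lambda0_def)
    from K.eqv_mult_left [OF this, of "gPsi 1"] have "gPsi 1 * ?w \<sim> 0" by simp
    moreover have "gPsi 1 * ?w \<sim> v"
      using weight_quadratic [OF v, of 1] n2 3 edge_self_neg [OF e3 vert fx]
        edge_self_neg [OF e3 vert(2,1) fx(2,1)] by auto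
    ultimately show ?thesis using K.eqv_sym K.eqv_trans by blast
  qed
qed

section \<open>The sign automorphism\<close>

text \<open>
  Up to a common sign of both sides, each relation for \<open>\<ii>\<close> becomes the relation of the same kind for
  \<open>-\<ii>\<close>: changing the signs of \<open>\<psi>\<close> and \<open>y\<close> compensates for the reversal of all edges.
\<close>

lemma sgn_rel:
  assumes "klr_rel e (neg_root e \<alpha>) p (q :: (klr_gen, 'z) free)"
  shows "sgn_map p \<sim> sgn_map q"
proof -
  have seqs: "neg \<ii> \<in> seqs \<alpha>" "\<ii> \<in> class_seqs \<gamma>" if "\<ii> \<in> seqs (neg_root e \<alpha>)" for \<ii>
    using seqs_neg [OF that, of e] class_seqsI [OF \<gamma> class_neg_root [OF \<gamma> \<alpha>] that]
    by (simp_all add: neg_neg_root [OF class_roots [OF \<gamma> \<alpha>]])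
  have [simp]: "size (neg_root e \<alpha>) = n"
    by (rule class_size [OF \<gamma> class_neg_root [OF \<gamma> \<alpha>]])
  have [simp]: "sgn_map_gen e (Psi_gen r) = - gPsi r" "sgn_map_gen e (Y_gen r) = - gY r"
    "\<ii> \<in> seqs (neg_root e \<alpha>) \<Longrightarrow> sgn_map_gen e (E_gen \<ii>) = gE (neg \<ii>)"
    "\<ii> \<in> class_seqs \<gamma> \<Longrightarrow> sgn_map_gen e (E_gen \<ii>) = gE (neg \<ii>)" for r \<ii>
    using seqs(2) [of \<ii>] class_seqs_set [OF \<gamma>, of \<ii>] by (auto simp: sgn_map_gen_def)
  have [simp]: "swap r \<ii> \<in> class_seqs \<gamma>" if "\<ii> \<in> class_seqs \<gamma>" "1 \<le> r" "r < n" for r \<ii>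
    using class_seqs_swap [OF \<gamma>] that by blast
  from assms show ?thesis
  proof cases
    case (cyclotomic \<ii>)
    then show ?thesis
      using K.eqv_rel [OF klr_rel.cyclotomic [OF seqs(1), of \<ii> e]] seqs(2)
      by (simp add: free_lift_simps Lambda0_def entry_neg residue_neg_0_iff entry_vertices split: if_splits)
        (metis K.eqv_minus add.inverse_neutral)
  next
    case (idem_idem \<ii> \<jj>)
    then have "neg \<ii> = neg \<jj> \<longleftrightarrow> \<ii> = \<jj>"
      by (metis seqs(2) neg_neg)
    with idem_idem show ?thesis
      using K.eqv_rel [OF klr_rel.idem_idem [OF seqs(1) seqs(1), of \<ii> \<jj> e]]
      by (simp add: free_lift_simps)
  next
    case idem_sum
    have "bij_betw neg (seqs (neg_root e \<alpha>)) (seqs \<alpha>)"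
      using seqs neg_neg seqs_class seqs_neg by (intro bij_betw_byWitness [where f' = neg]) auto
    then have "(\<Sum>\<ii>\<in>seqs (neg_root e \<alpha>). gE (neg \<ii>)) = (\<Sum>\<ii>\<in>seqs \<alpha>. gE \<ii> :: (klr_gen, 'z) free)"
      by (rule sum.reindex_bij_betw)
    with idem_sum show ?thesis
      using K.eqv_rel [OF klr_rel.idem_sum [of e \<alpha>]] by (simp add: free_lift_simps)
  next
    case (y_idem \<ii> r)
    then show ?thesis
      using K.eqv_minus [OF K.eqv_rel [OF klr_rel.y_idem [OF seqs(1), of \<ii> r e]]]
      by (simp add: free_lift_simps)
  next
    case (psi_idem \<ii> r)
    then show ?thesis
      using K.eqv_minus [OF K.eqv_rel [OF klr_rel.psi_idem [OF seqs(1), of \<ii> r e]]] seqs(2)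
      by (simp add: free_lift_simps swap_neg)
  next
    case (y_y r s)
    then show ?thesis
      using K.eqv_rel [OF klr_rel.y_y [of r \<alpha> s e]] by (simp add: free_lift_simps)
  next
    case (psi_y_Suc \<ii> r)
    then show ?thesis
      using K.eqv_rel [OF klr_rel.psi_y_Suc [OF seqs(1), of \<ii> r e]] seqs(2)
      by (simp add: free_lift_simps entry_neg_eq_iff)
  next
    case (y_Suc_psi \<ii> r)
    then show ?thesis
      using K.eqv_rel [OF klr_rel.y_Suc_psi [OF seqs(1), of \<ii> r e]] seqs(2)
      by (simp add: free_lift_simps entry_neg_eq_iff)
  next
    case (psi_y r s)
    then show ?thesis
      using K.eqv_rel [OF klr_rel.psi_y [of r \<alpha> s e]] by (simp add: free_lift_simps)
  next
    case (psi_psi r s)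
    then show ?thesis
      using K.eqv_rel [OF klr_rel.psi_psi [of r \<alpha> s e]] by (simp add: free_lift_simps)
  next
    case (quadratic \<ii> r)
    have "\<not> (edge e (entry \<ii> r) (entry \<ii> (r + 1)) \<and> edge e (entry \<ii> (r + 1)) (entry \<ii> r))"
      using edge_asym [OF e3] by blast
    with quadratic show ?thesis
      using K.eqv_rel [OF klr_rel.quadratic [OF seqs(1), of \<ii> r e]] seqs(2)
      by (auto simp: free_lift_simps entry_neg_eq_iff edge_neg_iff algebra_simps split: if_splits)
  next
    case (braid \<ii> r)
    have "\<not> (edge e (entry \<ii> r) (entry \<ii> (r + 1)) \<and> edge e (entry \<ii> (r + 1)) (entry \<ii> r))"
      using edge_asym [OF e3] by blast
    with braid(3-) seqs(2) [of \<ii>] have c: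
      "entry (neg \<ii>) r = entry (neg \<ii>) (r + 2) \<and> edge e (entry (neg \<ii>) r) (entry (neg \<ii>) (r + 1)) \<longleftrightarrow>
        entry \<ii> r = entry \<ii> (r + 2) \<and> edge e (entry \<ii> (r + 1)) (entry \<ii> r)"
      "entry (neg \<ii>) r = entry (neg \<ii>) (r + 2) \<and> edge e (entry (neg \<ii>) (r + 1)) (entry (neg \<ii>) r) \<longleftrightarrow>
        entry \<ii> r = entry \<ii> (r + 2) \<and> edge e (entry \<ii> r) (entry \<ii> (r + 1))"
      by (simp_all add: entry_neg_eq_iff edge_neg_iff)
    have "sgn_map p = - ((gPsi r * gPsi (r + 1) * gPsi r - gPsi (r + 1) * gPsi r * gPsi (r + 1)) * gE (neg \<ii>))"
      using braid(3) by (simp add: braid(1) free_lift_simps left_diff_distrib)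
    moreover have "sgn_map q = - (if entry (neg \<ii>) r = entry (neg \<ii>) (r + 2) \<and> edge e (entry (neg \<ii>) r) (entry (neg \<ii>) (r + 1)) then - gE (neg \<ii>)
       else if entry (neg \<ii>) r = entry (neg \<ii>) (r + 2) \<and> edge e (entry (neg \<ii>) (r + 1)) (entry (neg \<ii>) r) then gE (neg \<ii>)
       else 0)"
      unfolding c using braid(3) by (auto simp: braid(2) free_lift_simps dest: edge_asym [OF e3])
    ultimately show ?thesis
      using K.eqv_minus [OF K.eqv_rel [OF klr_rel.braid [OF seqs(1), of \<ii> r e]]] braid(3-) by simp
  qed
qed

lemma sgn_eqv:
  assumes "eqv (klr_gens (neg_root e \<alpha>)) (klr_rel e (neg_root e \<alpha>)) p (q :: (klr_gen, 'z) free)"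
  shows "sgn_map p \<sim> sgn_map q"
proof (rule presentation.free_lift_eqv [OF klr_presentation K.presentation_axioms assms sgn_rel])
  fix g assume g: "g \<notin> klr_gens (neg_root e \<alpha>)"
  have [simp]: "size (neg_root e \<alpha>) = n"
    by (rule class_size [OF \<gamma> class_neg_root [OF \<gamma> \<alpha>]])
  show "sgn_map_gen e g \<sim> 0"
  proof (cases g)
    case (Psi_gen r)
    with g have "Psi_gen r \<notin> klr_gens \<alpha>" by (auto simp: klr_gens_def)
    from K.eqv_minus [OF K.eqv_gen_out [OF this]] Psi_gen show ?thesis by (simp add: sgn_map_gen_def)
  next
    case (Y_gen r)
    with g have "Y_gen r \<notin> klr_gens \<alpha>" by (auto simp: klr_gens_def)
    from K.eqv_minus [OF K.eqv_gen_out [OF this]] Y_gen show ?thesis by (simp add: sgn_map_gen_def)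
  next
    case (E_gen \<ii>)
    show ?thesis
    proof (cases "set \<ii> \<subseteq> vertices e")
      case True
      with g E_gen have "E_gen (neg \<ii>) \<notin> klr_gens \<alpha>"
        using seqs_neg [of "neg \<ii>" \<alpha> e] by (auto simp: klr_gens_def neg_neg_seq)
      from K.eqv_gen_out [OF this] True E_gen show ?thesis by (simp add: sgn_map_gen_def)
    qed (simp add: E_gen sgn_map_gen_def)
  qed
qed

end

section \<open>The homomorphism from the alternating presentation\<close>

text \<open>
  The guard is needed because the homomorphism must kill what is not a generator of the
  presentation, whereas a sequence outside the class which has entries that are not residues may have
  its negative in the class.
\<close>

fun phi_gen :: "enat \<Rightarrow> int multiset set \<Rightarrow> alt_gen \<Rightarrow> (klr_gen, 'z::comm_ring_1) free" where
  "phi_gen e \<gamma> (APsi_gen r \<ii>) = (gPsi r * (gE \<ii> - gE (neg_seq e \<ii>)) when \<ii> \<in> class_seqs \<gamma>)"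
| "phi_gen e \<gamma> (AY_gen r \<ii>) = (gY r * (gE \<ii> - gE (neg_seq e \<ii>)) when \<ii> \<in> class_seqs \<gamma>)"
| "phi_gen e \<gamma> (AE_gen \<ii>) = (gE \<ii> + gE (neg_seq e \<ii>) when \<ii> \<in> class_seqs \<gamma>)"

context alternating_block
begin

sublocale A: presentation "alt_gens n \<gamma>" "alt_rel e n \<gamma> :: (alt_gen, 'z) free \<Rightarrow> _"
  by (rule alt_presentation [OF \<gamma>])

abbreviation aeqv (infix "\<asymp>" 50)
  where "x \<asymp> y \<equiv> eqv (alt_gens n \<gamma>) (alt_rel e n \<gamma> :: (alt_gen, 'z) free \<Rightarrow> _) x y"

abbreviation phi :: "(alt_gen, 'z) free \<Rightarrow> (klr_gen, 'z) free"
  where "phi \<equiv> free_lift (phi_gen e \<gamma>)"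

abbreviation I :: "int list set" where "I \<equiv> class_seqs \<gamma>"

lemmas I_swap = class_seqs_swap [OF \<gamma>]
lemmas I_neg = class_seqs_neg [OF \<gamma>]
lemmas I_length = class_seqs_length [OF \<gamma>]

text \<open>
  Inverses are unique, so the definite description is meaningful.
\<close>

lemma half_h: "half = h"
  unfolding half_def
proof (rule the_equality)
  show "2 * h = 1" by (simp only: mult_2 h)
next
  fix c :: 'z assume c: "2 * c = 1"
  have "c = c * (h + h)" by (simp only: h mult_1_right)
  also have "\<dots> = (2 * c) * h" by (simp only: mult_2 distrib_left distrib_right)
  finally show "c = h" by (simp only: c mult_1_left)
qed

lemma scale_h_double: "scale h x + scale h x = (x :: ('g, 'z) free)"
  by (simp add: scale_add_left [symmetric] h)

lemma sim_sym: "\<ii> \<in> I \<Longrightarrow> seq_sim e \<ii> \<jj> \<longleftrightarrow> \<jj> \<in> I \<and> seq_sim e \<jj> \<ii>"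
  by (auto simp: seq_sim_def neg_neg I_neg)

lemma sim_trans: "\<ii> \<in> I \<Longrightarrow> seq_sim e \<ii> \<jj> \<Longrightarrow> seq_sim e \<jj> \<kk> \<Longrightarrow> seq_sim e \<ii> \<kk>"
  by (auto simp: seq_sim_def neg_neg)

lemma sim_neg: "\<ii> \<in> I \<Longrightarrow> seq_sim e (neg \<ii>) \<jj> \<longleftrightarrow> seq_sim e \<ii> \<jj>"
  by (auto simp: seq_sim_def neg_neg)

lemma sim_swap:
  assumes "\<ii> \<in> I" "\<jj> \<in> I" "1 \<le> r" "r < n"
  shows "seq_sim e (swap r \<ii>) \<jj> \<longleftrightarrow> seq_sim e \<ii> (swap r \<jj>)"
proof -
  have inv: "\<jj> = swap r \<kk> \<longleftrightarrow> swap r \<jj> = \<kk>" if "\<kk> \<in> I" for \<kk>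
    using assms that swap_swap [of r] I_length by metis
  show ?thesis
    using assms inv [OF assms(1)] inv [OF I_neg [OF assms(1)]] by (simp add: seq_sim_def swap_neg)
qed

end

context alternating_component
begin

text \<open>
  \<open>\<ii> = s\<jj>\<close> for a sign \<open>s\<close>, which is taken as an element of the algebra.
\<close>

definition sign_rel :: "int list \<Rightarrow> int list \<Rightarrow> (klr_gen, 'z) free \<Rightarrow> bool"
  where "sign_rel \<ii> \<jj> s \<longleftrightarrow> (\<ii> = \<jj> \<and> s = 1) \<or> (\<ii> = neg \<jj> \<and> s = - 1)"

text \<open>
  If \<open>-\<jj> \<noteq> \<jj>\<close>, then the sign by which \<open>\<plusminus>\<jj>\<close> acts on the weight space of \<open>\<jj>\<close> is well defined.
\<close>

definition in_free_weight :: "int list \<Rightarrow> (klr_gen, 'z) free \<Rightarrow> bool"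
  where "in_free_weight \<jj> v \<longleftrightarrow> in_weight \<jj> v \<and> neg \<jj> \<noteq> \<jj>"

lemma in_free_weight_I: "in_free_weight \<jj> v \<Longrightarrow> \<jj> \<in> I"
  by (auto simp: in_free_weight_def in_weight_def intro: seqs_class)

lemma in_free_weight_sign: "in_free_weight \<jj> v \<Longrightarrow> sign_rel \<ii> \<jj> s \<Longrightarrow> in_free_weight \<jj> (s * v)"
  by (auto simp: in_free_weight_def sign_rel_def in_weight_minus)

lemma in_free_weight_Y: "in_free_weight \<jj> v \<Longrightarrow> 1 \<le> r \<Longrightarrow> r \<le> n \<Longrightarrow> in_free_weight \<jj> (gY r * v)"
  by (simp add: in_free_weight_def in_weight_Y)

lemma in_free_weight_Psi: "in_free_weight \<jj> v \<Longrightarrow> 1 \<le> r \<Longrightarrow> r < n \<Longrightarrow> in_free_weight (swap r \<jj>) (gPsi r * v)"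
proof -
  assume v: "in_free_weight \<jj> v" "1 \<le> r" "r < n"
  then have "swap r (swap r \<jj>) = \<jj>" "swap r (swap r (neg \<jj>)) = neg \<jj>"
    by (simp_all add: swap_swap I_length in_free_weight_I)
  with v show ?thesis
    by (auto simp: in_free_weight_def in_weight_Psi swap_neg [symmetric, OF seqs_class] in_weight_def [of \<jj>])
qed

lemma sign_rel_sim: "in_free_weight \<jj> v \<Longrightarrow> sign_rel \<ii> \<jj> s \<Longrightarrow> seq_sim e \<ii> \<jj>"
  using in_free_weight_I by (auto simp: sign_rel_def seq_sim_def neg_neg)

lemma sign_rel_cases:
  assumes "in_free_weight \<jj> v" "\<ii> \<in> I"
  obtains (no) "\<not> seq_sim e \<ii> \<jj>" | (yes) s where "sign_rel \<ii> \<jj> s"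
proof (cases "seq_sim e \<ii> \<jj>")
  case True
  then have "\<ii> = \<jj> \<or> \<ii> = neg \<jj>"
    using assms by (auto simp: seq_sim_def neg_neg)
  with yes show ?thesis by (auto simp: sign_rel_def)
qed (rule no)

lemma sign_rel_swap: "in_free_weight \<jj> v \<Longrightarrow> sign_rel \<ii> \<jj> s \<Longrightarrow> 1 \<le> r \<Longrightarrow> r < n \<Longrightarrow> sign_rel (swap r \<ii>) (swap r \<jj>) s"
  using in_free_weight_I by (auto simp: sign_rel_def swap_neg)

lemma sign_rel_neg: "in_free_weight \<jj> v \<Longrightarrow> sign_rel \<ii> \<jj> s \<Longrightarrow> sign_rel (neg \<ii>) \<jj> (- s)"
  using in_free_weight_I by (auto simp: sign_rel_def neg_neg)

lemma sign_rel_I: "in_free_weight \<jj> v \<Longrightarrow> sign_rel \<ii> \<jj> s \<Longrightarrow> \<ii> \<in> I"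
  using in_free_weight_I by (auto simp: sign_rel_def I_neg)

lemma diff_E: "in_free_weight \<jj> v \<Longrightarrow> sign_rel \<ii> \<jj> s \<Longrightarrow> (gE \<ii> - gE (neg \<ii>)) * v \<sim> s * v"
  using K.eqv_diff [OF E_in_weight [of \<jj> v \<ii>] E_in_weight [of \<jj> v "neg \<ii>"]] in_free_weight_I [of \<jj> v]
  by (auto simp: in_free_weight_def sign_rel_def left_diff_distrib neg_neg)

lemma diff_E_0: "in_free_weight \<jj> v \<Longrightarrow> \<not> seq_sim e \<ii> \<jj> \<Longrightarrow> (gE \<ii> - gE (neg \<ii>)) * v \<sim> 0"
  using K.eqv_diff [OF E_in_weight [of \<jj> v \<ii>] E_in_weight [of \<jj> v "neg \<ii>"]]
  by (auto simp: in_free_weight_def seq_sim_def left_diff_distrib)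

lemma phi_E_when: "in_free_weight \<jj> v \<Longrightarrow> \<ii> \<in> I \<Longrightarrow> phi (AE \<ii>) * v \<sim> (v when \<ii> = \<jj>) + (v when neg \<ii> = \<jj>)"
  using K.eqv_add [OF E_in_weight [of \<jj> v \<ii>] E_in_weight [of \<jj> v "neg \<ii>"]]
  by (auto simp: in_free_weight_def distrib_right)

lemma phi_E: "in_free_weight \<jj> v \<Longrightarrow> \<ii> \<in> I \<Longrightarrow> phi (AE \<ii>) * v \<sim> (v when seq_sim e \<ii> \<jj>)"
  using phi_E_when [of \<jj> v \<ii>] in_free_weight_I [of \<jj> v]
  by (auto simp: in_free_weight_def seq_sim_def neg_neg when_def split: if_splits)

lemma phi_Y: "in_free_weight \<jj> v \<Longrightarrow> sign_rel \<ii> \<jj> s \<Longrightarrow> phi (AY r \<ii>) * v \<sim> s * (gY r * v)"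
proof -
  assume v: "in_free_weight \<jj> v" "sign_rel \<ii> \<jj> s"
  have "gY r * (s * v) = s * (gY r * v)" using v by (auto simp: sign_rel_def)
  with K.eqv_mult_left [OF diff_E [OF v], of "gY r"] sign_rel_I [OF v] show ?thesis
    by (simp add: mult.assoc)
qed

lemma phi_Psi: "in_free_weight \<jj> v \<Longrightarrow> sign_rel \<ii> \<jj> s \<Longrightarrow> phi (APsi r \<ii>) * v \<sim> s * (gPsi r * v)"
proof -
  assume v: "in_free_weight \<jj> v" "sign_rel \<ii> \<jj> s"
  have "gPsi r * (s * v) = s * (gPsi r * v)" using v by (auto simp: sign_rel_def)
  with K.eqv_mult_left [OF diff_E [OF v], of "gPsi r"] sign_rel_I [OF v] show ?thesis
    by (simp add: mult.assoc)
qed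

lemma phi_0:
  assumes "in_free_weight \<jj> v" "\<not> seq_sim e \<ii> \<jj>" "\<ii> \<in> I"
  shows "phi (AY r \<ii>) * v \<sim> 0" "phi (APsi r \<ii>) * v \<sim> 0" "phi (AE \<ii>) * v \<sim> 0"
  using K.eqv_mult_left [OF diff_E_0 [OF assms(1,2)], of "gY r"]
    K.eqv_mult_left [OF diff_E_0 [OF assms(1,2)], of "gPsi r"] phi_E [OF assms(1,3)] assms
  by (simp_all add: mult.assoc)

text \<open>
  Keeps track of the weight while a product is applied to a vector factor by factor.
\<close>

definition phi_maps :: "(alt_gen, 'z) free \<Rightarrow> (klr_gen, 'z) free \<Rightarrow> int list \<Rightarrow> (klr_gen, 'z) free \<Rightarrow> bool"
  where "phi_maps a v \<jj> u \<longleftrightarrow> phi a * v \<sim> u \<and> in_free_weight \<jj> u"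

lemma phi_maps_1: "in_free_weight \<jj> v \<Longrightarrow> phi_maps 1 v \<jj> v"
  by (simp add: phi_maps_def)

lemma phi_maps_Y:
  assumes "phi_maps a v \<jj> u" "sign_rel \<ii> \<jj> s" "1 \<le> r" "r \<le> n"
  shows "phi_maps (AY r \<ii> * a) v \<jj> (s * (gY r * u))"
proof -
  have "phi (AY r \<ii> * a) * v \<sim> phi (AY r \<ii>) * u"
    using assms(1) K.eqv_mult_left unfolding phi_maps_def free_lift_mult mult.assoc by blast
  also have "\<dots> \<sim> s * (gY r * u)"
    using assms by (intro phi_Y) (auto simp: phi_maps_def)
  finally show ?thesis
    using assms in_free_weight_sign [OF in_free_weight_Y assms(2)] by (auto simp: phi_maps_def)
qed

lemma phi_maps_Psi:
  assumes "phi_maps a v \<jj> u" "sign_rel \<ii> \<jj> s" "1 \<le> r" "r < n"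
  shows "phi_maps (APsi r \<ii> * a) v (swap r \<jj>) (s * (gPsi r * u))"
proof -
  have u: "in_free_weight \<jj> u" using assms by (simp add: phi_maps_def)
  have "phi (APsi r \<ii> * a) * v \<sim> phi (APsi r \<ii>) * u"
    using assms(1) K.eqv_mult_left unfolding phi_maps_def free_lift_mult mult.assoc by blast
  also have "\<dots> \<sim> s * (gPsi r * u)"
    using assms by (intro phi_Psi) (auto simp: phi_maps_def)
  finally show ?thesis
    using assms in_free_weight_sign [OF in_free_weight_Psi [OF u] sign_rel_swap [OF u]] by (auto simp: phi_maps_def)
qed

lemma phi_maps_eqv: "phi_maps a v \<jj> u \<Longrightarrow> phi a * v \<sim> u"
  by (simp add: phi_maps_def)

lemma phi_mult_0: "phi b * v \<sim> 0 \<Longrightarrow> phi (a * b) * v \<sim> 0"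
  using K.eqv_mult_left [of "phi b * v" 0 "phi a"] by (simp add: free_lift_mult mult.assoc)

lemma phi_add_eqv: "phi a * v \<sim> x \<Longrightarrow> phi b * v \<sim> y \<Longrightarrow> phi (a + b) * v \<sim> x + y"
  using K.eqv_add by (fastforce simp: free_lift_add distrib_right)

lemma phi_diff_eqv: "phi a * v \<sim> x \<Longrightarrow> phi b * v \<sim> y \<Longrightarrow> phi (a - b) * v \<sim> x - y"
  using K.eqv_diff by (fastforce simp: free_lift_diff left_diff_distrib)

lemma eqv_via: "x \<sim> x' \<Longrightarrow> y \<sim> y' \<Longrightarrow> x' \<sim> y' \<Longrightarrow> x \<sim> y"
  by (meson K.eqv_sym K.eqv_trans)

lemma when_0_eqv: "phi a * v \<sim> 0 \<Longrightarrow> phi (a when b) * v \<sim> 0"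
  by (simp add: when_def)

text \<open>
  If the sequence \<open>\<ii>\<close> of a rightmost factor is not \<open>\<plusminus>\<jj>\<close>, the product vanishes on \<open>v\<close>. In a relation that
  involves only \<open>\<ii> = s\<jj>\<close> and its permutations, every \<open>\<Psi>\<close> and every \<open>Y\<close> acts through \<open>s\<psi>\<close> or \<open>sy\<close> with the same
  sign \<open>s\<close>. Hence a product of one or three of them carries the sign \<open>s\<close> and a product of two or none
  carries no sign. Where the two sides of such a relation differ in this respect, as in the quadratic and
  the braid relation, the reversal of the edges between \<open>\<jj>\<close> and \<open>-\<jj>\<close> accounts for the difference.
\<close>

lemma phi_rel_on_weight:
  assumes rel: "alt_rel e n \<gamma> p q" and v: "in_free_weight \<jj> v"
  shows "phi p * v \<sim> phi q * v"
proof -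
  \<comment> \<open>Images of generators stay folded, so that the rules for their action on weight vectors apply.\<close>
  note free_lift_gen [simp del]
  note z = phi_0 [OF v]
  have zero: ?thesis if "phi p * v \<sim> 0" "phi q * v \<sim> 0"
    using that by (rule eqv_via) simp
  have j: "\<jj> \<in> I" "in_weight \<jj> v" using v in_free_weight_I by (auto simp: in_free_weight_def)
  note ev1 = phi_maps_1 [OF v]
  have sgs: "s = 1 \<or> s = - 1" if "sign_rel \<ii> \<jj> s" for \<ii> s using that by (auto simp: sign_rel_def)
  have sgent: "entry \<ii> r = entry \<ii> t \<longleftrightarrow> entry \<jj> r = entry \<jj> t"
    if "sign_rel \<ii> \<jj> s" "1 \<le> r" "r \<le> n" "1 \<le> t" "t \<le> n" for \<ii> s r t
    using that j by (auto simp: sign_rel_def entry_neg_eq_iff)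
  note sw = sign_rel_swap [OF v]
  note sw2 = sign_rel_swap [OF in_free_weight_Psi [OF v]]
  from rel show ?thesis
  proof cases
    case (cyclotomic \<ii>)
    show ?thesis
      using v cyclotomic(3)
    proof (cases rule: sign_rel_cases)
      case no
      with cyclotomic show ?thesis
        using z(1) [of \<ii> 1] z(3) [of \<ii>] by (simp add: Lambda0_def)
    next
      case (yes s)
      have L: "Lambda0 (entry \<ii> 1) = Lambda0 (entry \<jj> 1)"
        using yes j by (auto simp: sign_rel_def Lambda0_neg simp del: One_nat_def)
      show ?thesis
      proof (cases "Lambda0 (entry \<jj> 1) = 0")
        case True
        then have "v \<sim> 0" using weight_cyclotomic [OF j(2)] by simp
        from K.eqv_mult_left [OF this, of "phi p"] show ?thesis
          using cyclotomic by simp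
      next
        case False
        then have 1: "Lambda0 (entry \<jj> 1) = 1" by (simp add: Lambda0_def split: if_splits)
        have "phi (AY 1 \<ii>) * v \<sim> s * (gY 1 * v)" by (rule phi_Y [OF v yes])
        also have "s * (gY 1 * v) \<sim> s * 0"
          using weight_cyclotomic [OF j(2)] 1 by (intro K.eqv_mult_left) simp
        finally show ?thesis using cyclotomic L 1 by simp
      qed
    qed
  next
    case (E_E \<ii> \<kk>)
    have "phi p * v \<sim> phi (AE \<ii>) * (v when seq_sim e \<kk> \<jj>)"
      using K.eqv_mult_left [OF phi_E [OF v E_E(4)]] by (simp add: E_E free_lift_simps mult.assoc)
    also have "\<dots> \<sim> (v when seq_sim e \<ii> \<jj> \<and> seq_sim e \<kk> \<jj>)"
      using phi_E [OF v E_E(3)] by (auto simp: when_def split: if_splits)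
    finally have 1: "phi p * v \<sim> (v when seq_sim e \<ii> \<jj> \<and> seq_sim e \<kk> \<jj>)" .
    have 2: "phi q * v \<sim> (v when seq_sim e \<ii> \<jj> \<and> seq_sim e \<ii> \<kk>)"
      using phi_E [OF v E_E(3)] by (auto simp: E_E when_def split: if_splits)
    have "seq_sim e \<ii> \<jj> \<and> seq_sim e \<ii> \<kk> \<longleftrightarrow> seq_sim e \<ii> \<jj> \<and> seq_sim e \<kk> \<jj>"
      using E_E(3,4) j sim_sym sim_trans by meson
    with 1 2 show ?thesis by (auto intro: eqv_via)
  next
    case E_sum
    have "phi p * v = (\<Sum>\<ii>\<in>I. scale h (phi (AE \<ii>) * v))"
      by (simp only: E_sum free_lift_simps half_h sum_distrib_right scale_mult_left)
    also have "\<dots> \<sim> (\<Sum>\<ii>\<in>I. scale h ((v when \<ii> = \<jj>) + (v when neg \<ii> = \<jj>)))"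
      by (intro K.eqv_sum K.eqv_scale phi_E_when v)
    also have "\<dots> = (\<Sum>\<ii>\<in>I. scale h (v when \<ii> = \<jj>)) + (\<Sum>\<ii>\<in>I. scale h (v when \<ii> = neg \<jj>))"
      unfolding sum.distrib [symmetric] scale_add_right
      using j by (intro sum.cong) (auto simp: neg_neg when_def)
    also have "\<dots> = scale h v + scale h v"
      using j I_neg [OF j(1)] finite_class_seqs [OF \<gamma>]
      by (simp add: when_def if_distrib [of "scale h"] cong: if_cong)
    also have "\<dots> = v" by (rule scale_h_double)
    finally show ?thesis using E_sum by simp
  next
    case (Y_neg \<ii> r)
    show ?thesis
      using v Y_neg(3)
    proof (cases rule: sign_rel_cases)
      case no
      then have "\<not> seq_sim e (neg \<ii>) \<jj>" using Y_neg by (simp add: sim_neg)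
      with no Y_neg show ?thesis
        using z(1) [of \<ii> r] z(1) [of "neg \<ii>" r] K.eqv_minus [of "phi (AY r \<ii>) * v" 0]
        by (intro zero) (auto simp: I_neg free_lift_minus)
    next
      case (yes s)
      show ?thesis
        unfolding Y_neg
        by (rule eqv_via [OF phi_Y [OF v sign_rel_neg [OF v yes]]])
          (use K.eqv_minus [OF phi_Y [OF v yes, of r]] in \<open>auto simp: free_lift_minus\<close>)
    qed
  next
    case (Psi_neg \<ii> r)
    show ?thesis
      using v Psi_neg(3)
    proof (cases rule: sign_rel_cases)
      case no
      then have "\<not> seq_sim e (neg \<ii>) \<jj>" using Psi_neg by (simp add: sim_neg)
      with no Psi_neg show ?thesis
        using z(2) [of \<ii> r] z(2) [of "neg \<ii>" r] K.eqv_minus [of "phi (APsi r \<ii>) * v" 0]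
        by (intro zero) (auto simp: I_neg free_lift_minus)
    next
      case (yes s)
      show ?thesis
        unfolding Psi_neg
        by (rule eqv_via [OF phi_Psi [OF v sign_rel_neg [OF v yes]]])
          (use K.eqv_minus [OF phi_Psi [OF v yes, of r]] in \<open>auto simp: free_lift_minus\<close>)
    qed
  next
    case (E_neg \<ii>)
    then show ?thesis
      by (simp add: neg_neg I_neg add.commute free_lift_gen)
  next
    case (E_Y_E \<ii> \<kk> \<ll> r)
    show ?thesis
      using v E_Y_E(4)
    proof (cases rule: sign_rel_cases)
      case no
      have "phi (AE \<ii> * (AY r \<kk> * AE \<ll>)) * v \<sim> phi (AE \<ii> * AY r \<kk>) * (v when seq_sim e \<ll> \<jj>)"
        using K.eqv_mult_left [OF phi_E [OF v E_Y_E(5)], of "phi (AE \<ii> * AY r \<kk>)"]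
        by (simp add: free_lift_mult mult.assoc)
      also have "\<dots> \<sim> 0"
        using phi_mult_0 [OF z(1) [OF no E_Y_E(4)], of "AE \<ii>"] by (auto simp: when_def split: if_splits)
      finally show ?thesis
        using z(1) [OF no E_Y_E(4)]
        by (intro zero) (auto simp: E_Y_E mult.assoc intro: when_0_eqv)
    next
      case (yes s)
      have l: "seq_sim e \<ll> \<jj> \<longleftrightarrow> seq_sim e \<kk> \<ll>" and i: "seq_sim e \<ii> \<jj> \<longleftrightarrow> seq_sim e \<ii> \<kk>"
        using E_Y_E(3-5) j sign_rel_sim [OF v yes] sim_sym sim_trans by meson+
      have "phi (AE \<ii> * (AY r \<kk> * AE \<ll>)) * v \<sim> phi (AE \<ii>) * (phi (AY r \<kk>) * (v when seq_sim e \<ll> \<jj>))"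
        using K.eqv_mult_left [OF phi_E [OF v E_Y_E(5)], of "phi (AE \<ii> * AY r \<kk>)"]
        by (simp add: free_lift_mult mult.assoc)
      also have "\<dots> \<sim> phi (AE \<ii>) * (s * (gY r * v) when seq_sim e \<ll> \<jj>)"
        using phi_Y [OF v yes, of r] by (intro K.eqv_mult_left) (simp add: when_def)
      also have "\<dots> \<sim> (s * (gY r * v) when seq_sim e \<ii> \<jj> \<and> seq_sim e \<ll> \<jj>)"
        using phi_E [OF in_free_weight_sign [OF in_free_weight_Y [OF v E_Y_E(6,7)] yes] E_Y_E(3)] by (auto simp: when_def split: if_splits)
      also have "\<dots> \<sim> phi q * v"
        using K.eqv_sym [OF phi_Y [OF v yes, of r]] by (simp add: E_Y_E when_def l i)
      finally show ?thesis by (simp add: E_Y_E mult.assoc)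
    qed
  next
    case (E_Psi_E \<ii> \<kk> \<ll> r)
    show ?thesis
      using v E_Psi_E(4)
    proof (cases rule: sign_rel_cases)
      case no
      have "phi (AE \<ii> * (APsi r \<kk> * AE \<ll>)) * v \<sim> phi (AE \<ii> * APsi r \<kk>) * (v when seq_sim e \<ll> \<jj>)"
        using K.eqv_mult_left [OF phi_E [OF v E_Psi_E(5)], of "phi (AE \<ii> * APsi r \<kk>)"]
        by (simp add: free_lift_mult mult.assoc)
      also have "\<dots> \<sim> 0"
        using phi_mult_0 [OF z(2) [OF no E_Psi_E(4)], of "AE \<ii>"] by (auto simp: when_def split: if_splits)
      finally show ?thesis
        using z(2) [OF no E_Psi_E(4)]
        by (intro zero) (auto simp: E_Psi_E mult.assoc intro: when_0_eqv)
    next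
      case (yes s)
      have "seq_sim e \<ll> \<jj> \<longleftrightarrow> seq_sim e \<kk> \<ll>" "seq_sim e (swap r \<ii>) \<jj> \<longleftrightarrow> seq_sim e (swap r \<ii>) \<kk>"
        using E_Psi_E(3-7) j sign_rel_sim [OF v yes] sim_sym sim_trans I_swap by meson+
      then have l: "seq_sim e \<ll> \<jj> \<longleftrightarrow> seq_sim e \<kk> \<ll>"
          and i: "seq_sim e \<ii> (swap r \<jj>) \<longleftrightarrow> seq_sim e (swap r \<ii>) \<kk>"
        using sim_swap [OF E_Psi_E(3) j(1) E_Psi_E(6,7)] by auto
      have "phi (AE \<ii> * (APsi r \<kk> * AE \<ll>)) * v \<sim> phi (AE \<ii>) * (phi (APsi r \<kk>) * (v when seq_sim e \<ll> \<jj>))"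
        using K.eqv_mult_left [OF phi_E [OF v E_Psi_E(5)], of "phi (AE \<ii> * APsi r \<kk>)"]
        by (simp add: free_lift_mult mult.assoc)
      also have "\<dots> \<sim> phi (AE \<ii>) * (s * (gPsi r * v) when seq_sim e \<ll> \<jj>)"
        using phi_Psi [OF v yes, of r] by (intro K.eqv_mult_left) (simp add: when_def)
      also have "\<dots> \<sim> (s * (gPsi r * v) when seq_sim e \<ii> (swap r \<jj>) \<and> seq_sim e \<ll> \<jj>)"
        using phi_E [OF in_free_weight_sign [OF in_free_weight_Psi [OF v E_Psi_E(6,7)] sw [OF yes E_Psi_E(6,7)]] E_Psi_E(3)]
        by (auto simp: when_def split: if_splits)
      also have "\<dots> \<sim> phi q * v"
        using K.eqv_sym [OF phi_Psi [OF v yes, of r]] by (simp add: E_Psi_E when_def l i)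
      finally show ?thesis by (simp add: E_Psi_E mult.assoc)
    qed
  next
    case (Y_Y \<ii> \<kk> r s)
    show ?thesis
      using v Y_Y(4)
    proof (cases rule: sign_rel_cases)
      case no
      show ?thesis
        unfolding Y_Y(1,2) by (rule zero [unfolded Y_Y(1,2)]) (intro when_0_eqv phi_mult_0 z(1) [OF no Y_Y(4)])+
    next
      case (yes \<sigma>)
      have sim: "seq_sim e \<ii> \<jj> \<longleftrightarrow> seq_sim e \<ii> \<kk>"
        using Y_Y(3,4) j sign_rel_sim [OF v yes] sim_sym sim_trans by meson
      show ?thesis
        using v Y_Y(3)
      proof (cases rule: sign_rel_cases)
        case no
        have "phi p * v \<sim> phi (AY r \<ii>) * (\<sigma> * (gY s * v))"
          using K.eqv_mult_left [OF phi_Y [OF v yes, of s], of "phi (AY r \<ii>)"] by (simp add: Y_Y free_lift_mult mult.assoc)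
        also have "\<dots> \<sim> 0"
          by (rule phi_0(1) [OF in_free_weight_sign [OF in_free_weight_Y [OF v Y_Y(7,8)] yes] no Y_Y(3)])
        finally show ?thesis using no by (simp add: Y_Y sim)
      next
        case (yes \<tau>)
        have "phi (AY r \<ii> * (AY s \<kk> * 1)) * v \<sim> \<tau> * (gY r * (\<sigma> * (gY s * v)))"
          by (rule phi_maps_eqv [where \<jj> = "\<jj>"]) (intro phi_maps_Y ev1 \<open>sign_rel \<kk> \<jj> \<sigma>\<close> yes Y_Y)
        moreover have "phi (AY s \<ii> * (AY r \<kk> * 1)) * v \<sim> \<tau> * (gY s * (\<sigma> * (gY r * v)))"
          by (rule phi_maps_eqv [where \<jj> = "\<jj>"]) (intro phi_maps_Y ev1 \<open>sign_rel \<kk> \<jj> \<sigma>\<close> yes Y_Y)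
        moreover have "\<tau> * (gY r * (\<sigma> * (gY s * v))) \<sim> \<tau> * (gY s * (\<sigma> * (gY r * v)))"
          using sgs [OF yes] sgs [OF \<open>sign_rel \<kk> \<jj> \<sigma>\<close>] y_y_act [OF Y_Y(5-8), of v]
            K.eqv_minus [OF y_y_act [OF Y_Y(5-8), of v]]
          by auto
        ultimately show ?thesis
          using sign_rel_sim [OF v yes] sim by (auto simp: Y_Y intro: eqv_via)
      qed
    qed
  next
    case (Psi_Y_Suc \<ii> r)
    show ?thesis
      using v Psi_Y_Suc(3)
    proof (cases rule: sign_rel_cases)
      case no
      note z0 = z [OF no Psi_Y_Suc(3)]
      show ?thesis
        unfolding Psi_Y_Suc(1,2)
        by (rule zero [unfolded Psi_Y_Suc(1,2)])
          (use phi_add_eqv [OF phi_mult_0 [OF z0(2)] when_0_eqv [OF z0(3)]] phi_mult_0 [OF z0(1)] in auto)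
    next
      case (yes s)
      have r: "r + 1 \<le> n" "1 \<le> r + 1" "r \<le> n" using Psi_Y_Suc by auto
      have "phi (APsi r \<ii> * (AY (r + 1) \<ii> * 1)) * v \<sim> s * (gPsi r * (s * (gY (r + 1) * v)))"
        by (rule phi_maps_eqv [where \<jj> = "swap r \<jj>"]) (intro phi_maps_Psi phi_maps_Y ev1 yes r Psi_Y_Suc)
      moreover have "phi (AY r (swap r \<ii>) * (APsi r \<ii> * 1) + (AE \<ii> when entry \<ii> r = entry \<ii> (r + 1))) * v
          \<sim> s * (gY r * (s * (gPsi r * v))) + (v when entry \<jj> r = entry \<jj> (r + 1))"
      proof (rule phi_add_eqv)
        show "phi (AY r (swap r \<ii>) * (APsi r \<ii> * 1)) * v \<sim> s * (gY r * (s * (gPsi r * v)))"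
          by (rule phi_maps_eqv [where \<jj> = "swap r \<jj>"]) (intro phi_maps_Psi phi_maps_Y ev1 yes r Psi_Y_Suc sw)
        show "phi (AE \<ii> when entry \<ii> r = entry \<ii> (r + 1)) * v \<sim> (v when entry \<jj> r = entry \<jj> (r + 1))"
          using phi_E [OF v Psi_Y_Suc(3)] sign_rel_sim [OF v yes] sgent [OF yes Psi_Y_Suc(4) r(3,2,1)]
          by (simp add: when_def)
      qed
      moreover have "s * (gPsi r * (s * (gY (r + 1) * v)))
          \<sim> s * (gY r * (s * (gPsi r * v))) + (v when entry \<jj> r = entry \<jj> (r + 1))"
        using sgs [OF yes] weight_psi_y_Suc [OF j(2) Psi_Y_Suc(4,5)] by auto
      ultimately show ?thesis
        unfolding Psi_Y_Suc(1,2) mult_1_right by (rule eqv_via)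
    qed
  next
    case (Y_Suc_Psi \<ii> r)
    show ?thesis
      using v Y_Suc_Psi(3)
    proof (cases rule: sign_rel_cases)
      case no
      note z0 = z [OF no Y_Suc_Psi(3)]
      show ?thesis
        unfolding Y_Suc_Psi(1,2)
        by (rule zero [unfolded Y_Suc_Psi(1,2)])
          (use phi_add_eqv [OF phi_mult_0 [OF z0(1)] when_0_eqv [OF z0(3)]] phi_mult_0 [OF z0(2)] in auto)
    next
      case (yes s)
      have r: "r + 1 \<le> n" "1 \<le> r + 1" "r \<le> n" using Y_Suc_Psi by auto
      have "phi (AY (r + 1) (swap r \<ii>) * (APsi r \<ii> * 1)) * v \<sim> s * (gY (r + 1) * (s * (gPsi r * v)))"
        by (rule phi_maps_eqv [where \<jj> = "swap r \<jj>"]) (intro phi_maps_Psi phi_maps_Y ev1 yes r Y_Suc_Psi sw)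
      moreover have "phi (APsi r \<ii> * (AY r \<ii> * 1) + (AE \<ii> when entry \<ii> r = entry \<ii> (r + 1))) * v
          \<sim> s * (gPsi r * (s * (gY r * v))) + (v when entry \<jj> r = entry \<jj> (r + 1))"
      proof (rule phi_add_eqv)
        show "phi (APsi r \<ii> * (AY r \<ii> * 1)) * v \<sim> s * (gPsi r * (s * (gY r * v)))"
          by (rule phi_maps_eqv [where \<jj> = "swap r \<jj>"]) (intro phi_maps_Psi phi_maps_Y ev1 yes r Y_Suc_Psi sw)
        show "phi (AE \<ii> when entry \<ii> r = entry \<ii> (r + 1)) * v \<sim> (v when entry \<jj> r = entry \<jj> (r + 1))"
          using phi_E [OF v Y_Suc_Psi(3)] sign_rel_sim [OF v yes] sgent [OF yes Y_Suc_Psi(4) r(3,2,1)]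
          by (simp add: when_def)
      qed
      moreover have "s * (gY (r + 1) * (s * (gPsi r * v)))
          \<sim> s * (gPsi r * (s * (gY r * v))) + (v when entry \<jj> r = entry \<jj> (r + 1))"
        using sgs [OF yes] weight_y_Suc_psi [OF j(2) Y_Suc_Psi(4,5)] by auto
      ultimately show ?thesis
        unfolding Y_Suc_Psi(1,2) mult_1_right by (rule eqv_via)
    qed
  next
    case (Psi_Y \<ii> r t)
    show ?thesis
      using v Psi_Y(3)
    proof (cases rule: sign_rel_cases)
      case no
      note z0 = z [OF no Psi_Y(3)]
      show ?thesis
        unfolding Psi_Y(1,2)
        by (rule zero [unfolded Psi_Y(1,2)]) (intro phi_mult_0 z0)+
    next
      case (yes s)
      have "phi (APsi r \<ii> * (AY t \<ii> * 1)) * v \<sim> s * (gPsi r * (s * (gY t * v)))"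
        by (rule phi_maps_eqv [where \<jj> = "swap r \<jj>"]) (intro phi_maps_Psi phi_maps_Y ev1 yes Psi_Y)
      moreover have "phi (AY t (swap r \<ii>) * (APsi r \<ii> * 1)) * v \<sim> s * (gY t * (s * (gPsi r * v)))"
        by (rule phi_maps_eqv [where \<jj> = "swap r \<jj>"]) (intro phi_maps_Psi phi_maps_Y ev1 yes Psi_Y sw)
      moreover have "s * (gPsi r * (s * (gY t * v))) \<sim> s * (gY t * (s * (gPsi r * v)))"
        using sgs [OF yes] psi_y_act [OF Psi_Y(4-9), of v] by auto
      ultimately show ?thesis
        unfolding Psi_Y(1,2) mult_1_right by (rule eqv_via)
    qed
  next
    case (Psi_Psi \<ii> r t)
    show ?thesis
      using v Psi_Psi(3)
    proof (cases rule: sign_rel_cases)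
      case no
      note z0 = z [OF no Psi_Psi(3)]
      show ?thesis
        unfolding Psi_Psi(1,2)
        by (rule zero [unfolded Psi_Psi(1,2)]) (intro phi_mult_0 z0)+
    next
      case (yes s)
      have "phi (APsi r (swap t \<ii>) * (APsi t \<ii> * 1)) * v \<sim> s * (gPsi r * (s * (gPsi t * v)))"
        by (rule phi_maps_eqv [where \<jj> = "swap r (swap t \<jj>)"]) (intro phi_maps_Psi ev1 yes Psi_Psi sw)
      moreover have "phi (APsi t (swap r \<ii>) * (APsi r \<ii> * 1)) * v \<sim> s * (gPsi t * (s * (gPsi r * v)))"
        by (rule phi_maps_eqv [where \<jj> = "swap t (swap r \<jj>)"]) (intro phi_maps_Psi ev1 yes Psi_Psi sw)
      moreover have "s * (gPsi r * (s * (gPsi t * v))) \<sim> s * (gPsi t * (s * (gPsi r * v)))"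
        using sgs [OF yes] psi_psi_act [OF Psi_Psi(4-8), of v] by auto
      ultimately show ?thesis
        unfolding Psi_Psi(1,2) mult_1_right by (rule eqv_via)
    qed
  next
    case (quadratic \<ii> r)
    show ?thesis
      using v quadratic(3)
    proof (cases rule: sign_rel_cases)
      case no
      note z0 = z [OF no quadratic(3)]
      show ?thesis
        unfolding quadratic(1,2)
        by (rule zero [unfolded quadratic(1,2)])
          (use phi_mult_0 [OF z0(2)] phi_diff_eqv [OF z0(1) z0(1)] z0(3) in auto)
    next
      case (yes s)
      have r: "r + 1 \<le> n" "1 \<le> r + 1" "r \<le> n" using quadratic by auto
      let ?q = "\<lambda>\<ii> a b c. if edge e (entry \<ii> r) (entry \<ii> (r + 1)) then a - b
         else if edge e (entry \<ii> (r + 1)) (entry \<ii> r) then b - a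
         else if entry \<ii> r = entry \<ii> (r + 1) then 0 else c"
      have "phi (APsi r (swap r \<ii>) * (APsi r \<ii> * 1)) * v \<sim> s * (gPsi r * (s * (gPsi r * v)))"
        by (rule phi_maps_eqv [where \<jj> = "swap r (swap r \<jj>)"]) (intro phi_maps_Psi ev1 yes quadratic sw)
      moreover have "s * (gPsi r * (s * (gPsi r * v))) = gPsi r * (gPsi r * v)"
        using sgs [OF yes] by auto
      ultimately have 1: "phi (APsi r (swap r \<ii>) * APsi r \<ii>) * v \<sim> gPsi r * (gPsi r * v)"
        by simp
      have "phi (AE \<ii>) * v \<sim> v"
        using phi_E [OF v quadratic(3)] sign_rel_sim [OF v yes] by simp
      then have 2: "phi (?q \<ii> (AY r \<ii>) (AY (r + 1) \<ii>) (AE \<ii>)) * v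
          \<sim> ?q \<ii> (s * (gY r * v)) (s * (gY (r + 1) * v)) v"
        using phi_diff_eqv [OF phi_Y [OF v yes] phi_Y [OF v yes]] by auto
      have 3: "?q \<ii> (s * (gY r * v)) (s * (gY (r + 1) * v)) v = ?q \<jj> (gY r * v) (gY (r + 1) * v) v"
        using yes unfolding sign_rel_def
      proof
        assume "\<ii> = neg \<jj> \<and> s = - 1"
        then show ?thesis
          using edge_asym [OF e3, of "entry \<jj> r" "entry \<jj> (r + 1)"] quadratic(4) r j
          by (auto simp: edge_neg_iff entry_neg_eq_iff)
      qed simp
      have 4: "gPsi r * (gPsi r * v) \<sim> ?q \<jj> (gY r * v) (gY (r + 1) * v) v"
        by (rule K.eqv_trans [OF weight_quadratic [OF j(2) quadratic(4,5)]])
          (auto simp: edge_irrefl [OF e3])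
      show ?thesis
        unfolding quadratic(1,2) by (rule eqv_via [OF 1 2]) (unfold 3, rule 4)
    qed
  next
    case (braid \<ii> r)
    let ?b = "\<lambda>\<ii> x y z. if entry \<ii> r = entry \<ii> (r + 2) \<and> edge e (entry \<ii> (r + 1)) (entry \<ii> r) then x
       else if entry \<ii> r = entry \<ii> (r + 2) \<and> edge e (entry \<ii> r) (entry \<ii> (r + 1)) then y
       else z"
    show ?thesis
      using v braid(3)
    proof (cases rule: sign_rel_cases)
      case no
      note z0 = z [OF no braid(3)]
      have "phi (- AE \<ii>) * v \<sim> 0"
        using K.eqv_minus [OF z0(3)] by (simp add: free_lift_minus)
      then show ?thesis
        unfolding braid(1,2)
        by (intro zero [unfolded braid(1,2)])
          (use phi_diff_eqv [OF phi_mult_0 [OF z0(2)] phi_mult_0 [OF z0(2)]] z0(3) in auto)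
    next
      case (yes s)
      have r: "r < n" "1 \<le> r + 1" "r + 2 \<le> n" "r \<le> n" "r + 1 \<le> n" "1 \<le> r + 2" using braid by auto
      have a: "phi (APsi r (swap (r + 1) (swap r \<ii>)) * (APsi (r + 1) (swap r \<ii>) * (APsi r \<ii> * 1))) * v
          \<sim> s * (gPsi r * (s * (gPsi (r + 1) * (s * (gPsi r * v)))))"
        by (rule phi_maps_eqv [where \<jj> = "swap r (swap (r + 1) (swap r \<jj>))"])
          (intro phi_maps_Psi ev1 yes braid r sw sw2)
      have b: "phi (APsi (r + 1) (swap r (swap (r + 1) \<ii>)) * (APsi r (swap (r + 1) \<ii>) * (APsi (r + 1) \<ii> * 1))) * v
          \<sim> s * (gPsi (r + 1) * (s * (gPsi r * (s * (gPsi (r + 1) * v)))))"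
        by (rule phi_maps_eqv [where \<jj> = "swap (r + 1) (swap r (swap (r + 1) \<jj>))"])
          (intro phi_maps_Psi ev1 yes braid r sw sw2)
      have c: "s * (gPsi r * (s * (gPsi (r + 1) * (s * (gPsi r * v)))))
            - s * (gPsi (r + 1) * (s * (gPsi r * (s * (gPsi (r + 1) * v))))) =
          s * (gPsi r * (gPsi (r + 1) * (gPsi r * v)) - gPsi (r + 1) * (gPsi r * (gPsi (r + 1) * v)))"
        using sgs [OF yes] by auto
      have "phi p * v \<sim> s * (gPsi r * (gPsi (r + 1) * (gPsi r * v)) - gPsi (r + 1) * (gPsi r * (gPsi (r + 1) * v)))"
        using phi_diff_eqv [OF a b] unfolding c braid(1) mult_1_right mult.assoc .
      also have "\<dots> \<sim> s * ?b \<jj> v (- v) 0"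
        by (intro K.eqv_mult_left K.eqv_trans [OF weight_braid [OF j(2) braid(4,5)]])
          (use edge_asym [OF e3, of "entry \<jj> r" "entry \<jj> (r + 1)"] in auto)
      finally have 1: "phi p * v \<sim> s * ?b \<jj> v (- v) 0" .
      have E: "phi (AE \<ii>) * v \<sim> v"
        using phi_E [OF v braid(3)] sign_rel_sim [OF v yes] by simp
      have "phi (- AE \<ii>) * v \<sim> - v"
        using K.eqv_minus [OF E] by (simp add: free_lift_minus)
      with E have 2: "phi q * v \<sim> ?b \<ii> v (- v) 0"
        unfolding braid(2) by auto
      have 3: "?b \<ii> v (- v) 0 = s * ?b \<jj> v (- v) 0"
        using yes unfolding sign_rel_def
      proof
        assume "\<ii> = neg \<jj> \<and> s = - 1"
        then show ?thesis
          using edge_asym [OF e3, of "entry \<jj> r" "entry \<jj> (r + 1)"] braid(4) r j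
          by (auto simp: edge_neg_iff entry_neg_eq_iff)
      qed (simp only: mult_1_left)
      show ?thesis by (rule eqv_via [OF 1 2]) (unfold 3, rule K.eqv_refl)
    qed
  qed
qed

text \<open>
  On a weight space with \<open>-\<jj> = \<jj>\<close> both sides of every relation are zero, as the space is.
\<close>

lemma phi_eqv:
  assumes "a \<asymp> b" shows "phi a \<sim> phi b"
proof (rule A.free_lift_eqv [OF K.presentation_axioms assms])
  fix p q :: "(alt_gen, 'z) free" assume rel: "alt_rel e n \<gamma> p q"
  show "phi p \<sim> phi q"
  proof (rule eqv_on_weights)
    fix \<jj> v assume v: "in_weight \<jj> v"
    show "phi p * v \<sim> phi q * v"
    proof (cases "neg \<jj> = \<jj>")
      case True
      from K.eqv_mult_left [OF weight_self_neg [OF v True], of "phi p"]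
        K.eqv_mult_left [OF weight_self_neg [OF v True], of "phi q"]
      show ?thesis by (rule eqv_via) simp
    next
      case False
      with v rel show ?thesis by (intro phi_rel_on_weight) (auto simp: in_free_weight_def)
    qed
  qed
next
  fix g assume g: "g \<notin> alt_gens n \<gamma>"
  show "phi_gen e \<gamma> g \<sim> 0"
  proof (cases g)
    case (APsi_gen r \<ii>)
    show ?thesis
    proof (cases "\<ii> \<in> I")
      case True
      with g APsi_gen have "Psi_gen r \<notin> klr_gens \<alpha>" by (simp add: alt_gens_iff klr_gens_iff)
      from K.eqv_mult_right [OF K.eqv_gen_out [OF this], of "gE \<ii> - gE (neg \<ii>)"] True show ?thesis
        by (simp add: APsi_gen)
    qed (simp add: APsi_gen)
  next
    case (AY_gen r \<ii>)
    show ?thesis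
    proof (cases "\<ii> \<in> I")
      case True
      with g AY_gen have "Y_gen r \<notin> klr_gens \<alpha>" by (simp add: alt_gens_iff klr_gens_iff)
      from K.eqv_mult_right [OF K.eqv_gen_out [OF this], of "gE \<ii> - gE (neg \<ii>)"] True show ?thesis
        by (simp add: AY_gen)
    qed (simp add: AY_gen)
  next
    case (AE_gen \<ii>)
    with g show ?thesis by (simp add: alt_gens_iff)
  qed
qed

end

section \<open>The parity automorphism of the alternating presentation\<close>

context alternating_block
begin

text \<open>
  The sign which tells a chosen representative of \<open>{\<ii>, -\<ii>}\<close> from its negative. The choice depends
  only on the set. The value is 1 if \<open>-\<ii> = \<ii>\<close>.
\<close>

definition orient :: "int list \<Rightarrow> 'z"
  where "orient \<ii> = (if \<ii> = (SOME \<jj>. \<jj> \<in> {\<ii>, neg \<ii>}) then 1 else - 1)"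

lemma orient_sq [simp]: "orient \<ii> * orient \<ii> = 1" "orient \<ii> * (orient \<ii> * x) = x"
  by (auto simp: orient_def)

lemma orient_neg:
  assumes "\<ii> \<in> I" "neg \<ii> \<noteq> \<ii>"
  shows "orient (neg \<ii>) = - orient \<ii>"
proof -
  have s: "{neg \<ii>, neg (neg \<ii>)} = {\<ii>, neg \<ii>}" using assms by (auto simp: neg_neg)
  have "(SOME \<jj>. \<jj> \<in> {\<ii>, neg \<ii>}) \<in> {\<ii>, neg \<ii>}" by (rule someI [of _ \<ii>]) simp
  then show ?thesis using assms(2) unfolding orient_def s by auto
qed

lemma orient_swap_neg:
  assumes "\<ii> \<in> I" "1 \<le> r" "r < n"
  shows "orient (neg \<ii>) * orient (swap r (neg \<ii>)) = orient \<ii> * orient (swap r \<ii>)"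
proof (cases "neg \<ii> = \<ii>")
  case False
  have "swap r (swap r \<ii>) = \<ii>" "swap r (swap r (neg \<ii>)) = neg \<ii>"
    using assms by (simp_all add: swap_swap I_length)
  with False have "neg (swap r \<ii>) \<noteq> swap r \<ii>"
    using assms by (metis swap_neg)
  with False assms show ?thesis
    by (simp add: orient_neg swap_neg I_swap)
qed simp

text \<open>
  In the quiver Hecke algebra this is conjugation by the element \<open>w = \<Sum> \<sigma>(\<ii>) e(\<ii>)\<close>, whose square is 1
  and which is negated by the sign automorphism.
\<close>

fun parity_gen :: "alt_gen \<Rightarrow> (alt_gen, 'z) free" where
  "parity_gen (APsi_gen r \<ii>) = scale (orient \<ii> * orient (swap r \<ii>)) (APsi r \<ii>)"
| "parity_gen (AY_gen r \<ii>) = AY r \<ii>"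
| "parity_gen (AE_gen \<ii>) = AE \<ii>"

definition parity :: "(alt_gen, 'z) free \<Rightarrow> (alt_gen, 'z) free"
  where "parity = free_lift parity_gen"

lemmas parity_simps [simp] = free_lift_simps [of parity_gen, folded parity_def]
  free_lift_0 [of parity_gen, folded parity_def] free_lift_1 [of parity_gen, folded parity_def]

lemma parity_APsi [simp]: "parity (APsi r \<ii>) = scale (orient \<ii> * orient (swap r \<ii>)) (APsi r \<ii>)"
  and parity_AY [simp]: "parity (AY r \<ii>) = AY r \<ii>"
  and parity_AE [simp]: "parity (AE \<ii>) = AE \<ii>"
  by (simp_all add: parity_def)

lemma parity_parity: "parity (parity p) = p"
proof (induction p rule: free_induct)
  case (gen g p)
  then show ?case
    by (cases g) (simp_all add: scale_mult_left scale_scale ac_simps)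
qed simp_all

text \<open>
  Both sides of each relation are homogeneous for the grading in which \<open>\<Psi>\<^sub>r(\<ii>)\<close> has the
  sign \<open>\<sigma>(\<ii>) \<sigma>(s\<^sub>r \<cdot> \<ii>)\<close>, since the sign of a path depends only on its end points.
\<close>

lemma parity_rel:
  assumes "alt_rel e n \<gamma> p q"
  shows "\<exists>k. parity p = scale k p \<and> parity q = scale k q"
proof -
  note pull = scale_mult_left scale_mult_right scale_scale scale_diff_right [symmetric] scale_add_right [symmetric]
    scale_minus_right
  from assms show ?thesis
  proof cases
    case (Psi_neg \<ii> r)
    then show ?thesis
      by (intro exI [of _ "orient \<ii> * orient (swap r \<ii>)"]) (simp add: pull orient_swap_neg)
  next
    case (E_Psi_E \<ii> \<jj> \<kk> r)
    then show ?thesis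
      by (intro exI [of _ "orient \<jj> * orient (swap r \<jj>)"]) (simp add: pull when_def)
  next
    case (Psi_Y_Suc \<ii> r)
    then have "entry \<ii> r = entry \<ii> (r + 1) \<Longrightarrow> swap r \<ii> = \<ii>"
      by (intro swap_id) (auto simp: I_length)
    with Psi_Y_Suc show ?thesis
      by (intro exI [of _ "orient \<ii> * orient (swap r \<ii>)"]) (auto simp: pull when_def)
  next
    case (Y_Suc_Psi \<ii> r)
    then have "entry \<ii> r = entry \<ii> (r + 1) \<Longrightarrow> swap r \<ii> = \<ii>"
      by (intro swap_id) (auto simp: I_length)
    with Y_Suc_Psi show ?thesis
      by (intro exI [of _ "orient \<ii> * orient (swap r \<ii>)"]) (auto simp: pull when_def)
  next
    case (Psi_Y \<ii> r s)
    then show ?thesis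
      by (intro exI [of _ "orient \<ii> * orient (swap r \<ii>)"]) (simp add: pull)
  next
    case (Psi_Psi \<ii> r t)
    then have "swap r (swap t \<ii>) = swap t (swap r \<ii>)"
      by (intro swap_commute) (auto simp: I_length)
    with Psi_Psi show ?thesis
      by (intro exI [of _ "orient \<ii> * orient (swap r (swap t \<ii>))"]) (simp add: pull ac_simps)
  next
    case (quadratic \<ii> r)
    then have "swap r (swap r \<ii>) = \<ii>"
      by (intro swap_swap) (auto simp: I_length)
    with quadratic show ?thesis
      by (intro exI [of _ 1]) (simp add: pull ac_simps)
  next
    case (braid \<ii> r)
    let ?x = "APsi r (swap (r + 1) (swap r \<ii>)) * APsi (r + 1) (swap r \<ii>) * APsi r \<ii>"
    let ?y = "APsi (r + 1) (swap r (swap (r + 1) \<ii>)) * APsi r (swap (r + 1) \<ii>) * APsi (r + 1) \<ii>"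
    let ?k = "orient \<ii> * orient (swap r (swap (r + 1) (swap r \<ii>)))"
    have r: "r + 1 < length \<ii>" using braid by (simp add: I_length)
    have "parity ?x = scale ?k ?x"
      by (simp add: pull ac_simps)
    moreover have "parity ?y = scale ?k ?y"
      unfolding swap_braid [OF braid(4) r] by (simp add: pull ac_simps)
    moreover have "entry \<ii> r = entry \<ii> (r + 2) \<Longrightarrow> ?k = 1"
      using swap_braid_id [OF braid(4) r] by simp
    ultimately show ?thesis
      unfolding braid(1,2) by (intro exI [of _ ?k]) (auto simp: pull)
  qed (intro exI [of _ 1]; simp)+
qed

lemma parity_eqv: "x \<asymp> y \<Longrightarrow> parity x \<asymp> parity y"
  unfolding parity_def
proof (rule A.free_lift_eqv [OF A.presentation_axioms])
  fix p q :: "(alt_gen, 'z) free" assume rel: "alt_rel e n \<gamma> p q"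
  with parity_rel [OF rel] A.eqv_scale [OF A.eqv_rel [OF rel]]
  show "free_lift parity_gen p \<asymp> free_lift parity_gen q"
    unfolding parity_def by fastforce
next
  fix g assume "g \<notin> alt_gens n \<gamma>"
  from A.eqv_gen_out [OF this] A.eqv_scale [OF A.eqv_gen_out [OF this]] show "parity_gen g \<asymp> 0"
    by (cases g) fastforce+
qed

section \<open>Consequences of the alternating relations\<close>

lemma eqv_minus_self: "x \<asymp> - x \<Longrightarrow> x \<asymp> 0"
proof -
  assume "x \<asymp> - x"
  then have "scale h (x + x) \<asymp> scale h (x + - x)"
    by (intro A.eqv_scale A.eqv_add A.eqv_refl)
  then show ?thesis by (simp only: scale_add_right scale_h_double add.right_inverse scale_zero_right
      scale_minus_right)
qed

lemma AE_AE: "\<ii> \<in> I \<Longrightarrow> \<jj> \<in> I \<Longrightarrow> AE \<ii> * AE \<jj> \<asymp> (AE \<ii> when seq_sim e \<ii> \<jj>)"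
  by (intro A.eqv_rel alt_rel.E_E)

lemma sim_refl [simp]: "seq_sim e \<ii> \<ii>"
  by (simp add: seq_sim_def)

lemma AE_AE_act: "\<jj> \<in> I \<Longrightarrow> AE \<jj> * (AE \<jj> * v) \<asymp> AE \<jj> * v"
  using A.eqv_mult_right [OF AE_AE [of \<jj> \<jj>], of v] by (simp add: mult.assoc)

lemma AE_out: "\<ii> \<notin> I \<Longrightarrow> AE \<ii> \<asymp> 0"
  by (intro A.eqv_gen_out) (simp add: alt_gens_iff)

lemma AY_out: "\<not> (1 \<le> r \<and> r \<le> n \<and> \<ii> \<in> I) \<Longrightarrow> AY r \<ii> \<asymp> 0"
  by (intro A.eqv_gen_out) (simp add: alt_gens_iff)

lemma APsi_out: "\<not> (1 \<le> r \<and> r < n \<and> \<ii> \<in> I) \<Longrightarrow> APsi r \<ii> \<asymp> 0"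
  by (intro A.eqv_gen_out) (simp add: alt_gens_iff)

lemma AY_neg: "\<ii> \<in> I \<Longrightarrow> AY r (neg \<ii>) \<asymp> - AY r \<ii>"
proof (cases "1 \<le> r \<and> r \<le> n")
  case False
  then have "AY r (neg \<ii>) \<asymp> 0" "AY r \<ii> \<asymp> 0" by (auto intro: AY_out)
  moreover from A.eqv_minus [OF this(2)] have "- AY r \<ii> \<asymp> 0" by simp
  ultimately show ?thesis using A.eqv_trans A.eqv_sym by blast
qed (intro A.eqv_rel alt_rel.Y_neg; simp)

lemma APsi_neg: "\<ii> \<in> I \<Longrightarrow> APsi r (neg \<ii>) \<asymp> - APsi r \<ii>"
proof (cases "1 \<le> r \<and> r < n")
  case False
  then have "APsi r (neg \<ii>) \<asymp> 0" "APsi r \<ii> \<asymp> 0" by (auto intro: APsi_out)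
  moreover from A.eqv_minus [OF this(2)] have "- APsi r \<ii> \<asymp> 0" by simp
  ultimately show ?thesis using A.eqv_trans A.eqv_sym by blast
qed (intro A.eqv_rel alt_rel.Psi_neg; simp)

text \<open>
  Here \<open>\<Psi>\<^sub>1(\<jj>) = \<Psi>\<^sub>1(-\<jj>) = -\<Psi>\<^sub>1(\<jj>)\<close> vanishes. If the first entry is not 0, the cyclotomic relation
  applies. If the first two entries are 0, the relation between \<open>\<Psi>\<^sub>1\<close> and \<open>Y\<^sub>2\<close> expresses \<open>\<epsilon>(\<jj>)\<close> by
  multiples of \<open>\<Psi>\<^sub>1(\<jj>)\<close>; if they are 0 and \<open>e/2\<close>, the quadratic relation does, because there is no edge
  between them.
\<close>

lemma AE_self_neg:
  assumes "\<jj> \<in> I" "neg \<jj> = \<jj>"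
  shows "AE \<jj> \<asymp> 0"
proof -
  let ?a = "entry \<jj> 1" and ?b = "entry \<jj> (1 + 1)"
  have vert: "?a \<in> vertices e" "?b \<in> vertices e"
    using entry_vertices [OF assms(1)] n2 by auto
  have fx: "residue e (- ?a) = ?a" "residue e (- ?b) = ?b"
    using entry_neg [OF assms(1), of 1, unfolded assms(2), symmetric]
      entry_neg [OF assms(1), of "1 + 1", unfolded assms(2), symmetric] n2 by simp_all
  have psi: "APsi 1 \<jj> \<asymp> 0"
    using APsi_neg [OF assms(1), of 1] by (intro eqv_minus_self) (simp add: assms(2))
  consider "?a \<noteq> 0" | "?a = 0" "?a = ?b" | "?a = 0" "?a \<noteq> ?b" by blast
  then show ?thesis
  proof cases
    case 1
    then show ?thesis
      using A.eqv_rel [OF alt_rel.cyclotomic [OF assms(1), of n e]] n2 by (simp add: Lambda0_def)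
  next
    case 2
    have "APsi 1 \<jj> * AY (1 + 1) \<jj> \<asymp> AY 1 (swap 1 \<jj>) * APsi 1 \<jj> + (AE \<jj> when ?a = ?b)"
      using n2 by (intro A.eqv_rel alt_rel.Psi_Y_Suc assms) auto
    moreover have "APsi 1 \<jj> * AY (1 + 1) \<jj> \<asymp> 0 * AY (1 + 1) \<jj>"
      by (intro A.eqv_mult_right psi)
    moreover have "AY 1 (swap 1 \<jj>) * APsi 1 \<jj> + (AE \<jj> when ?a = ?b) \<asymp> AY 1 (swap 1 \<jj>) * 0 + (AE \<jj> when ?a = ?b)"
      by (intro A.eqv_add A.eqv_mult_left psi A.eqv_refl)
    ultimately have "0 * AY (1 + 1) \<jj> \<asymp> AY 1 (swap 1 \<jj>) * 0 + (AE \<jj> when ?a = ?b)"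
      using A.eqv_sym A.eqv_trans by blast
    with 2(2) show ?thesis using A.eqv_sym by simp
  next
    case 3
    have "APsi 1 (swap 1 \<jj>) * APsi 1 \<jj> \<asymp> AE \<jj>"
      using A.eqv_rel [OF alt_rel.quadratic [OF assms(1), of 1 n e]] n2 3(2) edge_self_neg [OF e3 vert fx]
        edge_self_neg [OF e3 vert(2,1) fx(2,1)] by simp
    from A.eqv_trans [OF A.eqv_sym [OF this] A.eqv_mult_left [OF psi]] show ?thesis by simp
  qed
qed

text \<open>
  Turns the two-sided relations for \<open>\<epsilon>(\<ii>)Y\<^sub>r(\<jj>)\<epsilon>(\<kk>)\<close> and \<open>\<epsilon>(\<ii>)\<Psi>\<^sub>r(\<jj>)\<epsilon>(\<kk>)\<close> into one-sided ones.
\<close>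

lemma absorb_idempotents:
  assumes "x \<asymp> a * x * b" "a * a \<asymp> a" "b * b \<asymp> b"
  shows "a * x \<asymp> x" "x * b \<asymp> x"
proof -
  have "a * x \<asymp> a * (a * x * b)"
    by (rule A.eqv_mult_left [OF assms(1)])
  also have "a * (a * x * b) \<asymp> a * x * b"
    using A.eqv_mult_right [OF assms(2), of "x * b"] by (simp add: mult.assoc)
  finally show "a * x \<asymp> x"
    using A.eqv_sym [OF assms(1)] A.eqv_trans by blast
  have "x * b \<asymp> a * x * b * b"
    by (rule A.eqv_mult_right [OF assms(1)])
  also have "a * x * b * b \<asymp> a * x * b"
    using A.eqv_mult_left [OF assms(3), of "a * x"] by (simp add: mult.assoc)
  finally show "x * b \<asymp> x"
    using A.eqv_sym [OF assms(1)] A.eqv_trans by blast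
qed

lemma absorb_idempotents_0:
  assumes "x \<asymp> 0" shows "a * x \<asymp> x" "x * b \<asymp> x"
  using A.eqv_trans [OF A.eqv_mult_left [OF assms, of a]] A.eqv_trans [OF A.eqv_mult_right [OF assms, of b]]
    A.eqv_sym [OF assms] by simp_all

lemma AE_AY:
  assumes j: "\<jj> \<in> I"
  shows "AE \<jj> * AY r \<jj> \<asymp> AY r \<jj>" "AY r \<jj> * AE \<jj> \<asymp> AY r \<jj>"
proof -
  have "AE \<jj> * AY r \<jj> \<asymp> AY r \<jj> \<and> AY r \<jj> * AE \<jj> \<asymp> AY r \<jj>"
  proof (cases "1 \<le> r \<and> r \<le> n")
    case True
    have "AY r \<jj> \<asymp> AE \<jj> * AY r \<jj> * AE \<jj>"
      using A.eqv_sym [OF A.eqv_rel [OF alt_rel.E_Y_E [OF j j j, of r n e]]] True by simp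
    from absorb_idempotents [OF this] AE_AE [OF j j] show ?thesis by simp
  next
    case False
    then have "AY r \<jj> \<asymp> 0" by (intro AY_out) auto
    with absorb_idempotents_0 show ?thesis by blast
  qed
  then show "AE \<jj> * AY r \<jj> \<asymp> AY r \<jj>" "AY r \<jj> * AE \<jj> \<asymp> AY r \<jj>" by auto
qed

lemma AE_APsi:
  assumes j: "\<jj> \<in> I"
  shows "AE (swap r \<jj>) * APsi r \<jj> \<asymp> APsi r \<jj>" "APsi r \<jj> * AE \<jj> \<asymp> APsi r \<jj>"
proof -
  have "AE (swap r \<jj>) * APsi r \<jj> \<asymp> APsi r \<jj> \<and> APsi r \<jj> * AE \<jj> \<asymp> APsi r \<jj>"
  proof (cases "1 \<le> r \<and> r < n")
    case True
    then have j': "swap r \<jj> \<in> I" and "swap r (swap r \<jj>) = \<jj>"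
      using j by (auto simp: I_swap swap_swap I_length)
    then have "APsi r \<jj> \<asymp> AE (swap r \<jj>) * APsi r \<jj> * AE \<jj>"
      using A.eqv_sym [OF A.eqv_rel [OF alt_rel.E_Psi_E [OF j' j j, of r n e]]] True by simp
    from absorb_idempotents [OF this] AE_AE [OF j j] AE_AE [OF j' j'] show ?thesis by simp
  next
    case False
    then have "APsi r \<jj> \<asymp> 0" by (intro APsi_out) auto
    with absorb_idempotents_0 show ?thesis by blast
  qed
  then show "AE (swap r \<jj>) * APsi r \<jj> \<asymp> APsi r \<jj>" "APsi r \<jj> * AE \<jj> \<asymp> APsi r \<jj>" by auto
qed

section \<open>The quiver Hecke algebra acts on the alternating algebra\<close>

text \<open>
  The action of \<open>e(\<ii>) = \<epsilon>(\<ii>) (1 + \<sigma>(\<ii>) w) / 2\<close>, where \<open>w\<close> acts by \<^const>\<open>parity\<close>.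
\<close>

definition weight_proj :: "int list \<Rightarrow> (alt_gen, 'z) free \<Rightarrow> (alt_gen, 'z) free"
  where "weight_proj \<ii> v = scale h (AE \<ii> * (v + scale (orient \<ii>) (parity v)))"

text \<open>
  In the quiver Hecke algebra, \<open>\<psi>\<^sub>r\<close> is the sum of all \<open>\<psi>\<^sub>r e(\<jj>)\<close>, and \<open>\<psi>\<^sub>r e(\<jj>)\<close> is the image of \<open>\<Psi>\<^sub>r(\<jj>)\<close>
  times \<open>e(\<jj>)\<close>.
\<close>

fun T_gen :: "klr_gen \<Rightarrow> (alt_gen, 'z) free \<Rightarrow> (alt_gen, 'z) free" where
  "T_gen (Psi_gen r) v = (\<Sum>\<jj>\<in>I. APsi r \<jj> * weight_proj \<jj> v)"
| "T_gen (Y_gen r) v = (\<Sum>\<jj>\<in>I. AY r \<jj> * weight_proj \<jj> v)"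
| "T_gen (E_gen \<ii>) v = weight_proj \<ii> v"

abbreviation T :: "(klr_gen, 'z) free \<Rightarrow> (alt_gen, 'z) free \<Rightarrow> (alt_gen, 'z) free"
  where "T \<equiv> act T_gen"

lemma free_linear_weight_proj: "free_linear (weight_proj \<ii>)"
  by (simp add: free_linear_def weight_proj_def scale_add_right distrib_left scale_mult_right scale_scale ac_simps)

lemma free_linear_T_gen: "free_linear (T_gen g)"
  using free_linear_weight_proj unfolding free_linear_def
  by (cases g) (simp_all add: distrib_left scale_mult_right sum.distrib scale_sum)

lemma T_mult: "T (p * q) v = T p (T q v)"
  by (rule act_mult [OF free_linear_T_gen])

lemma free_linear_T: "free_linear (T p)"
  by (rule free_linear_act [OF free_linear_T_gen])

lemma weight_proj_eqv: "v \<asymp> w \<Longrightarrow> weight_proj \<ii> v \<asymp> weight_proj \<ii> w"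
  unfolding weight_proj_def by (intro A.eqv_scale A.eqv_mult_left A.eqv_add parity_eqv)

lemma T_gen_eqv: "v \<asymp> w \<Longrightarrow> T_gen g v \<asymp> T_gen g w"
  by (cases g) (auto intro!: A.eqv_sum A.eqv_mult_left weight_proj_eqv)

lemma T_eqv: "v \<asymp> w \<Longrightarrow> T p v \<asymp> T p w"
  by (induction p rule: free_induct)
    (auto simp: act_add act_scale T_mult intro: A.eqv_add A.eqv_scale T_gen_eqv)

text \<open>
  The image of \<open>weight_proj \<jj>\<close>, as \<open>weight_proj_alt_weight\<close> and \<open>alt_weight_proj\<close> show.
\<close>

definition alt_weight :: "int list \<Rightarrow> (alt_gen, 'z) free \<Rightarrow> bool"
  where "alt_weight \<jj> v \<longleftrightarrow> \<jj> \<in> I \<and> parity v \<asymp> scale (orient \<jj>) v \<and> AE \<jj> * v \<asymp> v"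

lemma alt_weight_I: "alt_weight \<jj> v \<Longrightarrow> \<jj> \<in> I"
  by (simp add: alt_weight_def)

lemma alt_weight_0: "\<jj> \<in> I \<Longrightarrow> alt_weight \<jj> 0"
  by (simp add: alt_weight_def)

lemma AE_alt_weight: "alt_weight \<jj> v \<Longrightarrow> \<ii> \<in> I \<Longrightarrow> AE \<ii> * v \<asymp> (v when seq_sim e \<ii> \<jj>)"
proof -
  assume v: "alt_weight \<jj> v" and i: "\<ii> \<in> I"
  have v': "v \<asymp> AE \<jj> * v" using v A.eqv_sym by (simp add: alt_weight_def)
  show ?thesis
  proof (cases "seq_sim e \<ii> \<jj>")
    case True
    then have "\<jj> = \<ii> \<or> \<jj> = neg \<ii>" by (auto simp: seq_sim_def)
    then have "AE \<ii> \<asymp> AE \<jj>"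
      using A.eqv_sym [OF A.eqv_rel [OF alt_rel.E_neg [OF i]]] by auto
    from A.eqv_trans [OF A.eqv_mult_right [OF this] A.eqv_sym [OF v']] True show ?thesis
      by simp
  next
    case False
    have "AE \<ii> * v \<asymp> AE \<ii> * (AE \<jj> * v)" by (rule A.eqv_mult_left [OF v'])
    also have "AE \<ii> * (AE \<jj> * v) \<asymp> 0 * v"
      using A.eqv_mult_right [OF AE_AE [OF i alt_weight_I [OF v]]] False by (simp add: mult.assoc)
    finally show ?thesis using False by simp
  qed
qed

lemma alt_weight_self_neg: "alt_weight \<jj> v \<Longrightarrow> neg \<jj> = \<jj> \<Longrightarrow> v \<asymp> 0"
proof -
  assume v: "alt_weight \<jj> v" and neg: "neg \<jj> = \<jj>"
  have "v \<asymp> AE \<jj> * v" using v A.eqv_sym by (simp add: alt_weight_def)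
  also have "\<dots> \<asymp> 0 * v"
    by (rule A.eqv_mult_right [OF AE_self_neg [OF alt_weight_I [OF v] neg]])
  finally show ?thesis by simp
qed

lemma weight_proj_alt_weight: "alt_weight \<jj> v \<Longrightarrow> weight_proj \<ii> v \<asymp> (v when \<ii> = \<jj>)"
proof -
  assume v: "alt_weight \<jj> v"
  have p: "weight_proj \<ii> v \<asymp> scale h (AE \<ii> * (v + scale (orient \<ii>) (scale (orient \<jj>) v)))"
    unfolding weight_proj_def using v
    by (intro A.eqv_scale A.eqv_mult_left A.eqv_add A.eqv_refl) (simp add: alt_weight_def)
  consider "\<ii> = \<jj>" | "\<ii> \<noteq> \<jj>" "\<ii> = neg \<jj>" | "\<ii> \<noteq> \<jj>" "\<ii> \<in> I" "\<ii> \<noteq> neg \<jj>" | "\<ii> \<notin> I" by blast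
  then show ?thesis
  proof cases
    case 1
    have "scale h (AE \<jj> * v + AE \<jj> * v) \<asymp> scale h (v + v)"
      using v by (intro A.eqv_scale A.eqv_add) (simp_all add: alt_weight_def)
    with p 1 show ?thesis
      by (simp add: scale_scale scale_add_right scale_h_double distrib_left) (rule A.eqv_trans)
  next
    case 2
    then have "orient \<ii> = - orient \<jj>"
      using orient_neg [OF alt_weight_I [OF v]] by auto
    then have "scale (orient \<ii>) (scale (orient \<jj>) v) = - v"
      by (simp add: scale_scale) (metis scale_of_int of_int_1 of_int_minus mult_minus1)
    with p 2 show ?thesis by simp
  next
    case 3
    then have "\<not> seq_sim e \<ii> \<jj>"
      using v by (auto simp: seq_sim_def alt_weight_def neg_neg)
    then have "AE \<ii> * v \<asymp> 0" using AE_alt_weight [OF v 3(2)] by simp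
    then have "scale h (AE \<ii> * v + scale (orient \<ii>) (scale (orient \<jj>) (AE \<ii> * v)))
        \<asymp> scale h (0 + scale (orient \<ii>) (scale (orient \<jj>) 0))"
      by (intro A.eqv_scale A.eqv_add)
    with p 3 show ?thesis
      by (simp add: distrib_left scale_mult_right) (rule A.eqv_trans)
  next
    case 4
    have "weight_proj \<ii> v \<asymp> scale h (0 * (v + scale (orient \<ii>) (parity v)))"
      unfolding weight_proj_def by (intro A.eqv_scale A.eqv_mult_right AE_out 4)
    with 4 alt_weight_I [OF v] show ?thesis by (auto simp: when_def)
  qed
qed

lemma alt_weight_proj: "\<jj> \<in> I \<Longrightarrow> alt_weight \<jj> (weight_proj \<jj> v)"
proof -
  assume j: "\<jj> \<in> I"
  have "parity (weight_proj \<jj> v) = scale (orient \<jj>) (weight_proj \<jj> v)"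
    by (simp add: weight_proj_def parity_parity scale_scale scale_mult_right scale_add_right distrib_left ac_simps)
  moreover have "AE \<jj> * weight_proj \<jj> v \<asymp> weight_proj \<jj> v"
    unfolding weight_proj_def scale_mult_right by (intro A.eqv_scale AE_AE_act j)
  ultimately show ?thesis using j by (simp add: alt_weight_def)
qed

text \<open>
  The terms \<open>\<epsilon>(\<jj>)v / 2\<close> add up to \<open>v\<close>, and the terms \<open>\<sigma>(\<jj>) \<epsilon>(\<jj>) \<theta>(v) / 2\<close> cancel in pairs, because \<open>\<sigma>\<close>
  is odd and \<open>\<epsilon>\<close> is even under \<open>\<jj> \<mapsto> -\<jj>\<close>.
\<close>

lemma sum_weight_proj: "v \<asymp> (\<Sum>\<jj>\<in>I. weight_proj \<jj> v)"
proof -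
  let ?S = "\<Sum>\<jj>\<in>I. scale (h * orient \<jj>) (AE \<jj>)"
  have bij: "bij_betw neg I I"
    using I_neg neg_neg by (intro bij_betw_byWitness [where f' = neg]) auto
  have "?S = (\<Sum>\<jj>\<in>I. scale (h * orient (neg \<jj>)) (AE (neg \<jj>)))"
    by (rule sum.reindex_bij_betw [OF bij, symmetric])
  also have "\<dots> \<asymp> (\<Sum>\<jj>\<in>I. - scale (h * orient \<jj>) (AE \<jj>))"
  proof (rule A.eqv_sum)
    fix \<jj> assume j: "\<jj> \<in> I"
    have "scale (h * orient (neg \<jj>)) (AE (neg \<jj>)) \<asymp> scale (h * orient (neg \<jj>)) (AE \<jj>)"
      by (intro A.eqv_scale A.eqv_rel alt_rel.E_neg j)
    also have "\<dots> \<asymp> - scale (h * orient \<jj>) (AE \<jj>)"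
    proof (cases "neg \<jj> = \<jj>")
      case True
      have 0: "scale c (AE \<jj>) \<asymp> 0" for c
        using A.eqv_scale [OF AE_self_neg [OF j True], of c] by simp
      have "- scale (h * orient \<jj>) (AE \<jj>) \<asymp> 0"
        using A.eqv_minus [OF 0] by simp
      from A.eqv_trans [OF 0 A.eqv_sym [OF this]] show ?thesis .
    next
      case False
      then show ?thesis
        using orient_neg [OF j] by (simp add: scale_def single_uminus)
    qed
    finally show "scale (h * orient (neg \<jj>)) (AE (neg \<jj>)) \<asymp> - scale (h * orient \<jj>) (AE \<jj>)" .
  qed
  finally have S: "?S \<asymp> 0"
    by (intro eqv_minus_self) (simp add: sum_negf)
  have "(\<Sum>\<jj>\<in>I. scale h (AE \<jj>)) \<asymp> 1"
    using A.eqv_rel [OF alt_rel.E_sum [of e n \<gamma>]] by (simp only: half_h)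
  then have "1 * v + 0 * parity v \<asymp> (\<Sum>\<jj>\<in>I. scale h (AE \<jj>)) * v + ?S * parity v"
    using A.eqv_sym [OF S] A.eqv_sym by (intro A.eqv_add A.eqv_mult_right) auto
  also have "\<dots> = (\<Sum>\<jj>\<in>I. weight_proj \<jj> v)"
    by (simp add: sum_distrib_right sum.distrib [symmetric] weight_proj_def scale_mult_left scale_mult_right
        scale_scale scale_add_right distrib_left)
  finally show ?thesis by simp
qed

end

context alternating_block
begin

lemma sum_mult_weight_proj: "alt_weight \<jj> v \<Longrightarrow> (\<Sum>\<ii>\<in>I. f \<ii> * weight_proj \<ii> v) \<asymp> f \<jj> * v"
proof -
  assume v: "alt_weight \<jj> v"
  have "(\<Sum>\<ii>\<in>I. f \<ii> * weight_proj \<ii> v) \<asymp> (\<Sum>\<ii>\<in>I. f \<ii> * (v when \<ii> = \<jj>))"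
    by (intro A.eqv_sum A.eqv_mult_left weight_proj_alt_weight v)
  also have "\<dots> = f \<jj> * v"
    using alt_weight_I [OF v] finite_class_seqs [OF \<gamma>]
    by (simp add: when_def if_distrib [of "\<lambda>x. _ * x"] cong: if_cong)
  finally show ?thesis .
qed

lemma T_Psi_weight: "alt_weight \<jj> v \<Longrightarrow> T (gPsi r) v \<asymp> APsi r \<jj> * v"
  and T_Y_weight: "alt_weight \<jj> v \<Longrightarrow> T (gY r) v \<asymp> AY r \<jj> * v"
  using sum_mult_weight_proj [of \<jj> v "\<lambda>\<ii>. APsi r \<ii>"] sum_mult_weight_proj [of \<jj> v "\<lambda>\<ii>. AY r \<ii>"]
  by simp_all

lemma T_E_weight: "alt_weight \<jj> v \<Longrightarrow> T (gE \<ii>) v \<asymp> (v when \<ii> = \<jj>)"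
  by (simp add: weight_proj_alt_weight)

lemma alt_weight_Y: "alt_weight \<jj> v \<Longrightarrow> alt_weight \<jj> (AY r \<jj> * v)"
proof -
  assume v: "alt_weight \<jj> v"
  have "parity (AY r \<jj> * v) \<asymp> AY r \<jj> * scale (orient \<jj>) v"
    using v by (simp add: alt_weight_def A.eqv_mult_left)
  with A.eqv_mult_right [OF AE_AY(1) [OF alt_weight_I [OF v]], of r v] v show ?thesis
    by (simp add: alt_weight_def scale_mult_right mult.assoc)
qed

lemma alt_weight_Psi: "alt_weight \<jj> v \<Longrightarrow> 1 \<le> r \<Longrightarrow> r < n \<Longrightarrow> alt_weight (swap r \<jj>) (APsi r \<jj> * v)"
proof -
  assume v: "alt_weight \<jj> v" and r: "1 \<le> r" "r < n"
  have "parity (APsi r \<jj> * v) \<asymp> scale (orient \<jj> * orient (swap r \<jj>)) (APsi r \<jj>) * scale (orient \<jj>) v"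
    using v by (simp add: alt_weight_def A.eqv_mult_left)
  also have "\<dots> = scale (orient (swap r \<jj>)) (APsi r \<jj> * v)"
    by (simp add: scale_mult_right scale_mult_left scale_scale ac_simps)
  finally show ?thesis
    using A.eqv_mult_right [OF AE_APsi(1) [OF alt_weight_I [OF v]], of r v] v r
    by (simp add: alt_weight_def mult.assoc I_swap)
qed

text \<open>
  The analogue of \<open>phi_maps\<close> for the action on the alternating algebra.
\<close>

definition T_maps :: "(klr_gen, 'z) free \<Rightarrow> (alt_gen, 'z) free \<Rightarrow> int list \<Rightarrow> (alt_gen, 'z) free \<Rightarrow> bool"
  where "T_maps p v \<jj> u \<longleftrightarrow> T p v \<asymp> u \<and> alt_weight \<jj> u"

lemma T_maps_1: "alt_weight \<jj> v \<Longrightarrow> T_maps 1 v \<jj> v"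
  by (simp add: T_maps_def)

lemma T_maps_Y: "T_maps p v \<jj> u \<Longrightarrow> T_maps (gY r * p) v \<jj> (AY r \<jj> * u)"
  using A.eqv_trans [OF T_eqv T_Y_weight] unfolding T_maps_def T_mult by (blast intro: alt_weight_Y)

lemma T_maps_Psi: "T_maps p v \<jj> u \<Longrightarrow> 1 \<le> r \<Longrightarrow> r < n \<Longrightarrow> T_maps (gPsi r * p) v (swap r \<jj>) (APsi r \<jj> * u)"
  using A.eqv_trans [OF T_eqv T_Psi_weight] unfolding T_maps_def T_mult by (blast intro: alt_weight_Psi)

lemma T_maps_eqv: "T_maps p v \<jj> u \<Longrightarrow> T p v \<asymp> u"
  by (simp add: T_maps_def)

lemma aeqv_via: "x \<asymp> x' \<Longrightarrow> y \<asymp> y' \<Longrightarrow> x' \<asymp> y' \<Longrightarrow> x \<asymp> y"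
  by (meson A.eqv_sym A.eqv_trans)

lemma T_when: "T p (v when b) = (T p v when b)"
  by (simp add: when_def free_linear_0 [OF free_linear_T])

lemma T_0: "T p 0 = 0"
  by (simp add: free_linear_0 [OF free_linear_T])

end

context alternating_component
begin

lemma T_mult_E: "alt_weight \<jj> v \<Longrightarrow> T (p * gE \<ii>) v \<asymp> (T p v when \<ii> = \<jj>)"
  unfolding T_mult using T_eqv [OF T_E_weight, of \<jj> v p \<ii>] by (simp only: T_when)

text \<open>
  Reduces relations that end in \<open>e(\<ii>)\<close> to the weight space of \<open>\<ii>\<close>.
\<close>

lemma T_rel_E:
  assumes "alt_weight \<jj> v" "\<ii> = \<jj> \<Longrightarrow> T p v \<asymp> T q v"
  shows "T (p * gE \<ii>) v \<asymp> T (q * gE \<ii>) v"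
  by (rule aeqv_via [OF T_mult_E [OF assms(1)] T_mult_E [OF assms(1)]])
    (use assms(2) in \<open>simp add: when_def\<close>)

text \<open>
  On weight vectors \<open>\<psi>\<^sub>r\<close> and \<open>y\<^sub>r\<close> act as \<open>\<Psi>\<^sub>r(\<jj>)\<close> and \<open>Y\<^sub>r(\<jj>)\<close>, where \<open>\<jj>\<close> is the current weight, so that
  each relation turns into the alternating relation of the same kind.
\<close>

lemma T_rel_on_weight:
  assumes rel: "klr_rel e \<alpha> p q" and j: "\<jj> \<in> seqs \<alpha>" and v: "alt_weight \<jj> v"
  shows "T p v \<asymp> T q v"
proof -
  \<comment> \<open>Generators stay folded, so that the rules for their action on weight vectors apply.\<close>
  note act_gen [simp del]
  note t1 = T_maps_1 [OF v]
  have jI: "\<jj> \<in> I" by (rule alt_weight_I [OF v])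
  have r: "a \<asymp> b \<Longrightarrow> a * v \<asymp> b * v" for a b by (rule A.eqv_mult_right)
  have Ev: "AE \<jj> * v \<asymp> v" using v by (simp add: alt_weight_def)
  from rel show ?thesis
  proof cases
    case (cyclotomic \<ii>)
    have "T (gY 1 ^ Lambda0 (entry \<ii> 1) * gE \<ii>) v \<asymp> T (0 * gE \<ii>) v"
    proof (rule T_rel_E [OF v])
      assume i: "\<ii> = \<jj>"
      note cyc = r [OF A.eqv_rel [OF alt_rel.cyclotomic [OF jI, of n e]]]
      show "T (gY 1 ^ Lambda0 (entry \<ii> 1)) v \<asymp> T 0 v"
      proof (cases "Lambda0 (entry \<jj> 1) = 0")
        case True
        then have "AE \<jj> * v \<asymp> 0 * v" using cyc n2 by simp
        from A.eqv_trans [OF A.eqv_sym [OF Ev] this] True i show ?thesis by simp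
      next
        case False
        then have 1: "Lambda0 (entry \<jj> 1) = 1" by (simp add: Lambda0_def split: if_splits)
        then have "AY 1 \<jj> * v \<asymp> 0 * v" using cyc n2 by simp
        from A.eqv_trans [OF T_Y_weight [OF v] this] 1 i show ?thesis by simp
      qed
    qed
    then show ?thesis using cyclotomic by simp
  next
    case (idem_idem \<ii> \<kk>)
    have "T (gE \<ii> * gE \<kk>) v \<asymp> (T (gE \<ii>) v when \<kk> = \<jj>)" by (rule T_mult_E [OF v])
    also have "\<dots> \<asymp> (v when \<ii> = \<jj> \<and> \<kk> = \<jj>)"
      using T_E_weight [OF v, of \<ii>] by (auto simp: when_def)
    also have "\<dots> \<asymp> T (gE \<ii> when \<ii> = \<kk>) v"
      using A.eqv_sym [OF T_E_weight [OF v, of \<ii>]] by (auto simp: when_def)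
    finally show ?thesis using idem_idem by simp
  next
    case idem_sum
    have "T (\<Sum>\<ii>\<in>seqs \<alpha>. gE \<ii>) v \<asymp> (\<Sum>\<ii>\<in>seqs \<alpha>. v when \<ii> = \<jj>)"
      unfolding act_sum by (intro A.eqv_sum T_E_weight v)
    then show ?thesis using j idem_sum by (simp add: when_def)
  next
    case (y_idem \<ii> s)
    have "T (gE \<ii> * gY s) v \<asymp> T (gE \<ii>) (AY s \<jj> * v)"
      unfolding T_mult by (intro T_eqv T_Y_weight v)
    also have "\<dots> \<asymp> (AY s \<jj> * v when \<ii> = \<jj>)"
      by (rule T_E_weight [OF alt_weight_Y [OF v]])
    also have "\<dots> \<asymp> (T (gY s) v when \<ii> = \<jj>)"
      using A.eqv_sym [OF T_Y_weight [OF v, of s]] by (auto simp: when_def)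
    also have "\<dots> \<asymp> T (gY s * gE \<ii>) v" by (rule A.eqv_sym [OF T_mult_E [OF v]])
    finally show ?thesis using y_idem A.eqv_sym by simp
  next
    case (psi_idem \<ii> s)
    then have s: "1 \<le> s" "s < n" by auto
    have sw: "swap s \<ii> = swap s \<jj> \<longleftrightarrow> \<ii> = \<jj>"
      using swap_swap [of s] I_length [OF seqs_class [OF psi_idem(3)]] I_length [OF jI] s by metis
    have "T (gE (swap s \<ii>) * gPsi s) v \<asymp> T (gE (swap s \<ii>)) (APsi s \<jj> * v)"
      unfolding T_mult by (intro T_eqv T_Psi_weight v)
    also have "\<dots> \<asymp> (APsi s \<jj> * v when \<ii> = \<jj>)"
      unfolding sw [symmetric] by (rule T_E_weight [OF alt_weight_Psi [OF v s]])
    also have "\<dots> \<asymp> (T (gPsi s) v when \<ii> = \<jj>)"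
      using A.eqv_sym [OF T_Psi_weight [OF v, of s]] by (auto simp: when_def)
    also have "\<dots> \<asymp> T (gPsi s * gE \<ii>) v" by (rule A.eqv_sym [OF T_mult_E [OF v]])
    finally show ?thesis using psi_idem A.eqv_sym by simp
  next
    case (y_y s t)
    have "T (gY s * (gY t * 1)) v \<asymp> AY s \<jj> * (AY t \<jj> * v)"
      "T (gY t * (gY s * 1)) v \<asymp> AY t \<jj> * (AY s \<jj> * v)"
      by (rule T_maps_eqv [where \<jj> = \<jj>], intro T_maps_Y t1)+
    moreover have "AY s \<jj> * (AY t \<jj> * v) \<asymp> AY t \<jj> * (AY s \<jj> * v)"
      using r [OF A.eqv_rel [OF alt_rel.Y_Y [OF jI jI, of s n t e]]] y_y by (simp add: mult.assoc)
    ultimately show ?thesis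
      unfolding y_y(1,2) mult_1_right by (rule aeqv_via)
  next
    case (psi_y_Suc \<ii> s)
    then have s: "1 \<le> s" "s < n" by auto
    have "T (gPsi s * gY (s + 1)) v \<asymp> T (gY s * gPsi s + (1 when entry \<ii> s = entry \<ii> (s + 1))) v"
      if i: "\<ii> = \<jj>"
    proof -
      let ?c = "\<lambda>x. x when entry \<jj> s = entry \<jj> (s + 1)"
      have "T (gPsi s * (gY (s + 1) * 1)) v \<asymp> APsi s \<jj> * (AY (s + 1) \<jj> * v)"
        by (rule T_maps_eqv [where \<jj> = "swap s \<jj>"]) (intro T_maps_Y T_maps_Psi t1 s)
      moreover have "T (gY s * (gPsi s * 1)) v + T (?c 1) v \<asymp> AY s (swap s \<jj>) * (APsi s \<jj> * v) + ?c v"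
        by (rule A.eqv_add, rule T_maps_eqv [where \<jj> = "swap s \<jj>"], intro T_maps_Y T_maps_Psi t1 s)
          (simp add: when_def)
      moreover have "APsi s \<jj> * (AY (s + 1) \<jj> * v) \<asymp> AY s (swap s \<jj>) * (APsi s \<jj> * v) + ?c (AE \<jj> * v)"
        using r [OF A.eqv_rel [OF alt_rel.Psi_Y_Suc [OF jI s, of e]]] by (simp add: mult.assoc distrib_right when_mult)
      moreover have "AY s (swap s \<jj>) * (APsi s \<jj> * v) + ?c (AE \<jj> * v) \<asymp> AY s (swap s \<jj>) * (APsi s \<jj> * v) + ?c v"
        using Ev by (intro A.eqv_add A.eqv_refl) (simp add: when_def)
      ultimately show ?thesis
        unfolding i act_add mult_1_right using aeqv_via A.eqv_trans by blast
    qed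
    from T_rel_E [OF v this] show ?thesis unfolding psi_y_Suc(1,2) .
  next
    case (y_Suc_psi \<ii> s)
    then have s: "1 \<le> s" "s < n" by auto
    have "T (gY (s + 1) * gPsi s) v \<asymp> T (gPsi s * gY s + (1 when entry \<ii> s = entry \<ii> (s + 1))) v"
      if i: "\<ii> = \<jj>"
    proof -
      let ?c = "\<lambda>x. x when entry \<jj> s = entry \<jj> (s + 1)"
      have "T (gY (s + 1) * (gPsi s * 1)) v \<asymp> AY (s + 1) (swap s \<jj>) * (APsi s \<jj> * v)"
        by (rule T_maps_eqv [where \<jj> = "swap s \<jj>"]) (intro T_maps_Y T_maps_Psi t1 s)
      moreover have "T (gPsi s * (gY s * 1)) v + T (?c 1) v \<asymp> APsi s \<jj> * (AY s \<jj> * v) + ?c v"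
        by (rule A.eqv_add, rule T_maps_eqv [where \<jj> = "swap s \<jj>"], intro T_maps_Y T_maps_Psi t1 s)
          (simp add: when_def)
      moreover have "AY (s + 1) (swap s \<jj>) * (APsi s \<jj> * v) \<asymp> APsi s \<jj> * (AY s \<jj> * v) + ?c (AE \<jj> * v)"
        using r [OF A.eqv_rel [OF alt_rel.Y_Suc_Psi [OF jI s, of e]]] by (simp add: mult.assoc distrib_right when_mult)
      moreover have "APsi s \<jj> * (AY s \<jj> * v) + ?c (AE \<jj> * v) \<asymp> APsi s \<jj> * (AY s \<jj> * v) + ?c v"
        using Ev by (intro A.eqv_add A.eqv_refl) (simp add: when_def)
      ultimately show ?thesis
        unfolding i act_add mult_1_right using aeqv_via A.eqv_trans by blast
    qed
    from T_rel_E [OF v this] show ?thesis unfolding y_Suc_psi(1,2) .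
  next
    case (psi_y s t)
    then have s: "1 \<le> s" "s < n" by auto
    have "T (gPsi s * (gY t * 1)) v \<asymp> APsi s \<jj> * (AY t \<jj> * v)"
      "T (gY t * (gPsi s * 1)) v \<asymp> AY t (swap s \<jj>) * (APsi s \<jj> * v)"
      by (rule T_maps_eqv [where \<jj> = "swap s \<jj>"], intro T_maps_Y T_maps_Psi t1 s)+
    moreover have "APsi s \<jj> * (AY t \<jj> * v) \<asymp> AY t (swap s \<jj>) * (APsi s \<jj> * v)"
      using r [OF A.eqv_rel [OF alt_rel.Psi_Y [OF jI s, of t e]]] psi_y by (simp add: mult.assoc)
    ultimately show ?thesis
      unfolding psi_y(1,2) mult_1_right by (rule aeqv_via)
  next
    case (psi_psi s t)
    then have s: "1 \<le> s" "s < n" and t: "1 \<le> t" "t < n" by auto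
    have "T (gPsi s * (gPsi t * 1)) v \<asymp> APsi s (swap t \<jj>) * (APsi t \<jj> * v)"
      by (rule T_maps_eqv [where \<jj> = "swap s (swap t \<jj>)"]) (intro T_maps_Psi t1 s t)
    moreover have "T (gPsi t * (gPsi s * 1)) v \<asymp> APsi t (swap s \<jj>) * (APsi s \<jj> * v)"
      by (rule T_maps_eqv [where \<jj> = "swap t (swap s \<jj>)"]) (intro T_maps_Psi t1 s t)
    moreover have "APsi s (swap t \<jj>) * (APsi t \<jj> * v) \<asymp> APsi t (swap s \<jj>) * (APsi s \<jj> * v)"
      using r [OF A.eqv_rel [OF alt_rel.Psi_Psi [OF jI s t, of e]]] psi_psi by (simp add: mult.assoc)
    ultimately show ?thesis
      unfolding psi_psi(1,2) mult_1_right by (rule aeqv_via)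
  next
    case (quadratic \<ii> s)
    then have s: "1 \<le> s" "s < n" by auto
    let ?q = "\<lambda>\<ii> a b c. if entry \<ii> s = entry \<ii> (s + 1) then 0
       else if edge e (entry \<ii> s) (entry \<ii> (s + 1)) then a - b
       else if edge e (entry \<ii> (s + 1)) (entry \<ii> s) then b - a
       else c"
    have "T (gPsi s ^ 2) v \<asymp> T (?q \<ii> (gY s) (gY (s + 1)) 1) v" if i: "\<ii> = \<jj>"
    proof (rule aeqv_via)
      have "T (gPsi s * (gPsi s * 1)) v \<asymp> APsi s (swap s \<jj>) * (APsi s \<jj> * v)"
        by (rule T_maps_eqv [where \<jj> = "swap s (swap s \<jj>)"]) (intro T_maps_Psi t1 s)
      then show "T (gPsi s ^ 2) v \<asymp> APsi s (swap s \<jj>) * (APsi s \<jj> * v)"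
        by (simp add: power2_eq_square)
      show "T (?q \<ii> (gY s) (gY (s + 1)) 1) v \<asymp> ?q \<jj> (AY s \<jj> * v) (AY (s + 1) \<jj> * v) v"
        unfolding i using T_Y_weight [OF v] by (auto simp: act_diff intro!: A.eqv_diff)
      have "APsi s (swap s \<jj>) * (APsi s \<jj> * v) \<asymp> ?q \<jj> (AY s \<jj>) (AY (s + 1) \<jj>) (AE \<jj>) * v"
        using r [OF A.eqv_rel [OF alt_rel.quadratic [OF jI s, of e]]] edge_irrefl [OF e3]
        by (auto simp: mult.assoc split: if_splits)
      also have "?q \<jj> (AY s \<jj>) (AY (s + 1) \<jj>) (AE \<jj>) * v \<asymp> ?q \<jj> (AY s \<jj> * v) (AY (s + 1) \<jj> * v) v"
        using Ev by (auto simp: left_diff_distrib)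
      finally show "APsi s (swap s \<jj>) * (APsi s \<jj> * v) \<asymp> ?q \<jj> (AY s \<jj> * v) (AY (s + 1) \<jj> * v) v" .
    qed
    from T_rel_E [OF v this] show ?thesis
      unfolding quadratic(1,2) by (simp add: if_distrib [of "\<lambda>x. x * _"] cong: if_cong)
  next
    case (braid \<ii> s)
    then have s: "1 \<le> s" "s < n" "1 \<le> s + 1" "s + 1 < n" by auto
    let ?q = "\<lambda>\<ii> a b. if entry \<ii> s = entry \<ii> (s + 2) \<and> edge e (entry \<ii> s) (entry \<ii> (s + 1)) then a
       else if entry \<ii> s = entry \<ii> (s + 2) \<and> edge e (entry \<ii> (s + 1)) (entry \<ii> s) then b
       else 0"
    let ?x = "APsi s (swap (s + 1) (swap s \<jj>)) * (APsi (s + 1) (swap s \<jj>) * (APsi s \<jj> * v))"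
    let ?y = "APsi (s + 1) (swap s (swap (s + 1) \<jj>)) * (APsi s (swap (s + 1) \<jj>) * (APsi (s + 1) \<jj> * v))"
    have "T (gPsi s * gPsi (s + 1) * gPsi s - gPsi (s + 1) * gPsi s * gPsi (s + 1)) v \<asymp> T (?q \<ii> (- 1) 1) v"
      if i: "\<ii> = \<jj>"
    proof (rule aeqv_via)
      have x: "T (gPsi s * (gPsi (s + 1) * (gPsi s * 1))) v \<asymp> ?x"
        by (rule T_maps_eqv [where \<jj> = "swap s (swap (s + 1) (swap s \<jj>))"]) (intro T_maps_Psi t1 s)
      have y: "T (gPsi (s + 1) * (gPsi s * (gPsi (s + 1) * 1))) v \<asymp> ?y"
        by (rule T_maps_eqv [where \<jj> = "swap (s + 1) (swap s (swap (s + 1) \<jj>))"]) (intro T_maps_Psi t1 s)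
      show "T (gPsi s * gPsi (s + 1) * gPsi s - gPsi (s + 1) * gPsi s * gPsi (s + 1)) v \<asymp> ?x - ?y"
        using A.eqv_diff [OF x y] unfolding act_diff mult.assoc mult_1_right .
      show "T (?q \<ii> (- 1) 1) v \<asymp> ?q \<jj> (- v) v"
        unfolding i by (auto simp: act_minus)
      have "?x - ?y \<asymp> ?q \<jj> (- AE \<jj>) (AE \<jj>) * v"
        using r [OF A.eqv_rel [OF alt_rel.braid [OF jI s(1,4), of e]]]
          edge_asym [OF e3, of "entry \<jj> s" "entry \<jj> (s + 1)"]
        by (auto simp: mult.assoc left_diff_distrib split: if_splits)
      also have "?q \<jj> (- AE \<jj>) (AE \<jj>) * v \<asymp> ?q \<jj> (- v) v"
        using Ev A.eqv_minus [OF Ev] by auto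
      finally show "?x - ?y \<asymp> ?q \<jj> (- v) v" .
    qed
    from T_rel_E [OF v this] show ?thesis
      unfolding braid(1,2) by (simp add: if_distrib [of "\<lambda>x. x * _"] cong: if_cong)
  qed
qed

text \<open>
  The part of the alternating algebra on which the unit of the block of \<open>\<alpha>\<close> acts as the identity. It is
  all of the alternating algebra, or one of two summands; the relation \<open>\<Sum> e(\<ii>) = 1\<close> of the block can hold
  only there.
\<close>

definition in_weight_sum :: "(alt_gen, 'z) free \<Rightarrow> bool"
  where "in_weight_sum v \<longleftrightarrow> (\<exists>f. (\<forall>\<jj>\<in>seqs \<alpha>. alt_weight \<jj> (f \<jj>)) \<and> v \<asymp> (\<Sum>\<jj>\<in>seqs \<alpha>. f \<jj>))"

lemma alt_weight_add: "alt_weight \<jj> v \<Longrightarrow> alt_weight \<jj> w \<Longrightarrow> alt_weight \<jj> (v + w)"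
  by (simp add: alt_weight_def scale_add_right distrib_left A.eqv_add)

lemma alt_weight_scale: "alt_weight \<jj> v \<Longrightarrow> alt_weight \<jj> (scale c v)"
proof -
  assume v: "alt_weight \<jj> v"
  then have "scale c (parity v) \<asymp> scale c (scale (orient \<jj>) v)"
    by (intro A.eqv_scale) (simp add: alt_weight_def)
  with v A.eqv_scale [of "AE \<jj> * v" v c] show ?thesis
    by (simp add: alt_weight_def scale_scale scale_mult_right mult.commute)
qed

lemma in_weight_sum_add: "in_weight_sum v \<Longrightarrow> in_weight_sum w \<Longrightarrow> in_weight_sum (v + w)"
  unfolding in_weight_sum_def
proof clarify
  fix f g
  assume "\<forall>\<jj>\<in>seqs \<alpha>. alt_weight \<jj> (f \<jj>)" "v \<asymp> sum f (seqs \<alpha>)" "\<forall>\<jj>\<in>seqs \<alpha>. alt_weight \<jj> (g \<jj>)" "w \<asymp> sum g (seqs \<alpha>)"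
  then show "\<exists>f. (\<forall>\<jj>\<in>seqs \<alpha>. alt_weight \<jj> (f \<jj>)) \<and> v + w \<asymp> sum f (seqs \<alpha>)"
    by (intro exI [of _ "\<lambda>\<jj>. f \<jj> + g \<jj>"]) (simp add: alt_weight_add sum.distrib A.eqv_add)
qed

lemma in_weight_sum_scale: "in_weight_sum v \<Longrightarrow> in_weight_sum (scale c v)"
  unfolding in_weight_sum_def
proof clarify
  fix f
  assume "\<forall>\<jj>\<in>seqs \<alpha>. alt_weight \<jj> (f \<jj>)" "v \<asymp> sum f (seqs \<alpha>)"
  then show "\<exists>f. (\<forall>\<jj>\<in>seqs \<alpha>. alt_weight \<jj> (f \<jj>)) \<and> scale c v \<asymp> sum f (seqs \<alpha>)"
    by (intro exI [of _ "\<lambda>\<jj>. scale c (f \<jj>)"]) (simp add: alt_weight_scale scale_sum [symmetric] A.eqv_scale)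
qed

lemma in_weight_sum_weight: "\<jj> \<in> seqs \<alpha> \<Longrightarrow> alt_weight \<jj> v \<Longrightarrow> in_weight_sum v"
  unfolding in_weight_sum_def
  by (intro exI [of _ "\<lambda>\<ii>. v when \<ii> = \<jj>"]) (auto simp: when_def alt_weight_0 seqs_class)

lemma in_weight_sum_0: "in_weight_sum 0"
  unfolding in_weight_sum_def by (intro exI [of _ "\<lambda>_. 0"]) (auto simp: alt_weight_0 seqs_class)

lemma in_weight_sum_eqv: "v \<asymp> w \<Longrightarrow> in_weight_sum w \<Longrightarrow> in_weight_sum v"
  unfolding in_weight_sum_def using A.eqv_trans by blast

lemma in_weight_sum_sum: "(\<And>x. x \<in> X \<Longrightarrow> in_weight_sum (f x)) \<Longrightarrow> in_weight_sum (sum f X)"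
  by (induction X rule: infinite_finite_induct) (auto simp: in_weight_sum_0 in_weight_sum_add)

lemma in_weight_sum_T_gen: "in_weight_sum v \<Longrightarrow> in_weight_sum (T_gen g v)"
proof -
  assume "in_weight_sum v"
  then obtain f where f: "\<And>\<jj>. \<jj> \<in> seqs \<alpha> \<Longrightarrow> alt_weight \<jj> (f \<jj>)" "v \<asymp> (\<Sum>\<jj>\<in>seqs \<alpha>. f \<jj>)"
    by (auto simp: in_weight_sum_def)
  have "in_weight_sum (T_gen g w)" if j: "\<jj> \<in> seqs \<alpha>" and w: "alt_weight \<jj> w" for \<jj> w
  proof (cases g)
    case (Psi_gen r)
    have t: "T_gen g w \<asymp> APsi r \<jj> * w"
      using T_Psi_weight [OF w, of r] Psi_gen by simp
    show ?thesis
    proof (cases "1 \<le> r \<and> r < n")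
      case True
      with t j w show ?thesis
        by (intro in_weight_sum_eqv [OF t] in_weight_sum_weight [of "swap r \<jj>"] alt_weight_Psi) (auto simp: seqs_swap)
    next
      case False
      then have "APsi r \<jj> * w \<asymp> 0 * w" by (intro A.eqv_mult_right APsi_out) auto
      from A.eqv_trans [OF t this] show ?thesis by (intro in_weight_sum_eqv [OF _ in_weight_sum_0]) simp
    qed
  next
    case (Y_gen r)
    with T_Y_weight [OF w, of r] show ?thesis
      by (intro in_weight_sum_eqv [OF _ in_weight_sum_weight [OF j alt_weight_Y [OF w]]]) simp
  next
    case (E_gen \<ii>)
    with T_E_weight [OF w, of \<ii>] have "T_gen g w \<asymp> (w when \<ii> = \<jj>)" by simp
    then show ?thesis
      by (rule in_weight_sum_eqv) (auto simp: when_def in_weight_sum_0 in_weight_sum_weight [OF j w])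
  qed
  with f(1) have "in_weight_sum (\<Sum>\<jj>\<in>seqs \<alpha>. T_gen g (f \<jj>))"
    by (intro in_weight_sum_sum) auto
  with T_gen_eqv [OF f(2), of g] show ?thesis
    by (simp add: free_linear_sum [OF free_linear_T_gen] in_weight_sum_eqv)
qed

lemma in_weight_sum_T: "in_weight_sum v \<Longrightarrow> in_weight_sum (T p v)"
  by (induction p rule: free_induct) (auto simp: in_weight_sum_0 act_add in_weight_sum_add act_scale in_weight_sum_scale T_mult in_weight_sum_T_gen)

text \<open>
  Congruences between linear maps need only be checked on weight vectors.
\<close>

lemma linear_eqv_on_weight_sum:
  assumes "free_linear L" "free_linear L'" "\<And>x y. x \<asymp> y \<Longrightarrow> L x \<asymp> L y" "\<And>x y. x \<asymp> y \<Longrightarrow> L' x \<asymp> L' y"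
    and "\<And>\<jj> v. \<jj> \<in> seqs \<alpha> \<Longrightarrow> alt_weight \<jj> v \<Longrightarrow> L v \<asymp> L' v" and "in_weight_sum v"
  shows "L v \<asymp> L' v"
proof -
  from \<open>in_weight_sum v\<close> obtain f where f: "\<And>\<jj>. \<jj> \<in> seqs \<alpha> \<Longrightarrow> alt_weight \<jj> (f \<jj>)" "v \<asymp> (\<Sum>\<jj>\<in>seqs \<alpha>. f \<jj>)"
    by (auto simp: in_weight_sum_def)
  show ?thesis
    by (rule aeqv_via [OF assms(3) [OF f(2)] assms(4) [OF f(2)]])
      (auto simp: free_linear_sum [OF assms(1)] free_linear_sum [OF assms(2)] intro!: A.eqv_sum assms(5) f(1))
qed

lemma T_vanish: "x \<sim> 0 \<Longrightarrow> in_weight_sum v \<Longrightarrow> T x v \<asymp> 0"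
proof (induction x arbitrary: v rule: K.eqv_0_induct)
  case (add x y)
  then show ?case using A.eqv_add by (fastforce simp: act_add)
next
  case (left a x)
  then show ?case using T_eqv [of "T x v" 0 a] by (simp add: T_mult T_0)
next
  case (right a x)
  show ?case unfolding T_mult by (rule right.IH [OF in_weight_sum_T [OF right.prems]])
next
  case (rel p q)
  have "T p v \<asymp> T q v"
    by (rule linear_eqv_on_weight_sum [OF free_linear_T free_linear_T T_eqv T_eqv T_rel_on_weight [OF rel(1)] rel(2)])
  then show ?case using A.eqv_diff_0 by (simp add: act_diff)
next
  case (gen g)
  have "T_gen g v \<asymp> 0"
  proof (rule linear_eqv_on_weight_sum [OF free_linear_T_gen, of "\<lambda>_. 0", OF _ T_gen_eqv _ _ gen(2)])
    show "free_linear (\<lambda>_. 0 :: (alt_gen, 'z) free)" by (simp add: free_linear_def)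
    fix \<jj> v assume j: "\<jj> \<in> seqs \<alpha>" and v: "alt_weight \<jj> v"
    show "T_gen g v \<asymp> 0"
    proof (cases g)
      case (Psi_gen r)
      with gen(1) have "APsi r \<jj> * v \<asymp> 0 * v"
        by (intro A.eqv_mult_right APsi_out) (auto simp: klr_gens_iff)
      from A.eqv_trans [OF T_Psi_weight [OF v] this] Psi_gen show ?thesis by simp
    next
      case (Y_gen r)
      with gen(1) have "AY r \<jj> * v \<asymp> 0 * v"
        by (intro A.eqv_mult_right AY_out) (auto simp: klr_gens_iff)
      from A.eqv_trans [OF T_Y_weight [OF v] this] Y_gen show ?thesis by simp
    next
      case (E_gen \<ii>)
      with gen(1) j have "\<ii> \<noteq> \<jj>" by (auto simp: klr_gens_iff)
      with T_E_weight [OF v, of \<ii>] E_gen show ?thesis by simp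
    qed
  qed auto
  then show ?case by simp
qed simp

lemma T_phi_gen: "in_weight_sum v \<Longrightarrow> T (phi (gen g)) v \<asymp> gen g * v"
proof (rule linear_eqv_on_weight_sum [OF free_linear_T free_linear_mult T_eqv A.eqv_mult_left])
  fix \<jj> v assume j: "\<jj> \<in> seqs \<alpha>" and v: "alt_weight \<jj> v"
  have D: "T (gE \<ii> - gE (neg \<ii>)) v \<asymp> (v when \<ii> = \<jj>) - (v when neg \<ii> = \<jj>)" for \<ii>
    unfolding act_diff by (intro A.eqv_diff T_E_weight v)
  have jI: "\<jj> \<in> I" by (rule alt_weight_I [OF v])
  \<comment> \<open>The computation for \<open>\<Psi>\<close> and \<open>Y\<close>: \<open>g'\<close> is \<open>\<psi>\<^sub>r\<close> or \<open>y\<^sub>r\<close>, and \<open>X \<ii>\<close> is \<open>\<Psi>\<^sub>r(\<ii>)\<close> or \<open>Y\<^sub>r(\<ii>)\<close>.\<close>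
  have general: "T (g' * (gE \<ii> - gE (neg \<ii>))) v \<asymp> X \<ii> * v"
    if i: "\<ii> \<in> I" and out: "\<And>\<ii>. \<ii> \<in> I \<Longrightarrow> X \<ii> * AE \<ii> \<asymp> X \<ii>" and X: "T g' v \<asymp> X \<jj> * v"
      and neg: "X (neg \<jj>) \<asymp> - X \<jj>" for g' X \<ii>
  proof (cases "neg \<jj> = \<jj>")
    case True
    have v0: "v \<asymp> 0" by (rule alt_weight_self_neg [OF v True])
    show ?thesis
      using T_eqv [OF v0, of "g' * (gE \<ii> - gE (neg \<ii>))"] A.eqv_mult_left [OF v0, of "X \<ii>"]
      by (simp add: T_0) (meson A.eqv_sym A.eqv_trans)
  next
    case False
    have "T (g' * (gE \<ii> - gE (neg \<ii>))) v \<asymp> T g' ((v when \<ii> = \<jj>) - (v when neg \<ii> = \<jj>))"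
      unfolding T_mult by (intro T_eqv D)
    also have "\<dots> \<asymp> X \<ii> * v"
    proof -
      have "seq_sim e \<ii> \<jj> \<Longrightarrow> \<ii> = \<jj> \<or> \<ii> = neg \<jj>"
        using i by (auto simp: seq_sim_def neg_neg)
      then consider "\<ii> = \<jj>" | "\<ii> = neg \<jj>" | "\<not> seq_sim e \<ii> \<jj>"
        by blast
      then show ?thesis
      proof cases
        case 1
        with X False show ?thesis by simp
      next
        case 2
        have "T g' (- v) \<asymp> - (X \<jj> * v)"
          using A.eqv_minus [OF X] by (simp add: free_linear_minus [OF free_linear_T])
        also have "\<dots> \<asymp> X (neg \<jj>) * v"
          using A.eqv_sym [OF A.eqv_mult_right [OF neg, of v]] by simp
        finally show ?thesis using 2 False by (simp add: neg_neg jI)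
      next
        case 3
        have "X \<ii> * v \<asymp> X \<ii> * AE \<ii> * v"
          by (rule A.eqv_mult_right [OF A.eqv_sym [OF out [OF i]]])
        also have "\<dots> \<asymp> X \<ii> * 0"
          using AE_alt_weight [OF v i] 3 unfolding mult.assoc by (intro A.eqv_mult_left) simp
        finally have "0 \<asymp> X \<ii> * v" using A.eqv_sym by simp
        moreover have "\<ii> \<noteq> \<jj>" "neg \<ii> \<noteq> \<jj>" using 3 by (auto simp: seq_sim_def)
        ultimately show ?thesis by (simp add: T_0)
      qed
    qed
    finally show ?thesis .
  qed
  show "T (phi (gen g)) v \<asymp> gen g * v"
  proof (cases g)
    case (APsi_gen r \<ii>)
    show ?thesis
    proof (cases "\<ii> \<in> I")
      case True
      have "T (gPsi r * (gE \<ii> - gE (neg \<ii>))) v \<asymp> APsi r \<ii> * v"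
        by (rule general [where X = "\<lambda>\<ii>. APsi r \<ii>"]) (use True AE_APsi T_Psi_weight [OF v] APsi_neg [OF jI] in auto)
      with True APsi_gen show ?thesis by simp
    next
      case False
      with A.eqv_sym [OF A.eqv_mult_right [OF APsi_out, of r \<ii> v]] APsi_gen show ?thesis by simp
    qed
  next
    case (AY_gen r \<ii>)
    show ?thesis
    proof (cases "\<ii> \<in> I")
      case True
      have "T (gY r * (gE \<ii> - gE (neg \<ii>))) v \<asymp> AY r \<ii> * v"
        by (rule general [where X = "\<lambda>\<ii>. AY r \<ii>"]) (use True AE_AY T_Y_weight [OF v] AY_neg [OF jI] in auto)
      with True AY_gen show ?thesis by simp
    next
      case False
      with A.eqv_sym [OF A.eqv_mult_right [OF AY_out, of r \<ii> v]] AY_gen show ?thesis by simp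
    qed
  next
    case (AE_gen \<ii>)
    show ?thesis
    proof (cases "\<ii> \<in> I")
      case True
      have E: "T (gE \<ii> + gE (neg \<ii>)) v \<asymp> (v when \<ii> = \<jj>) + (v when neg \<ii> = \<jj>)"
        unfolding act_add by (intro A.eqv_add T_E_weight v)
      have "T (gE \<ii> + gE (neg \<ii>)) v \<asymp> AE \<ii> * v"
      proof (cases "neg \<jj> = \<jj>")
        case True
        have v0: "v \<asymp> 0" by (rule alt_weight_self_neg [OF v True])
        show ?thesis
          using T_eqv [OF v0, of "gE \<ii> + gE (neg \<ii>)"] A.eqv_mult_left [OF v0, of "AE \<ii>"]
          by (simp add: T_0) (meson A.eqv_sym A.eqv_trans)
      next
        case False
        then have "(v when \<ii> = \<jj>) + (v when neg \<ii> = \<jj>) = (v when seq_sim e \<ii> \<jj>)"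
          using True by (auto simp: seq_sim_def when_def)
        with E AE_alt_weight [OF v True] show ?thesis
          by simp (meson A.eqv_sym A.eqv_trans)
      qed
      with True AE_gen show ?thesis by simp
    next
      case False
      with A.eqv_sym [OF A.eqv_mult_right [OF AE_out, of \<ii> v]] AE_gen show ?thesis by simp
    qed
  qed
qed

text \<open>
  The composition of \<open>\<Phi>\<close> with the action is the regular representation; it suffices to compare the
  generators, because the block acts on its part of the module.
\<close>

lemma T_phi: "in_weight_sum v \<Longrightarrow> T (phi a) v \<asymp> a * v"
proof (induction a rule: free_induct)
  case (gen g a)
  have "T (phi (gen g * a)) v = T (phi (gen g)) (T (phi a) v)"
    by (simp only: free_lift_mult T_mult)
  also have "\<dots> \<asymp> gen g * T (phi a) v"
    by (intro T_phi_gen in_weight_sum_T gen)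
  also have "\<dots> \<asymp> gen g * (a * v)"
    by (intro A.eqv_mult_left gen)
  finally show ?case by (simp add: mult.assoc)
qed (auto simp: free_lift_simps act_add act_scale distrib_right scale_mult_left intro: A.eqv_add A.eqv_scale)

lemma phi_kernel_component: "phi a \<sim> 0 \<Longrightarrow> \<jj> \<in> seqs \<alpha> \<Longrightarrow> a * weight_proj \<jj> v \<asymp> 0"
proof -
  assume a: "phi a \<sim> 0" and j: "\<jj> \<in> seqs \<alpha>"
  have m: "in_weight_sum (weight_proj \<jj> v)"
    by (rule in_weight_sum_weight [OF j alt_weight_proj [OF seqs_class [OF j]]])
  show ?thesis
    using T_phi [OF m, of a] T_vanish [OF a m] A.eqv_sym A.eqv_trans by blast
qed

end

section \<open>Generation of the fixed points\<close>

lemma free_induct_right [case_names zero add scale one gen]: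
  assumes "P 0" "\<And>p q. P p \<Longrightarrow> P q \<Longrightarrow> P (p + q)" "\<And>c p. P p \<Longrightarrow> P (scale c p)"
    "P 1" "\<And>g p. P p \<Longrightarrow> P (p * gen g)"
  shows "P (p :: ('g, 'z::comm_ring_1) free)"
proof -
  have "P (q * p)" if "P q" for q
    using that
    by (induction p arbitrary: q rule: free_induct)
      (simp_all add: assms distrib_left scale_mult_right mult.assoc [symmetric])
  from this [OF assms(4)] show ?thesis by simp
qed

lemma free_lift_cong:
  assumes "p \<in> carrier (free_alg G)" "\<And>g. g \<in> G \<Longrightarrow> f g = f' g"
  shows "free_lift f p = free_lift f' p"
  unfolding free_lift_def using assms
  by (intro sum.cong refl arg_cong2 [where f = scale] arg_cong [where f = prod_list] map_cong)
    (auto simp: in_free_alg)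

lemma free_lift_in_free_alg:
  assumes "p \<in> carrier (free_alg G)" "\<And>g. g \<in> G \<Longrightarrow> f g \<in> carrier (free_alg G')"
  shows "free_lift f p \<in> carrier (free_alg G')"
proof -
  have "prod_list (map f w) \<in> carrier (free_alg G')" if "set w \<subseteq> G" for w
    using that by (induction w) (auto intro: assms(2))
  with assms(1) [unfolded in_free_alg] show ?thesis
    unfolding free_lift_def by (intro free_alg_sum free_alg_scale) blast
qed

context alternating_block
begin

abbreviation keq :: "int multiset \<Rightarrow> (klr_gen, 'z) free \<Rightarrow> (klr_gen, 'z) free \<Rightarrow> bool"
  where "keq \<alpha> \<equiv> eqv (klr_gens \<alpha>) (klr_rel e \<alpha>)"

lemma component: "\<alpha> \<in> \<gamma> \<Longrightarrow> alternating_component e n \<gamma> h \<alpha>"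
  by unfold_locales

lemma class_neg_neg: "\<alpha> \<in> \<gamma> \<Longrightarrow> neg_root e (neg_root e \<alpha>) = \<alpha>"
  by (rule neg_neg_root [OF class_roots [OF \<gamma>]])

lemma sgn_map_E: "\<ii> \<in> I \<Longrightarrow> sgn_map (gE \<ii>) = gE (neg \<ii>)"
  using class_seqs_set [OF \<gamma>, of \<ii>] by (simp add: sgn_map_gen_def)

lemma sgn_map_phi: "sgn_map (phi a) = phi a"
proof (induction a rule: free_induct)
  case (gen g a)
  have D: "sgn_map (gE \<ii> - gE (neg \<ii>)) = - (gE \<ii> - gE (neg \<ii>))"
    and S: "sgn_map (gE \<ii> + gE (neg \<ii>)) = gE \<ii> + gE (neg \<ii>)" if "\<ii> \<in> I" for \<ii>
    unfolding free_lift_diff free_lift_add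
    using that I_neg [OF that] by (simp_all only: sgn_map_E neg_neg minus_diff_eq add.commute)
  have "sgn_map (phi (gen g)) = phi (gen g)"
  proof (cases g)
    case (APsi_gen r \<ii>)
    then show ?thesis
      using D [of \<ii>] by (simp add: when_def free_lift_mult) (simp add: sgn_map_gen_def right_diff_distrib)
  next
    case (AY_gen r \<ii>)
    then show ?thesis
      using D [of \<ii>] by (simp add: when_def free_lift_mult) (simp add: sgn_map_gen_def right_diff_distrib)
  next
    case (AE_gen \<ii>)
    then show ?thesis
      using S [of \<ii>] by (simp add: when_def)
  qed
  with gen show ?case by (simp only: free_lift_mult)
qed (simp_all add: free_lift_simps)

text \<open>
  \<open>a = a \<cdot> 1\<close>, and 1 is the sum of its weight components.
\<close>

lemma phi_kernel:
  assumes "\<And>\<alpha>. \<alpha> \<in> \<gamma> \<Longrightarrow> keq \<alpha> (phi a) 0"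
  shows "a \<asymp> 0"
proof -
  have "a * 1 \<asymp> a * (\<Sum>\<jj>\<in>I. weight_proj \<jj> 1)"
    by (rule A.eqv_mult_left [OF sum_weight_proj])
  also have "\<dots> = (\<Sum>\<jj>\<in>I. a * weight_proj \<jj> 1)" by (rule sum_distrib_left)
  also have "\<dots> \<asymp> (\<Sum>\<jj>\<in>I. 0)"
  proof (rule A.eqv_sum)
    fix \<jj> assume "\<jj> \<in> I"
    then obtain \<alpha> where \<alpha>: "\<alpha> \<in> \<gamma>" "\<jj> \<in> seqs \<alpha>" by (rule class_seqsE [OF \<gamma>])
    then show "a * weight_proj \<jj> 1 \<asymp> 0"
      by (intro alternating_component.phi_kernel_component [OF component] assms)
  qed
  finally show ?thesis by simp
qed

text \<open>
  The component at \<open>\<beta>\<close> of \<open>x + sgn x\<close>, where \<open>x\<close> lies in the block of \<open>\<alpha>\<close>. The two terms are in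
  different components unless \<open>\<alpha>\<close> equals its negative.
\<close>

definition sgn_orbit :: "int multiset \<Rightarrow> (klr_gen, 'z) free \<Rightarrow> int multiset \<Rightarrow> (klr_gen, 'z) free"
  where "sgn_orbit \<alpha> x \<beta> = (x when \<beta> = \<alpha>) + (sgn_map x when \<beta> = neg_root e \<alpha>)"

definition has_lift :: "int multiset \<Rightarrow> (klr_gen, 'z) free \<Rightarrow> bool"
  where "has_lift \<alpha> x \<longleftrightarrow> (\<exists>a. \<forall>\<beta>\<in>\<gamma>. keq \<beta> (phi a) (sgn_orbit \<alpha> x \<beta>))"

lemma sgn_orbit_eqv:
  assumes "keq \<alpha> x y" "\<alpha> \<in> \<gamma>" "\<beta> \<in> \<gamma>"
  shows "keq \<beta> (sgn_orbit \<alpha> x \<beta>) (sgn_orbit \<alpha> y \<beta>)"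
proof -
  interpret alternating_component e n \<gamma> h \<beta> by (rule component) fact
  have "keq \<beta> (sgn_map x) (sgn_map y)" if "\<beta> = neg_root e \<alpha>"
    using assms(1) that class_neg_neg [OF assms(2)] by (intro sgn_eqv) simp
  then show ?thesis
    unfolding sgn_orbit_def using assms(1) by (intro K.eqv_add) (auto simp: when_def)
qed

lemma has_lift_eqv: "keq \<alpha> x y \<Longrightarrow> \<alpha> \<in> \<gamma> \<Longrightarrow> has_lift \<alpha> y \<Longrightarrow> has_lift \<alpha> x"
  unfolding has_lift_def
  using presentation.eqv_trans [OF klr_presentation] presentation.eqv_sym [OF klr_presentation] sgn_orbit_eqv
  by meson

lemma has_lift_0: "has_lift \<alpha> 0"
  unfolding has_lift_def
  by (intro exI [of _ 0]) (simp add: sgn_orbit_def when_def presentation.eqv_refl [OF klr_presentation])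

lemma has_lift_add: "has_lift \<alpha> x \<Longrightarrow> has_lift \<alpha> y \<Longrightarrow> has_lift \<alpha> (x + y)"
  unfolding has_lift_def
proof clarify
  fix a b assume "\<forall>\<beta>\<in>\<gamma>. keq \<beta> (phi a) (sgn_orbit \<alpha> x \<beta>)" "\<forall>\<beta>\<in>\<gamma>. keq \<beta> (phi b) (sgn_orbit \<alpha> y \<beta>)"
  then have "\<forall>\<beta>\<in>\<gamma>. keq \<beta> (phi a + phi b) (sgn_orbit \<alpha> x \<beta> + sgn_orbit \<alpha> y \<beta>)"
    using presentation.eqv_add [OF klr_presentation] by blast
  moreover have "sgn_orbit \<alpha> x \<beta> + sgn_orbit \<alpha> y \<beta> = sgn_orbit \<alpha> (x + y) \<beta>" for \<beta>
    by (simp add: sgn_orbit_def free_lift_add when_add_distrib)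
  ultimately show "\<exists>a. \<forall>\<beta>\<in>\<gamma>. keq \<beta> (phi a) (sgn_orbit \<alpha> (x + y) \<beta>)"
    by (intro exI [of _ "a + b"]) (simp add: free_lift_add)
qed

lemma has_lift_scale: "has_lift \<alpha> x \<Longrightarrow> has_lift \<alpha> (scale c x)"
  unfolding has_lift_def
proof clarify
  fix a assume "\<forall>\<beta>\<in>\<gamma>. keq \<beta> (phi a) (sgn_orbit \<alpha> x \<beta>)"
  then have "\<forall>\<beta>\<in>\<gamma>. keq \<beta> (scale c (phi a)) (scale c (sgn_orbit \<alpha> x \<beta>))"
    using presentation.eqv_scale [OF klr_presentation] by blast
  moreover have "scale c (sgn_orbit \<alpha> x \<beta>) = sgn_orbit \<alpha> (scale c x) \<beta>" for \<beta>
    by (simp add: sgn_orbit_def free_lift_scale when_def scale_add_right)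
  ultimately show "\<exists>a. \<forall>\<beta>\<in>\<gamma>. keq \<beta> (phi a) (sgn_orbit \<alpha> (scale c x) \<beta>)"
    by (intro exI [of _ "scale c a"]) (simp add: free_lift_scale)
qed

lemma has_lift_sum: "(\<And>x. x \<in> X \<Longrightarrow> has_lift \<alpha> (f x)) \<Longrightarrow> has_lift \<alpha> (sum f X)"
  by (induction X rule: infinite_finite_induct) (auto simp: has_lift_0 has_lift_add)

end

context alternating_component
begin

lemma in_weight_neg:
  assumes "alternating_component.in_weight e (neg_root e \<alpha>) \<jj> x"
  shows "in_weight (neg \<jj>) (sgn_map x)"
proof -
  interpret B: alternating_component e n \<gamma> h "neg_root e \<alpha>"
    by (rule component [OF class_neg_root [OF \<gamma> \<alpha>]])
  have j: "\<jj> \<in> seqs (neg_root e \<alpha>)" and E: "keq (neg_root e \<alpha>) (gE \<jj> * x) x"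
    using assms by (simp_all add: B.in_weight_def)
  from sgn_eqv [OF E] have "gE (neg \<jj>) * sgn_map x \<sim> sgn_map x"
    by (simp only: free_lift_mult sgn_map_E [OF B.seqs_class [OF j]])
  moreover have "neg \<jj> \<in> seqs \<alpha>"
    using seqs_neg [OF j, of e] by (simp add: class_neg_neg \<alpha>)
  ultimately show ?thesis by (simp add: in_weight_def)
qed

lemma has_lift_E: "\<ii> \<in> seqs \<alpha> \<Longrightarrow> has_lift \<alpha> (gE \<ii>)"
  unfolding has_lift_def
proof (intro exI [of _ "AE \<ii>"] ballI)
  fix \<beta> assume i: "\<ii> \<in> seqs \<alpha>" and \<beta>: "\<beta> \<in> \<gamma>"
  interpret B: presentation "klr_gens \<beta>" "klr_rel e \<beta> :: (klr_gen, 'z) free \<Rightarrow> _"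
    by (rule klr_presentation)
  have "E_gen \<ii> \<in> klr_gens \<beta> \<longleftrightarrow> \<beta> = \<alpha>"
    using i by (auto simp: klr_gens_iff seqs_def)
  moreover have "E_gen (neg \<ii>) \<in> klr_gens \<beta> \<longleftrightarrow> \<beta> = neg_root e \<alpha>"
    using i by (auto simp: klr_gens_iff seqs_def mset_neg_seq)
  ultimately have "keq \<beta> (gE \<ii>) (gE \<ii> when \<beta> = \<alpha>)" "keq \<beta> (gE (neg \<ii>)) (gE (neg \<ii>) when \<beta> = neg_root e \<alpha>)"
    by (simp_all add: when_def B.eqv_gen_out presentation.eqv_refl [OF klr_presentation])
  from B.eqv_add [OF this] show "keq \<beta> (phi (AE \<ii>)) (sgn_orbit \<alpha> (gE \<ii>) \<beta>)"
    unfolding sgn_orbit_def sgn_map_E [OF seqs_class [OF i]] using seqs_class [OF i] by simp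
qed

text \<open>
  Here \<open>g\<close> is one of the \<open>\<psi>\<^sub>r\<close> and \<open>y\<^sub>r\<close>. The factor \<open>e(\<jj>) - e(-\<jj>)\<close> fixes \<open>x\<close>, which has weight \<open>\<jj>\<close>, and
  negates \<open>sgn x\<close>, which has weight \<open>-\<jj>\<close>; this sign is the one by which \<open>sgn (g x)\<close> differs from
  \<open>g (sgn x)\<close>.
\<close>

lemma has_lift_odd:
  assumes x: "has_lift \<alpha> x" "in_weight \<jj> x" and nj: "neg \<jj> \<noteq> \<jj>"
    and g: "sgn_map g = - g" "phi b = g * (gE \<jj> - gE (neg \<jj>))"
  shows "has_lift \<alpha> (g * x)"
proof -
  from x(1) obtain a where a: "\<And>\<beta>. \<beta> \<in> \<gamma> \<Longrightarrow> keq \<beta> (phi a) (sgn_orbit \<alpha> x \<beta>)"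
    by (auto simp: has_lift_def)
  have "keq \<beta> (phi (b * a)) (sgn_orbit \<alpha> (g * x) \<beta>)" if \<beta>: "\<beta> \<in> \<gamma>" for \<beta>
  proof -
    interpret B: alternating_component e n \<gamma> h \<beta> by (rule component [OF \<beta>])
    let ?d = "gE \<jj> - gE (neg \<jj>) :: (klr_gen, 'z) free"
    have 1: "keq \<beta> (?d * (x when \<beta> = \<alpha>)) (x when \<beta> = \<alpha>)"
    proof (cases "\<beta> = \<alpha>")
      case True
      have "?d * x \<sim> (x when \<jj> = \<jj>) - (x when neg \<jj> = \<jj>)"
        unfolding left_diff_distrib by (intro K.eqv_diff E_in_weight x)
      with True nj show ?thesis by simp
    qed simp
    have 2: "keq \<beta> (?d * (sgn_map x when \<beta> = neg_root e \<alpha>)) (- sgn_map x when \<beta> = neg_root e \<alpha>)"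
    proof (cases "\<beta> = neg_root e \<alpha>")
      case True
      then have c: "B.in_weight (neg \<jj>) (sgn_map x)"
        using x(2) class_neg_neg [OF \<alpha>] by (intro B.in_weight_neg) simp
      have "keq \<beta> (?d * sgn_map x) ((sgn_map x when \<jj> = neg \<jj>) - (sgn_map x when neg \<jj> = neg \<jj>))"
        unfolding left_diff_distrib by (intro B.K.eqv_diff B.E_in_weight c)
      with True nj show ?thesis by simp
    qed simp
    have "keq \<beta> (phi (b * a)) (g * (?d * sgn_orbit \<alpha> x \<beta>))"
      unfolding free_lift_mult g(2) mult.assoc by (intro B.K.eqv_mult_left a \<beta>)
    also have "keq \<beta> (g * (?d * sgn_orbit \<alpha> x \<beta>)) (g * ((x when \<beta> = \<alpha>) + (- sgn_map x when \<beta> = neg_root e \<alpha>)))"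
      using B.K.eqv_mult_left [OF B.K.eqv_add [OF 1 2], of g] by (simp only: sgn_orbit_def distrib_left)
    also have "g * ((x when \<beta> = \<alpha>) + (- sgn_map x when \<beta> = neg_root e \<alpha>)) = sgn_orbit \<alpha> (g * x) \<beta>"
      by (simp add: sgn_orbit_def distrib_left free_lift_mult g(1) when_def)
    finally show ?thesis .
  qed
  then show ?thesis unfolding has_lift_def by blast
qed

lemma has_lift_gen:
  assumes x: "has_lift \<alpha> x" "in_weight \<jj> x"
  shows "\<exists>\<kk>. has_lift \<alpha> (gen g * x) \<and> in_weight \<kk> (gen g * x)"
proof -
  have zero: ?thesis if "gen g * x \<sim> 0"
  proof (intro exI conjI)
    show "has_lift \<alpha> (gen g * x)" by (rule has_lift_eqv [OF that \<alpha> has_lift_0])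
    have "gE \<jj> * (gen g * x) \<sim> gE \<jj> * 0" by (rule K.eqv_mult_left [OF that])
    then have "gE \<jj> * (gen g * x) \<sim> gen g * x"
      using K.eqv_trans [OF _ K.eqv_sym [OF that]] by simp
    then show "in_weight \<jj> (gen g * x)" using x(2) by (simp add: in_weight_def)
  qed
  have jI: "\<jj> \<in> I" using x(2) seqs_class by (simp add: in_weight_def)
  show ?thesis
  proof (cases "g \<notin> klr_gens \<alpha> \<or> neg \<jj> = \<jj>")
    case True
    then have "gen g * x \<sim> 0"
    proof
      assume "g \<notin> klr_gens \<alpha>"
      from K.eqv_mult_right [OF K.eqv_gen_out [OF this], of x] show ?thesis by simp
    next
      assume "neg \<jj> = \<jj>"
      from K.eqv_mult_left [OF weight_self_neg [OF x(2) this], of "gen g"] show ?thesis by simp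
    qed
    then show ?thesis by (rule zero)
  next
    case False
    then have g: "g \<in> klr_gens \<alpha>" and nj: "neg \<jj> \<noteq> \<jj>" by auto
    show ?thesis
    proof (cases g)
      case (Psi_gen r)
      with g have "1 \<le> r" "r < n" by (auto simp: klr_gens_iff)
      then show ?thesis
        using has_lift_odd [OF x nj, of "gPsi r" "APsi r \<jj>"] in_weight_Psi [OF x(2)] Psi_gen jI
        by (auto simp: sgn_map_gen_def)
    next
      case (Y_gen r)
      with g have "1 \<le> r" "r \<le> n" by (auto simp: klr_gens_iff)
      then show ?thesis
        using has_lift_odd [OF x nj, of "gY r" "AY r \<jj>"] in_weight_Y [OF x(2)] Y_gen jI
        by (auto simp: sgn_map_gen_def)
    next
      case (E_gen \<ii>)
      show ?thesis
      proof (cases "\<ii> = \<jj>")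
        case True
        have "gE \<jj> * x \<sim> x" "in_weight \<jj> (gE \<jj> * x)"
          using x(2) by (auto simp: in_weight_def intro: in_weight_E [unfolded in_weight_def, THEN conjunct2])
        with E_gen True show ?thesis
          using has_lift_eqv [OF _ \<alpha> x(1)] by auto
      next
        case False
        with E_in_weight [OF x(2), of \<ii>] E_gen show ?thesis by (intro zero) simp
      qed
    qed
  qed
qed

text \<open>
  A word is applied to an idempotent letter by letter from the right, since each letter maps liftable
  weight vectors to liftable weight vectors.
\<close>

lemma has_lift_all: "has_lift \<alpha> p"
proof -
  have ind: "has_lift \<alpha> x \<Longrightarrow> in_weight \<jj> x \<Longrightarrow> has_lift \<alpha> (p * x)" for x \<jj>
  proof (induction p arbitrary: x \<jj> rule: free_induct_right)
    case (gen g p)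
    from has_lift_gen [OF gen.prems, of g] obtain \<kk> where "has_lift \<alpha> (gen g * x)" "in_weight \<kk> (gen g * x)"
      by blast
    then show ?case unfolding mult.assoc by (rule gen.IH)
  qed (auto simp: has_lift_0 distrib_right has_lift_add scale_mult_left has_lift_scale)
  have "has_lift \<alpha> (p * (\<Sum>\<ii>\<in>seqs \<alpha>. gE \<ii>))"
    unfolding sum_distrib_left
    using in_weight_E [of _ 1] by (intro has_lift_sum ind has_lift_E) auto
  moreover have "p * 1 \<sim> p * (\<Sum>\<ii>\<in>seqs \<alpha>. gE \<ii>)"
    by (intro K.eqv_mult_left K.eqv_sym [OF K.eqv_rel] klr_rel.idem_sum)
  ultimately show ?thesis
    using has_lift_eqv [OF _ \<alpha>] by simp
qed

end

context alternating_block
begin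

text \<open>
  The sum of the orbits of all components \<open>p \<alpha>\<close> is \<open>p + sgn p = 2p\<close>, irrespective of whether the class
  has one or two elements.
\<close>

lemma phi_surj:
  assumes "\<And>\<alpha>. \<alpha> \<in> \<gamma> \<Longrightarrow> keq \<alpha> (sgn_map (p (neg_root e \<alpha>))) (p \<alpha>)"
  shows "\<exists>a. \<forall>\<beta>\<in>\<gamma>. keq \<beta> (phi a) (p \<beta>)"
proof -
  have "\<forall>\<alpha>\<in>\<gamma>. \<exists>a. \<forall>\<beta>\<in>\<gamma>. keq \<beta> (phi a) (sgn_orbit \<alpha> (p \<alpha>) \<beta>)"
    using alternating_component.has_lift_all [OF component] unfolding has_lift_def by blast
  then obtain a where a: "\<And>\<alpha> \<beta>. \<alpha> \<in> \<gamma> \<Longrightarrow> \<beta> \<in> \<gamma> \<Longrightarrow> keq \<beta> (phi (a \<alpha>)) (sgn_orbit \<alpha> (p \<alpha>) \<beta>)"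
    by metis
  have "keq \<beta> (phi (scale h (\<Sum>\<alpha>\<in>\<gamma>. a \<alpha>))) (p \<beta>)" if \<beta>: "\<beta> \<in> \<gamma>" for \<beta>
  proof -
    interpret B: presentation "klr_gens \<beta>" "klr_rel e \<beta> :: (klr_gen, 'z) free \<Rightarrow> _"
      by (rule klr_presentation)
    have "phi (scale h (\<Sum>\<alpha>\<in>\<gamma>. a \<alpha>)) = scale h (\<Sum>\<alpha>\<in>\<gamma>. phi (a \<alpha>))"
      by (simp add: free_lift_simps)
    also have "keq \<beta> \<dots> (scale h (\<Sum>\<alpha>\<in>\<gamma>. sgn_orbit \<alpha> (p \<alpha>) \<beta>))"
      by (intro B.eqv_scale B.eqv_sum a \<beta>)
    also have "(\<Sum>\<alpha>\<in>\<gamma>. sgn_orbit \<alpha> (p \<alpha>) \<beta>) = (\<Sum>\<alpha>\<in>\<gamma>. p \<alpha> when \<alpha> = \<beta>) + (\<Sum>\<alpha>\<in>\<gamma>. sgn_map (p \<alpha>) when \<alpha> = neg_root e \<beta>)"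
      unfolding sum.distrib [symmetric] using class_neg_neg \<beta>
      by (intro sum.cong) (auto simp: sgn_orbit_def when_def)
    also have "\<dots> = p \<beta> + sgn_map (p (neg_root e \<beta>))"
      using \<beta> class_neg_root [OF \<gamma> \<beta>] finite_class [OF \<gamma>] by (simp add: when_def)
    also have "keq \<beta> (scale h (p \<beta> + sgn_map (p (neg_root e \<beta>)))) (scale h (p \<beta> + p \<beta>))"
      by (intro B.eqv_scale B.eqv_add B.eqv_refl assms \<beta>)
    also have "scale h (p \<beta> + p \<beta>) = p \<beta>"
      by (simp only: scale_add_right scale_h_double)
    finally show ?thesis .
  qed
  then show ?thesis by blast
qed

section \<open>The isomorphism for one class of blocks\<close>

abbreviation kcls :: "int multiset \<Rightarrow> (klr_gen, 'z) free \<Rightarrow> (klr_gen, 'z) free set"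
  where "kcls \<alpha> \<equiv> cls (klr_gens \<alpha>) (klr_rel e \<alpha>)"

lemma kcls_eq_iff: "kcls \<alpha> p = kcls \<alpha> q \<longleftrightarrow> keq \<alpha> p q"
  by (rule presentation.cls_eq_iff [OF klr_presentation])

lemma sgn_block_cls:
  assumes \<alpha>: "\<alpha> \<in> \<gamma>"
  shows "sgn_block e \<alpha> (kcls (neg_root e \<alpha>) p) = kcls \<alpha> (sgn_map p)"
proof -
  interpret alternating_component e n \<gamma> h \<alpha> by (rule component [OF \<alpha>])
  interpret B: presentation "klr_gens (neg_root e \<alpha>)" "klr_rel e (neg_root e \<alpha>) :: (klr_gen, 'z) free \<Rightarrow> _"
    by (rule klr_presentation)
  have seqs: "neg \<ii> \<in> seqs \<alpha> \<and> \<ii> \<in> I" if "\<ii> \<in> seqs (neg_root e \<alpha>)" for \<ii>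
    using seqs_neg [OF that, of e] class_seqsI [OF \<gamma> class_neg_root [OF \<gamma> \<alpha>] that] class_neg_neg [OF \<alpha>]
    by simp
  have size: "size (neg_root e \<alpha>) = n"
    by (rule class_size [OF \<gamma> class_neg_root [OF \<gamma> \<alpha>]])
  have agree: "sgn_gen e g = sgn_map_gen e g" and closed: "sgn_map_gen e g \<in> carrier (free_alg (klr_gens \<alpha>))"
    if "g \<in> klr_gens (neg_root e \<alpha>)" for g
    using that seqs class_seqs_set [OF \<gamma>]
    by (cases g; force simp: sgn_map_gen_def klr_gens_iff size)+
  show ?thesis
    unfolding sgn_block_def
  proof (rule B.UN_cls_const)
    fix q assume "q \<in> kcls (neg_root e \<alpha>) p"
    then have q: "q \<in> carrier (free_alg (klr_gens (neg_root e \<alpha>)))" "keq (neg_root e \<alpha>) q p"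
      by (simp_all add: B.in_cls)
    have "free_lift (sgn_gen e) q = sgn_map q"
      by (rule free_lift_cong [OF q(1) agree])
    moreover have "sgn_map q \<in> carrier (free_alg (klr_gens \<alpha>))"
      by (rule free_lift_in_free_alg [OF q(1) closed])
    moreover have "keq \<alpha> (sgn_map q) (sgn_map p)"
      by (rule sgn_eqv [OF q(2)])
    ultimately show "rel_ideal (klr_gens \<alpha>) (klr_rel e \<alpha>) +>\<^bsub>free_alg (klr_gens \<alpha>)\<^esub> free_lift (sgn_gen e) q
        = kcls \<alpha> (sgn_map p)"
      by (simp add: K.coset_cls K.cls_eq_iff)
  qed
qed

definition phi_class :: "(alt_gen, 'z) free \<Rightarrow> int multiset \<Rightarrow> (klr_gen, 'z) free set"
  where "phi_class a = (\<lambda>\<alpha>\<in>\<gamma>. kcls \<alpha> (phi a))"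

lemma phi_class_eq_iff: "phi_class a = phi_class b \<longleftrightarrow> a \<asymp> b"
proof
  assume "phi_class a = phi_class b"
  then have "kcls \<alpha> (phi a) = kcls \<alpha> (phi b)" if "\<alpha> \<in> \<gamma>" for \<alpha>
    using that by (auto simp: phi_class_def dest: fun_cong [of _ _ \<alpha>])
  then have "keq \<alpha> (phi (a - b)) 0" if "\<alpha> \<in> \<gamma>" for \<alpha>
    using that unfolding kcls_eq_iff free_lift_diff
    by (intro presentation.eqv_diff_0 [OF klr_presentation, THEN iffD1]) blast
  then show "a \<asymp> b"
    using phi_kernel A.eqv_diff_0 by blast
next
  assume "a \<asymp> b"
  then show "phi_class a = phi_class b"
    unfolding phi_class_def
    by (intro restrict_ext) (simp add: kcls_eq_iff alternating_component.phi_eqv [OF component])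
qed

lemma carrier_klr_alt: "carrier (klr_alt e \<gamma>) = range phi_class"
proof (intro subset_antisym subsetI)
  fix x :: "int multiset \<Rightarrow> (klr_gen, 'z) free set"
  assume "x \<in> carrier (klr_alt e \<gamma>)"
  then have x: "x \<in> (\<Pi>\<^sub>E \<alpha>\<in>\<gamma>. carrier (klr_block e \<alpha>))" and fx: "klr_sgn e \<gamma> x = x"
    by (simp_all add: klr_alt_def fixed_subalg_def klr_sym_def alg_dsum_def)
  have "\<forall>\<alpha>\<in>\<gamma>. \<exists>p. x \<alpha> = kcls \<alpha> p"
    using x unfolding klr_block_def presentation.presented_carrier [OF klr_presentation] by blast
  then obtain p where p: "\<And>\<alpha>. \<alpha> \<in> \<gamma> \<Longrightarrow> x \<alpha> = kcls \<alpha> (p \<alpha>)" by metis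
  have "keq \<alpha> (sgn_map (p (neg_root e \<alpha>))) (p \<alpha>)" if \<alpha>: "\<alpha> \<in> \<gamma>" for \<alpha>
  proof -
    have "x \<alpha> = sgn_block e \<alpha> (x (neg_root e \<alpha>))"
      using fun_cong [OF fx, of \<alpha>] \<alpha> by (simp add: klr_sgn_def)
    then show ?thesis
      using \<alpha> class_neg_root [OF \<gamma> \<alpha>] by (simp add: p sgn_block_cls kcls_eq_iff [symmetric])
  qed
  from phi_surj [OF this] obtain a where a: "\<And>\<beta>. \<beta> \<in> \<gamma> \<Longrightarrow> keq \<beta> (phi a) (p \<beta>)" by blast
  have "x = phi_class a"
  proof
    fix \<beta>
    show "x \<beta> = phi_class a \<beta>"
      using x a [of \<beta>] p [of \<beta>] by (cases "\<beta> \<in> \<gamma>") (auto simp: phi_class_def kcls_eq_iff PiE_def extensional_def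
          intro: presentation.eqv_sym [OF klr_presentation])
  qed
  then show "x \<in> range phi_class" by blast
next
  fix x :: "int multiset \<Rightarrow> (klr_gen, 'z) free set"
  assume "x \<in> range phi_class"
  then obtain a where x: "x = phi_class a" by auto
  have "phi_class a \<in> (\<Pi>\<^sub>E \<alpha>\<in>\<gamma>. carrier (klr_block e \<alpha>))"
    unfolding phi_class_def klr_block_def presentation.presented_carrier [OF klr_presentation] by auto
  moreover have "klr_sgn e \<gamma> (phi_class a) = phi_class a"
    unfolding klr_sgn_def phi_class_def
    by (intro restrict_ext) (simp add: class_neg_root [OF \<gamma>] sgn_block_cls sgn_map_phi)
  ultimately show "x \<in> carrier (klr_alt e \<gamma>)"
    using finite_class [OF \<gamma>] by (simp add: x klr_alt_def fixed_subalg_def klr_sym_def alg_dsum_def)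
qed

lemma phi_class_ops:
  "phi_class a \<otimes>\<^bsub>klr_alt e \<gamma>\<^esub> phi_class b = phi_class (a * b)"
  "phi_class a \<oplus>\<^bsub>klr_alt e \<gamma>\<^esub> phi_class b = phi_class (a + b)"
  "c \<odot>\<^bsub>klr_alt e \<gamma>\<^esub> phi_class a = phi_class (scale c a)"
  "\<one>\<^bsub>klr_alt e \<gamma>\<^esub> = phi_class 1"
  by (auto simp: klr_alt_def fixed_subalg_def klr_sym_def alg_dsum_def phi_class_def klr_block_def
      presentation.presented_mult [OF klr_presentation] presentation.presented_add [OF klr_presentation]
      presentation.presented_smult [OF klr_presentation] presentation.presented_one [OF klr_presentation]
      free_lift_simps intro!: restrict_ext)

theorem klr_alt_iso_presented:
  "alg_iso (klr_alt e \<gamma> :: ('z, int multiset \<Rightarrow> (klr_gen, 'z) free set) module) (alt_presented e n \<gamma>) \<noteq> {}"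
proof -
  let ?A = "alt_presented e n \<gamma> :: ('z, (alt_gen, 'z) free set) module"
  let ?c = "cls (alt_gens n \<gamma>) (alt_rel e n \<gamma>) :: (alt_gen, 'z) free \<Rightarrow> _"
  \<comment> \<open>Well defined because the class of \<open>a\<close> is determined by \<open>phi_class a\<close>.\<close>
  define f where "f x = ?c (SOME a. phi_class a = x)" for x
  have f: "f (phi_class a) = ?c a" for a
  proof -
    have "phi_class (SOME b. phi_class b = phi_class a) = phi_class a" by (rule someI) simp
    then show ?thesis by (simp add: f_def phi_class_eq_iff A.cls_eq_iff)
  qed
  have "f \<in> ring_hom (klr_alt e \<gamma>) ?A"
    by (rule ring_hom_memI)
      (auto simp: carrier_klr_alt phi_class_ops f alt_presented_def A.presented_carrier A.presented_mult
        A.presented_add A.presented_one)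
  moreover have "bij_betw f (carrier (klr_alt e \<gamma>)) (carrier ?A)"
  proof (rule bij_betw_imageI)
    show "inj_on f (carrier (klr_alt e \<gamma>))"
      by (auto simp: inj_on_def carrier_klr_alt f A.cls_eq_iff phi_class_eq_iff)
    show "f ` carrier (klr_alt e \<gamma>) = carrier ?A"
      by (auto simp: carrier_klr_alt alt_presented_def A.presented_carrier f image_image)
  qed
  moreover have "\<forall>c. \<forall>x\<in>carrier (klr_alt e \<gamma>). f (c \<odot>\<^bsub>klr_alt e \<gamma>\<^esub> x) = c \<odot>\<^bsub>?A\<^esub> f x"
    by (auto simp: carrier_klr_alt phi_class_ops f alt_presented_def A.presented_smult)
  ultimately have "f \<in> alg_iso (klr_alt e \<gamma>) ?A"
    by (simp add: alg_iso_def ring_iso_def)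
  then show ?thesis by blast
qed

end

section \<open>The decomposition into classes of blocks\<close>

lemma root_class_eq:
  assumes "\<gamma> \<in> root_classes e n" "\<alpha> \<in> \<gamma>"
  shows "\<gamma> = {\<alpha>, neg_root e \<alpha>}"
  using assms by (elim root_classes_cases) (auto simp: neg_neg_root)

lemma root_class_mem: "\<alpha> \<in> roots e n \<Longrightarrow> {\<alpha>, neg_root e \<alpha>} \<in> root_classes e n"
  unfolding root_classes_def by (rule quotientI [THEN back_subst [of "\<lambda>x. x \<in> _"]]) auto

lemma klr_alt_simps:
  "x \<in> carrier (klr_alt e K) \<longleftrightarrow> x \<in> (\<Pi>\<^sub>E \<alpha>\<in>K. carrier (klr_block e \<alpha>)) \<and>
    finite {\<alpha>\<in>K. x \<alpha> \<noteq> \<zero>\<^bsub>klr_block e \<alpha>\<^esub>} \<and> klr_sgn e K x = x"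
  "x \<otimes>\<^bsub>klr_alt e K\<^esub> y = (\<lambda>\<alpha>\<in>K. x \<alpha> \<otimes>\<^bsub>klr_block e \<alpha>\<^esub> y \<alpha>)"
  "x \<oplus>\<^bsub>klr_alt e K\<^esub> y = (\<lambda>\<alpha>\<in>K. x \<alpha> \<oplus>\<^bsub>klr_block e \<alpha>\<^esub> y \<alpha>)"
  "c \<odot>\<^bsub>klr_alt e K\<^esub> x = (\<lambda>\<alpha>\<in>K. c \<odot>\<^bsub>klr_block e \<alpha>\<^esub> x \<alpha>)"
  "\<one>\<^bsub>klr_alt e K\<^esub> = (\<lambda>\<alpha>\<in>K. \<one>\<^bsub>klr_block e \<alpha>\<^esub>)"
  "\<zero>\<^bsub>klr_alt e K\<^esub> = (\<lambda>\<alpha>\<in>K. \<zero>\<^bsub>klr_block e \<alpha>\<^esub>)"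
  by (auto simp: klr_alt_def fixed_subalg_def klr_sym_def alg_dsum_def)

lemma alg_dsum_simps:
  "f \<in> carrier (alg_dsum K A) \<longleftrightarrow> f \<in> (\<Pi>\<^sub>E k\<in>K. carrier (A k)) \<and> finite {k\<in>K. f k \<noteq> \<zero>\<^bsub>A k\<^esub>}"
  "f \<otimes>\<^bsub>alg_dsum K A\<^esub> g = (\<lambda>k\<in>K. f k \<otimes>\<^bsub>A k\<^esub> g k)"
  "f \<oplus>\<^bsub>alg_dsum K A\<^esub> g = (\<lambda>k\<in>K. f k \<oplus>\<^bsub>A k\<^esub> g k)"
  "c \<odot>\<^bsub>alg_dsum K A\<^esub> f = (\<lambda>k\<in>K. c \<odot>\<^bsub>A k\<^esub> f k)"
  "\<one>\<^bsub>alg_dsum K A\<^esub> = (\<lambda>k\<in>K. \<one>\<^bsub>A k\<^esub>)"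
  by (auto simp: alg_dsum_def)

text \<open>
  Restriction commutes with the sign automorphism because each class contains with \<open>\<alpha>\<close> also its
  negative. A finitely supported family on the roots meets finitely many classes, and conversely
  finitely many classes contain finitely many roots.
\<close>

theorem klr_alt_decomposition:
  "(\<lambda>x. \<lambda>\<gamma>\<in>root_classes e n. restrict x \<gamma>)
    \<in> alg_iso (klr_alt e (roots e n) :: ('z::comm_ring_1, int multiset \<Rightarrow> (klr_gen, 'z) free set) module)
        (alg_dsum (root_classes e n) (klr_alt e))"
proof -
  let ?A = "klr_alt e (roots e n) :: ('z, int multiset \<Rightarrow> (klr_gen, 'z) free set) module"
  let ?B = "alg_dsum (root_classes e n) (klr_alt e) :: ('z, int multiset set \<Rightarrow> int multiset \<Rightarrow> (klr_gen, 'z) free set) module"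
  let ?h = "\<lambda>x :: int multiset \<Rightarrow> (klr_gen, 'z) free set. \<lambda>\<gamma>\<in>root_classes e n. restrict x \<gamma>"
  let ?cl = "\<lambda>\<alpha>. {\<alpha>, neg_root e \<alpha>}"
  have closed: "?h x \<in> carrier ?B" if "x \<in> carrier ?A" for x
  proof -
    from that have x: "x \<in> (\<Pi>\<^sub>E \<alpha>\<in>roots e n. carrier (klr_block e \<alpha>))"
      and fin: "finite {\<alpha>\<in>roots e n. x \<alpha> \<noteq> \<zero>\<^bsub>klr_block e \<alpha>\<^esub>}" and fx: "klr_sgn e (roots e n) x = x"
      by (simp_all add: klr_alt_simps)
    have "restrict x \<gamma> \<in> carrier (klr_alt e \<gamma>)" if \<gamma>: "\<gamma> \<in> root_classes e n" for \<gamma>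
    proof -
      have "klr_sgn e \<gamma> (restrict x \<gamma>) = restrict x \<gamma>"
        unfolding klr_sgn_def
      proof (rule restrict_ext)
        fix \<alpha> assume \<alpha>: "\<alpha> \<in> \<gamma>"
        then show "sgn_block e \<alpha> (restrict x \<gamma> (neg_root e \<alpha>)) = x \<alpha>"
          using fun_cong [OF fx, of \<alpha>] class_roots [OF \<gamma> \<alpha>] class_neg_root [OF \<gamma> \<alpha>]
          by (simp add: klr_sgn_def)
      qed
      then show ?thesis
        using x class_roots [OF \<gamma>] finite_class [OF \<gamma>] by (auto simp: klr_alt_simps)
    qed
    moreover have "finite {\<gamma>\<in>root_classes e n. restrict x \<gamma> \<noteq> \<zero>\<^bsub>klr_alt e \<gamma>\<^esub>}"
    proof (rule finite_subset)
      show "{\<gamma>\<in>root_classes e n. restrict x \<gamma> \<noteq> \<zero>\<^bsub>klr_alt e \<gamma>\<^esub>}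
          \<subseteq> ?cl ` {\<alpha>\<in>roots e n. x \<alpha> \<noteq> \<zero>\<^bsub>klr_block e \<alpha>\<^esub>}"
      proof clarify
        fix \<gamma> assume \<gamma>: "\<gamma> \<in> root_classes e n" and "restrict x \<gamma> \<noteq> \<zero>\<^bsub>klr_alt e \<gamma>\<^esub>"
        then obtain \<alpha> where \<alpha>: "\<alpha> \<in> \<gamma>" "x \<alpha> \<noteq> \<zero>\<^bsub>klr_block e \<alpha>\<^esub>"
          by (auto simp: klr_alt_simps restrict_def fun_eq_iff split: if_splits)
        with class_roots [OF \<gamma> \<alpha>(1)] root_class_eq [OF \<gamma> \<alpha>(1)]
        show "\<gamma> \<in> ?cl ` {\<alpha>\<in>roots e n. x \<alpha> \<noteq> \<zero>\<^bsub>klr_block e \<alpha>\<^esub>}" by auto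
      qed
    qed (use fin in simp)
    ultimately show ?thesis by (auto simp: alg_dsum_simps cong: conj_cong)
  qed
  have hom: "?h \<in> ring_hom ?A ?B"
    by (rule ring_hom_memI)
      (use closed class_roots in \<open>auto simp: klr_alt_simps(2-) alg_dsum_simps(2-) fun_eq_iff restrict_def\<close>)
  have inj: "inj_on ?h (carrier ?A)"
  proof (rule inj_onI)
    fix x y assume x: "x \<in> carrier ?A" and y: "y \<in> carrier ?A" and eq: "?h x = ?h y"
    show "x = y"
    proof
      fix \<alpha>
      show "x \<alpha> = y \<alpha>"
      proof (cases "\<alpha> \<in> roots e n")
        case True
        from fun_cong [OF fun_cong [OF eq, of "?cl \<alpha>"], of \<alpha>] root_class_mem [OF True] show ?thesis by simp
      next
        case False
        with x y show ?thesis by (auto simp: klr_alt_simps PiE_def extensional_def)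
      qed
    qed
  qed
  have surj: "carrier ?B \<subseteq> ?h ` carrier ?A"
  proof
    fix g assume g: "g \<in> carrier ?B"
    define x where "x = (\<lambda>\<alpha>\<in>roots e n. g (?cl \<alpha>) \<alpha>)"
    have gc: "g \<gamma> \<in> carrier (klr_alt e \<gamma>)" if "\<gamma> \<in> root_classes e n" for \<gamma>
      using g that by (auto simp: alg_dsum_simps)
    have fin: "finite {\<gamma>\<in>root_classes e n. g \<gamma> \<noteq> \<zero>\<^bsub>klr_alt e \<gamma>\<^esub>}"
      using g by (simp add: alg_dsum_simps)
    have xg: "x \<alpha> = g \<gamma> \<alpha>" if "\<gamma> \<in> root_classes e n" "\<alpha> \<in> \<gamma>" for \<alpha> \<gamma>
      using class_roots [OF that] root_class_eq [OF that] by (simp add: x_def)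
    have neg: "neg_root e \<alpha> \<in> ?cl \<alpha>" "\<alpha> \<in> ?cl \<alpha>" for \<alpha> by auto
    have "x \<in> (\<Pi>\<^sub>E \<alpha>\<in>roots e n. carrier (klr_block e \<alpha>))"
      using gc root_class_mem by (fastforce simp: x_def klr_alt_simps)
    moreover have "finite {\<alpha>\<in>roots e n. x \<alpha> \<noteq> \<zero>\<^bsub>klr_block e \<alpha>\<^esub>}"
    proof (rule finite_subset)
      show "{\<alpha>\<in>roots e n. x \<alpha> \<noteq> \<zero>\<^bsub>klr_block e \<alpha>\<^esub>} \<subseteq> \<Union>{\<gamma>\<in>root_classes e n. g \<gamma> \<noteq> \<zero>\<^bsub>klr_alt e \<gamma>\<^esub>}"
      proof
        fix \<alpha> assume "\<alpha> \<in> {\<alpha>\<in>roots e n. x \<alpha> \<noteq> \<zero>\<^bsub>klr_block e \<alpha>\<^esub>}"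
        then have \<alpha>: "?cl \<alpha> \<in> root_classes e n" "x \<alpha> \<noteq> \<zero>\<^bsub>klr_block e \<alpha>\<^esub>"
          by (auto intro: root_class_mem)
        with xg [OF \<alpha>(1) neg(2)] have "g (?cl \<alpha>) \<noteq> \<zero>\<^bsub>klr_alt e (?cl \<alpha>)\<^esub>"
          by (auto simp: klr_alt_simps)
        with \<alpha>(1) show "\<alpha> \<in> \<Union>{\<gamma>\<in>root_classes e n. g \<gamma> \<noteq> \<zero>\<^bsub>klr_alt e \<gamma>\<^esub>}" by blast
      qed
      show "finite (\<Union>{\<gamma>\<in>root_classes e n. g \<gamma> \<noteq> \<zero>\<^bsub>klr_alt e \<gamma>\<^esub>})"
        using fin by (intro finite_Union) (auto intro: finite_class)
    qed
    moreover have "klr_sgn e (roots e n) x = x"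
    proof
      fix \<alpha>
      show "klr_sgn e (roots e n) x \<alpha> = x \<alpha>"
      proof (cases "\<alpha> \<in> roots e n")
        case True
        note c = root_class_mem [OF True]
        have "klr_sgn e (?cl \<alpha>) (g (?cl \<alpha>)) = g (?cl \<alpha>)"
          using gc [OF c] by (simp add: klr_alt_simps)
        from fun_cong [OF this, of \<alpha>] True show ?thesis
          by (simp add: klr_sgn_def xg [OF c neg(1)] xg [OF c neg(2)])
      qed (simp add: klr_sgn_def x_def)
    qed
    ultimately have xA: "x \<in> carrier ?A" by (simp add: klr_alt_simps)
    have "?h x = g"
    proof
      fix \<gamma>
      show "?h x \<gamma> = g \<gamma>"
      proof (cases "\<gamma> \<in> root_classes e n")
        case True
        then have "restrict x \<gamma> = g \<gamma>"
          using gc [OF True] xg [OF True] by (auto simp: klr_alt_simps fun_eq_iff PiE_def extensional_def)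
        with True show ?thesis by simp
      next
        case False
        with g show ?thesis by (auto simp: alg_dsum_simps PiE_def extensional_def)
      qed
    qed
    with xA show "g \<in> ?h ` carrier ?A" by blast
  qed
  have "bij_betw ?h (carrier ?A) (carrier ?B)"
    using inj surj closed by (intro bij_betw_imageI subset_antisym) auto
  moreover have "\<forall>c. \<forall>x\<in>carrier ?A. ?h (c \<odot>\<^bsub>?A\<^esub> x) = c \<odot>\<^bsub>?B\<^esub> ?h x"
    using class_roots by (auto simp: klr_alt_simps(2-) alg_dsum_simps(2-) fun_eq_iff restrict_def)
  ultimately show ?thesis
    using hom by (simp add: alg_iso_def ring_iso_def)
qed

theorem theorem2:
  fixes e :: enat and n :: nat
  assumes "3 \<le> e"
    and "2 \<le> n"
    and "(2 :: 'z::idom) dvd 1"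
  shows "(\<lambda>x. \<lambda>\<gamma>\<in>root_classes e n. restrict x \<gamma>)
      \<in> alg_iso (klr_alt e (roots e n) :: ('z, int multiset \<Rightarrow> (klr_gen, 'z) free set) module)
          (alg_dsum (root_classes e n) (klr_alt e))
    \<and> (\<forall>\<gamma>\<in>root_classes e n.
        alg_iso (klr_alt e \<gamma> :: ('z, int multiset \<Rightarrow> (klr_gen, 'z) free set) module)
          (alt_presented e n \<gamma>) \<noteq> {})"
proof (intro conjI ballI klr_alt_decomposition)
  fix \<gamma> assume \<gamma>: "\<gamma> \<in> root_classes e n"
  from assms(3) obtain h :: 'z where h: "1 = 2 * h" by (rule dvdE)
  interpret alternating_block e n \<gamma> h
    by unfold_locales (use assms(1,2) \<gamma> h in \<open>simp_all only: mult_2\<close>)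
  show "alg_iso (klr_alt e \<gamma> :: ('z, int multiset \<Rightarrow> (klr_gen, 'z) free set) module)
      (alt_presented e n \<gamma>) \<noteq> {}"
    by (rule klr_alt_iso_presented)
qed

end
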